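(* Assume the setting described in the context. Then, as $n\to\infty$ along multiples of $T$, $$G^{\mathrm{FB}}-G^{\mathrm{SB}}_n=\exp\Big[-\tfrac1T\min_{a\in A^-}\mathrm{KL}(\mu_a,\mu_{a^*})\,n+o(n)\Big],\qquad G^{\mathrm{FB}}-G^{\mathrm{bin}}_n=\exp\Big[-\tfrac1T\min_{a\in A^-}\mathrm{KL}(\mu_a,\mu_{a^*})\,n+o(n)\Big].$$
   Context: Finite action set $A$; monitoring technology $\mu=(\mu_a)_{a\in A}$ of Borel probability measures on a signal space $X$ (subset of a Euclidean space), pairwise distinct, $\mu_{a'}\ll\mu_a$ for all $a,a'$, $\int(\frac{d\mu_{a'}}{d\mu_a})^\lambda d\mu_a<\infty$ for all $\lambda>0$; richness: for each $p\in(0,1)$ and $a\in A$ there is a measurable $Y\subseteq X$ with $\mu_a(Y)=p$. Fix $T\in\mathbb{N}\setminus\{0\}$ and $n$ divisible by $T$. The agent sequentially chooses $a_1,\dots,a_T\in A$; action $a_t$ generates $n/T$ i.i.d. signals $x^n_t\in X^{n/T}$ from $\mu_{a_t}$, observed by both parties. An agent strategy $\alpha=(\alpha_t)_{t=1}^T$ has $\alpha_t:X^{(t-1)n/T}\to A$ (action after past signals $x^n_1,\dots,x^n_{t-1}$). $\mathbb{E}_\alpha$ denotes expectation under $\alpha$. $\underline w\in\mathbb{R}$; $u:[\underline w,\infty)\to\mathbb{R}$ is $C^2$, $u'>0$, $u''<0$, $\lim_{w\to\infty}u'(w)=0$; $c:A\to\mathbb{R}$ with $c(A)\subseteq\mathrm{int}\,u([\underline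 w,\infty))$; $h=u^{-1}$. The principal chooses a utility contract $v:X^n\to u([\underline w,\infty))$ (function of all signals $x^n=(x^n_1,\dots,x^n_T)$) and a strategy $\alpha$, and receives $\mathbb{E}_\alpha[\frac1T\sum_t g(a_t)-h(v(x^n))]$ for a given $g:A\to\mathbb{R}$. (IC): $\mathbb{E}_\alpha[v(x^n)-\frac1T\sum_t c(a_t)]\ge\mathbb{E}_{\alpha'}[v(x^n)-\frac1T\sum_t c(a_t)]$ for all strategies $\alpha'$; (IR): $\mathbb{E}_\alpha[v(x^n)-\frac1T\sum_tc(a_t)]\ge0$. $G^{\mathrm{SB}}_n$ is the supremum of the principal's payoff over $(v,\alpha)$ satisfying (IC),(IR); $G^{\mathrm{bin}}_n$ the same with $v$ restricted to take exactly two values. The first-best problem imposes only (IR); it is assumed there is $a^*\in A$ such that the strategy $\alpha_t\equiv a^*$ for all $t$ is strictly optimal in the first-best problem for every $n$, so the first-best payoff is $G^{\mathrm{FB}}=g(a^* )-h(c(a^* ))$. Also $c(a^* )>c(a)$ for some $a$ and $c(a^* )\neq c(a)$ for all $a\neq a^*$. $A^-=\{a:c(a)<c(a^* )\}$. $\mathrm{KL}(\nu,\nu')=\int\log\frac{d\nu}{d\nu'}d\nu$. $f(n)=\exp[-rn+o(n)]$ means $\frac1n\log f(n)\to-r$. *)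

theory Defs
  imports "HOL-Probability.Probability"
begin

definition sig :: "'x::euclidean_space set \<Rightarrow> 'x measure" where
  "sig X = restrict_space borel X"

definition hspace :: "'x::euclidean_space set \<Rightarrow> nat \<Rightarrow> (nat \<Rightarrow> 'x) measure" where
  "hspace X k = PiM {..<k} (\<lambda>_. sig X)"

text \<open>Law of the first (t*m) signals when the agent follows strategy alpha; m = n/T signals
per period.  Period t (0-indexed) uses signal coordinates t*m ..< (t+1)*m; the action in
period t is alpha t applied to the history of the first t*m signals.\<close>
fun path :: "('a \<Rightarrow> 'x::euclidean_space measure) \<Rightarrow> 'x set \<Rightarrow> nat
      \<Rightarrow> (nat \<Rightarrow> (nat \<Rightarrow> 'x) \<Rightarrow> 'a) \<Rightarrow> nat \<Rightarrow> (nat \<Rightarrow> 'x) measure" where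
  "path \<mu> X m \<alpha> 0 = return (hspace X 0) (\<lambda>_. undefined)"
| "path \<mu> X m \<alpha> (Suc t) =
     path \<mu> X m \<alpha> t \<bind>
       (\<lambda>h. distr (PiM {t*m..<Suc t*m} (\<lambda>_. \<mu> (\<alpha> t h))) (hspace X (Suc t * m))
              (\<lambda>y. merge {..<t*m} {t*m..<Suc t*m} (h, y)))"

definition is_strategy :: "'x::euclidean_space set \<Rightarrow> nat \<Rightarrow> nat
      \<Rightarrow> (nat \<Rightarrow> (nat \<Rightarrow> 'x) \<Rightarrow> 'a) \<Rightarrow> bool" where
  "is_strategy X m T \<alpha> \<longleftrightarrow>
     (\<forall>t<T. \<alpha> t \<in> measurable (hspace X (t*m)) (count_space UNIV))"

definition act :: "(nat \<Rightarrow> (nat \<Rightarrow> 'x) \<Rightarrow> 'a) \<Rightarrow> nat \<Rightarrow> nat \<Rightarrow> (nat \<Rightarrow> 'x) \<Rightarrow> 'a" where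
  "act \<alpha> m t x = \<alpha> t (restrict x {..<t*m})"

definition hinv :: "(real \<Rightarrow> real) \<Rightarrow> real \<Rightarrow> real \<Rightarrow> real" where
  "hinv u w = the_inv_into {w..} u"

definition agent_util :: "('a \<Rightarrow> 'x::euclidean_space measure) \<Rightarrow> 'x set \<Rightarrow> nat \<Rightarrow> nat
      \<Rightarrow> ('a \<Rightarrow> real) \<Rightarrow> (nat \<Rightarrow> (nat \<Rightarrow> 'x) \<Rightarrow> 'a) \<Rightarrow> ((nat \<Rightarrow> 'x) \<Rightarrow> real) \<Rightarrow> real" where
  "agent_util \<mu> X T n c \<alpha> v =
     (\<integral>x. v x - (\<Sum>t<T. c (act \<alpha> (n div T) t x)) / real T \<partial>path \<mu> X (n div T) \<alpha> T)"

definition princ_pay :: "('a \<Rightarrow> 'x::euclidean_space measure) \<Rightarrow> 'x set \<Rightarrow> nat \<Rightarrow> nat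
      \<Rightarrow> (real \<Rightarrow> real) \<Rightarrow> real \<Rightarrow> ('a \<Rightarrow> real)
      \<Rightarrow> (nat \<Rightarrow> (nat \<Rightarrow> 'x) \<Rightarrow> 'a) \<Rightarrow> ((nat \<Rightarrow> 'x) \<Rightarrow> real) \<Rightarrow> real" where
  "princ_pay \<mu> X T n u w g \<alpha> v =
     (\<integral>x. (\<Sum>t<T. g (act \<alpha> (n div T) t x)) / real T - hinv u w (v x)
        \<partial>path \<mu> X (n div T) \<alpha> T)"

definition is_contract :: "'x::euclidean_space set \<Rightarrow> nat \<Rightarrow> (real \<Rightarrow> real) \<Rightarrow> real
      \<Rightarrow> ((nat \<Rightarrow> 'x) \<Rightarrow> real) \<Rightarrow> bool" where
  "is_contract X n u w v \<longleftrightarrow>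
     v \<in> borel_measurable (hspace X n) \<and> (\<forall>x\<in>space (hspace X n). v x \<in> u ` {w..})"

definition fb_feasible :: "('a \<Rightarrow> 'x::euclidean_space measure) \<Rightarrow> 'x set \<Rightarrow> nat \<Rightarrow> nat
      \<Rightarrow> (real \<Rightarrow> real) \<Rightarrow> real \<Rightarrow> ('a \<Rightarrow> real)
      \<Rightarrow> (nat \<Rightarrow> (nat \<Rightarrow> 'x) \<Rightarrow> 'a) \<Rightarrow> ((nat \<Rightarrow> 'x) \<Rightarrow> real) \<Rightarrow> bool" where
  "fb_feasible \<mu> X T n u w c \<alpha> v \<longleftrightarrow>
     is_strategy X (n div T) T \<alpha> \<and> is_contract X n u w v
     \<and> integrable (path \<mu> X (n div T) \<alpha> T) v
     \<and> integrable (path \<mu> X (n div T) \<alpha> T) (\<lambda>x. hinv u w (v x))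
     \<and> agent_util \<mu> X T n c \<alpha> v \<ge> 0"

text \<open>Feasibility in the second-best problem: (IR) and (IC); E_alpha'[v] is required to be
finite for every strategy alpha' (v is bounded below, so E_alpha'[v] = +infinity would
violate (IC) anyway).\<close>
definition sb_feasible :: "('a \<Rightarrow> 'x::euclidean_space measure) \<Rightarrow> 'x set \<Rightarrow> nat \<Rightarrow> nat
      \<Rightarrow> (real \<Rightarrow> real) \<Rightarrow> real \<Rightarrow> ('a \<Rightarrow> real)
      \<Rightarrow> (nat \<Rightarrow> (nat \<Rightarrow> 'x) \<Rightarrow> 'a) \<Rightarrow> ((nat \<Rightarrow> 'x) \<Rightarrow> real) \<Rightarrow> bool" where
  "sb_feasible \<mu> X T n u w c \<alpha> v \<longleftrightarrow>
     fb_feasible \<mu> X T n u w c \<alpha> v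
     \<and> (\<forall>\<alpha>'. is_strategy X (n div T) T \<alpha>' \<longrightarrow>
            integrable (path \<mu> X (n div T) \<alpha>' T) v
          \<and> agent_util \<mu> X T n c \<alpha>' v \<le> agent_util \<mu> X T n c \<alpha> v)"

definition fb_value :: "('a \<Rightarrow> 'x::euclidean_space measure) \<Rightarrow> 'x set \<Rightarrow> nat \<Rightarrow> nat
      \<Rightarrow> (real \<Rightarrow> real) \<Rightarrow> real \<Rightarrow> ('a \<Rightarrow> real) \<Rightarrow> ('a \<Rightarrow> real)
      \<Rightarrow> (nat \<Rightarrow> (nat \<Rightarrow> 'x) \<Rightarrow> 'a) \<Rightarrow> real" where
  "fb_value \<mu> X T n u w c g \<alpha> =
     Sup {princ_pay \<mu> X T n u w g \<alpha> v | v. fb_feasible \<mu> X T n u w c \<alpha> v}"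

definition G_SB :: "('a \<Rightarrow> 'x::euclidean_space measure) \<Rightarrow> 'x set \<Rightarrow> nat \<Rightarrow> nat
      \<Rightarrow> (real \<Rightarrow> real) \<Rightarrow> real \<Rightarrow> ('a \<Rightarrow> real) \<Rightarrow> ('a \<Rightarrow> real) \<Rightarrow> real" where
  "G_SB \<mu> X T n u w c g =
     Sup {princ_pay \<mu> X T n u w g \<alpha> v | \<alpha> v. sb_feasible \<mu> X T n u w c \<alpha> v}"

definition G_bin :: "('a \<Rightarrow> 'x::euclidean_space measure) \<Rightarrow> 'x set \<Rightarrow> nat \<Rightarrow> nat
      \<Rightarrow> (real \<Rightarrow> real) \<Rightarrow> real \<Rightarrow> ('a \<Rightarrow> real) \<Rightarrow> ('a \<Rightarrow> real) \<Rightarrow> real" where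
  "G_bin \<mu> X T n u w c g =
     Sup {princ_pay \<mu> X T n u w g \<alpha> v | \<alpha> v. sb_feasible \<mu> X T n u w c \<alpha> v
                                          \<and> card (v ` space (hspace X n)) = 2}"

text \<open>KL(nu, nu') = integral of log (d nu / d nu') d nu, natural logarithm.\<close>
definition KL :: "'x measure \<Rightarrow> 'x measure \<Rightarrow> real" where
  "KL \<nu> \<nu>' = KL_divergence (exp 1) \<nu>' \<nu>"

end

theory Submission
  imports Defs
begin

text \<open>Write \<open>k = n / T\<close> for the number of signals per period.  Both rates are those of Stein's lemma
  for testing \<open>astar\<close> against a cheaper action \<open>a\<close> on the basis of one period.

  For the lower bound on the loss, let the agent replace \<open>astar\<close> by \<open>a\<close> in the last period only.  By
  (IC) this deviation must lower the expected utility payment by an amount bounded away from \<open>0\<close>, so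
  under the deviation the payment is low with probability bounded away from \<open>0\<close>.  The change of
  measure costs at most \<open>exp (s k)\<close> for any \<open>s > KL (\<mu> a) (\<mu> astar)\<close>; hence on the path of play the
  payment is low with probability at least of order \<open>exp (- s k)\<close>, and strict concavity of \<open>u\<close> turns
  this into a loss of the same order.  Strategies that often avoid \<open>astar\<close> in the last period lose a
  fixed amount because \<open>astar\<close> is strictly first-best optimal.

  For the upper bound, pay one of two wages: the lowest one as soon as in some period the likelihood
  ratio of some cheaper action exceeds \<open>exp (s k)\<close>, where \<open>s < KL (\<mu> a) (\<mu> astar)\<close>.  Under \<open>astar\<close>
  this happens with probability at most of order \<open>exp (- s k)\<close> by Markov's inequality, whereas shirking
  in any period is detected with probability close to \<open>1\<close> by the law of large numbers.  A potential
  function which is a supermartingale under every strategy, and a martingale under the intended one,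
  yields (IC).\<close>

section \<open>Likelihood ratio tests on product measures\<close>

text \<open>The fixed loss away from \<open>astar\<close> must be uniform in the number of signals,
  while strict optimality is assumed for each \<open>n\<close> separately. Gains and costs depend on
  a strategy only through its expected action frequencies, a point of a simplex that does not
  involve \<open>n\<close>; compactness then gives a uniform gap once strictness is known for every
  lottery over actions. Richness is used for lotteries between two actions in one of the
  \<open>T\<close> periods. These yield a first-order condition at \<open>astar\<close>, and strict
  concavity extends it to all lotteries.

  In the construction, staying unrejected costs the agent more than shirking, so the stake in not
  being rejected is smallest in the first period. In the limit it still exceeds the cost saving of
  one period, because \<open>c amin\<close> is larger than \<open>u w\<close>; this uses the
  interior condition on costs. The same condition at \<open>astar\<close> leaves room for a wage
  above the first-best one, needed to pay for false alarms.\<close>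

lemma PiM_density:
  fixes f :: "'b \<Rightarrow> ennreal"
  assumes N: "prob_space N" and M: "prob_space M"
    and f[measurable]: "f \<in> borel_measurable N" and d: "density N f = M" and I: "finite I"
  shows "PiM I (\<lambda>_. M) = density (PiM I (\<lambda>_. N)) (\<lambda>x. \<Prod>i\<in>I. f (x i))"
proof -
  interpret N: product_prob_space "\<lambda>_. N" I
    using N by (auto intro!: product_prob_spaceI)
  interpret M: product_prob_space "\<lambda>_. M" I
    using M by (auto intro!: product_prob_spaceI)
  have sets_M: "sets M = sets N" using d by auto
  show ?thesis
  proof (rule M.PiM_eqI[symmetric, OF I])
    show "sets (density (PiM I (\<lambda>_. N)) (\<lambda>x. \<Prod>i\<in>I. f (x i))) = sets (PiM I (\<lambda>_. M))"
      using sets_M by (simp cong: sets_PiM_cong)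
  next
    fix A assume A: "\<And>i. i \<in> I \<Longrightarrow> A i \<in> sets M"
    then have A'[measurable]: "i \<in> I \<Longrightarrow> A i \<in> sets N" for i using sets_M by auto
    have "emeasure (density (PiM I (\<lambda>_. N)) (\<lambda>x. \<Prod>i\<in>I. f (x i))) (Pi\<^sub>E I A)
      = (\<integral>\<^sup>+x. (\<Prod>i\<in>I. f (x i)) * indicator (Pi\<^sub>E I A) x \<partial>PiM I (\<lambda>_. N))"
      using I A' by (intro emeasure_density) (auto intro!: sets_PiM_I_finite)
    also have "\<dots> = (\<integral>\<^sup>+x. (\<Prod>i\<in>I. f (x i) * indicator (A i) (x i)) \<partial>PiM I (\<lambda>_. N))"
      using I by (intro nn_integral_cong)
        (auto simp: prod.distrib indicator_def space_PiM PiE_iff prod_zero_iff split: if_splits)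
    also have "\<dots> = (\<Prod>i\<in>I. \<integral>\<^sup>+x. f x * indicator (A i) x \<partial>N)"
      using I by (intro N.product_nn_integral_prod) auto
    also have "\<dots> = (\<Prod>i\<in>I. emeasure M (A i))"
      using A' by (intro prod.cong refl) (auto simp: emeasure_density d[symmetric])
    finally show "emeasure (density (PiM I (\<lambda>_. N)) (\<lambda>x. \<Prod>i\<in>I. f (x i))) (Pi\<^sub>E I A)
      = (\<Prod>i\<in>I. emeasure M (A i))" .
  qed
qed

text \<open>Chebyshev's inequality: independence makes the mixed second moments vanish, so the
  variance of the sum grows only linearly in \<open>k\<close>.\<close>

lemma PiM_weak_law:
  fixes \<phi> :: "'b \<Rightarrow> real" and I :: "'i set"
  assumes M: "prob_space M" and i1: "integrable M \<phi>" and i2: "integrable M (\<lambda>x. (\<phi> x)\<^sup>2)"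
    and I: "finite I" "card I = k" "k > 0" and e: "e > 0"
  shows "measure (PiM I (\<lambda>_. M)) {y \<in> space (PiM I (\<lambda>_. M)).
      e * real k \<le> \<bar>(\<Sum>i\<in>I. \<phi> (y i)) - real k * (\<integral>x. \<phi> x \<partial>M)\<bar>}
    \<le> (\<integral>x. (\<phi> x - (\<integral>x. \<phi> x \<partial>M))\<^sup>2 \<partial>M) / (real k * e\<^sup>2)"
proof -
  define K where "K = (\<integral>x. \<phi> x \<partial>M)"
  define Z where "Z x = \<phi> x - K" for x
  interpret M: prob_space M by fact
  interpret P: product_prob_space "\<lambda>_. M" I
    using M by (auto intro!: product_prob_spaceI)
  let ?P = "PiM I (\<lambda>_. M)"
  have Z1: "integrable M Z" using i1 by (auto simp: Z_def[abs_def])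
  have Z0: "(\<integral>x. Z x \<partial>M) = 0" using i1 by (auto simp: Z_def K_def M.prob_space)
  have Z2: "integrable M (\<lambda>x. Z x * Z x)"
  proof -
    have "integrable M (\<lambda>x. (\<phi> x)\<^sup>2 - 2 * K * \<phi> x + K\<^sup>2)" using i1 i2 by auto
    then show ?thesis
      by (rule arg_cong[where f="integrable M", THEN iffD1, rotated])
        (auto simp: Z_def power2_eq_square algebra_simps fun_eq_iff)
  qed
  \<comment> \<open>\<open>G i j\<close> spreads \<open>Z (y i) * Z (y j)\<close> over all
    coordinates, with factor \<open>1\<close> elsewhere, so that one product formula covers both
    \<open>i = j\<close> and the mixed terms.\<close>
  define G where "G (i :: 'i) j l x = (if l = i then Z x else 1) * (if l = j then Z x else 1)" for i j l x
  have Gi: "integrable M (G i j l)" for i j l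
    using Z1 Z2 by (cases "l = i"; cases "l = j") (simp_all add: G_def[abs_def])
  have prodG: "(\<Prod>l\<in>I. G i j l (y l)) = Z (y i) * Z (y j)" if "i \<in> I" "j \<in> I" for i j y
    using that I unfolding G_def by (simp add: prod.distrib prod.delta)
  have int: "integrable ?P (\<lambda>y. Z (y i) * Z (y j))" if "i \<in> I" "j \<in> I" for i j
    using P.product_integrable_prod[OF I(1), of "\<lambda>l. G i j l"] Gi prodG[OF that] by simp
  have ex: "(\<integral>y. Z (y i) * Z (y j) \<partial>?P) = (if i = j then (\<integral>x. Z x * Z x \<partial>M) else 0)"
    if "i \<in> I" "j \<in> I" for i j
  proof -
    have "(\<integral>y. Z (y i) * Z (y j) \<partial>?P) = (\<Prod>l\<in>I. \<integral>x. G i j l x \<partial>M)"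
      using P.product_integral_prod[OF I(1), of "\<lambda>l. G i j l"] Gi prodG[OF that] by simp
    also have "\<dots> = (if i = j then (\<integral>x. Z x * Z x \<partial>M) else 0)"
    proof (cases "i = j")
      case True
      have "(\<Prod>l\<in>I. \<integral>x. G i j l x \<partial>M) = (\<Prod>l\<in>I. if l = j then (\<integral>x. Z x * Z x \<partial>M) else 1)"
        using True by (intro prod.cong) (auto simp: G_def M.prob_space)
      then show ?thesis using True that I by simp
    next
      case False
      then have "(\<integral>x. G i j i x \<partial>M) = 0" by (auto simp: G_def Z0)
      then show ?thesis using False that I by (auto intro!: prod_zero)
    qed
    finally show ?thesis .
  qed
  have sq: "(\<Sum>i\<in>I. Z (y i))\<^sup>2 = (\<Sum>i\<in>I. \<Sum>j\<in>I. Z (y i) * Z (y j))" for y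
    by (simp add: power2_eq_square sum_product)
  have S2: "integrable ?P (\<lambda>y. (\<Sum>i\<in>I. Z (y i))\<^sup>2)"
    unfolding sq using int by (intro Bochner_Integration.integrable_sum) auto
  have E2: "(\<integral>y. (\<Sum>i\<in>I. Z (y i))\<^sup>2 \<partial>?P) = real k * (\<integral>x. Z x * Z x \<partial>M)"
  proof -
    have "(\<integral>y. (\<Sum>i\<in>I. Z (y i))\<^sup>2 \<partial>?P) = (\<Sum>i\<in>I. \<Sum>j\<in>I. \<integral>y. Z (y i) * Z (y j) \<partial>?P)"
      unfolding sq by (simp add: Bochner_Integration.integral_sum Bochner_Integration.integrable_sum int)
    also have "\<dots> = (\<Sum>i\<in>I. \<Sum>j\<in>I. if i = j then (\<integral>x. Z x * Z x \<partial>M) else 0)"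
      by (intro sum.cong refl ex)
    also have "\<dots> = real k * (\<integral>x. Z x * Z x \<partial>M)" using I by simp
    finally show ?thesis .
  qed
  have eq: "(\<Sum>i\<in>I. \<phi> (y i)) - real k * K = (\<Sum>i\<in>I. Z (y i))" for y
    using I by (simp add: Z_def sum_subtractf)
  have ek: "e * real k > 0" using e I by simp
  have "{y \<in> space ?P. e * real k \<le> \<bar>\<Sum>i\<in>I. Z (y i)\<bar>}
      = {y \<in> space ?P. (e * real k)\<^sup>2 \<le> (\<Sum>i\<in>I. Z (y i))\<^sup>2}"
    using ek abs_le_square_iff[of "e * real k"] by auto
  also have "measure ?P \<dots> \<le> (\<integral>y. (\<Sum>i\<in>I. Z (y i))\<^sup>2 \<partial>?P) / (e * real k)\<^sup>2"
    using ek S2 I e by (intro integral_Markov_inequality_measure[where A="{}"]) auto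
  also have "\<dots> = (\<integral>x. (Z x)\<^sup>2 \<partial>M) / (real k * e\<^sup>2)"
    using I e unfolding E2 by (simp add: field_simps power2_eq_square)
  finally show ?thesis by (simp add: eq K_def[symmetric] Z_def[symmetric])
qed

section \<open>Log-likelihoods and the error probabilities of the test\<close>

locale likelihood_ratio = N: prob_space N + M: prob_space M
  for N M :: "'b measure" +
  fixes f :: "'b \<Rightarrow> real"
  assumes f_meas[measurable]: "f \<in> borel_measurable N"
    and f_nonneg: "\<And>x. 0 \<le> f x"
    and density_f: "density N (\<lambda>x. ennreal (f x)) = M"
    and f_sq: "integrable N (\<lambda>x. (f x)\<^sup>2)"
begin

definition "info = (\<integral>x. ln (f x) \<partial>M)"
definition "info_var = (\<integral>x. (ln (f x) - info)\<^sup>2 \<partial>M)"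

lemma sets_M[measurable_cong, simp]: "sets M = sets N"
  by (simp add: density_f[symmetric])

lemma integrable_M_iff:
  fixes g :: "'b \<Rightarrow> real"
  assumes "g \<in> borel_measurable N"
  shows "integrable M g \<longleftrightarrow> integrable N (\<lambda>x. f x * g x)"
  using assms f_nonneg by (subst density_f[symmetric]) (subst integrable_density, auto)

lemma AE_pos: "AE x in M. 0 < f x"
  using f_nonneg by (subst density_f[symmetric]) (auto simp: AE_density)

text \<open>Integrating against \<open>M\<close> means multiplying by \<open>f\<close> and
  integrating against \<open>N\<close>. These bounds therefore let the second moment of
  \<open>f\<close> under \<open>N\<close> control the first two moments of \<open>ln f\<close> under
  \<open>M\<close>.\<close>

lemma ln_bounds:
  assumes "0 \<le> (t::real)"
  shows "\<bar>t * ln t\<bar> \<le> 1 + t\<^sup>2" "\<bar>t * (ln t)\<^sup>2\<bar> \<le> 4 + 4 * t\<^sup>2"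
proof -
  show 1: "\<bar>t * ln t\<bar> \<le> 1 + t\<^sup>2"
  proof (cases "t = 0")
    case False
    then have t: "t > 0" using assms by simp
    have "ln t \<le> t" using ln_le_minus_one[OF t] by simp
    then have a: "t * ln t \<le> t\<^sup>2" using t by (simp add: power2_eq_square)
    have "- ln t \<le> 1 / t" using ln_le_minus_one[of "1/t"] t by (simp add: ln_div)
    then have b: "- (t * ln t) \<le> 1" using t by (simp add: field_simps)
    show ?thesis using a b zero_le_power2[of t] by linarith
  qed simp
  show "\<bar>t * (ln t)\<^sup>2\<bar> \<le> 4 + 4 * t\<^sup>2"
  proof (cases "t = 0")
    case False
    then have t: "t > 0" using assms by simp
    \<comment> \<open>With \<open>t = r^2\<close> the term becomes \<open>4 * (r * ln r)^2\<close>,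
      where \<open>r * ln r\<close> is bounded by \<open>1\<close> for \<open>r\<close> up to
      \<open>1\<close> and by \<open>t\<close> beyond.\<close>
    define r where "r = sqrt t"
    have r: "r > 0" "t = r\<^sup>2" using t by (auto simp: r_def)
    have l: "ln t = 2 * ln r" using r by (simp add: ln_realpow)
    have "t * (ln t)\<^sup>2 = 4 * (r * ln r)\<^sup>2" unfolding l using r by (simp add: power_mult_distrib)
    moreover have "(r * ln r)\<^sup>2 \<le> 1 + t\<^sup>2"
    proof (cases "r \<le> 1")
      case True
      have "- ln r \<le> 1 / r" using ln_le_minus_one[of "1/r"] r by (simp add: ln_div)
      then have "- (r * ln r) \<le> 1" using r by (simp add: field_simps)
      moreover have "r * ln r \<le> 0" using r True by (simp add: mult_nonneg_nonpos)
      ultimately have "\<bar>r * ln r\<bar> \<le> 1" by linarith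
      then show ?thesis using abs_square_le_1[of "r * ln r"] zero_le_power2[of t] by linarith
    next
      case False
      have "ln r \<le> r" using ln_le_minus_one[of r] r by simp
      then have "r * ln r \<le> t" using r by (simp add: power2_eq_square)
      moreover have "0 \<le> r * ln r" using r False by simp
      ultimately have "(r * ln r)\<^sup>2 \<le> t\<^sup>2" by (intro power_mono)
      then show ?thesis by simp
    qed
    ultimately show ?thesis using t by simp
  qed simp
qed

lemma integrable_ln: "integrable M (\<lambda>x. ln (f x))"
proof (subst integrable_M_iff)
  show "integrable N (\<lambda>x. f x * ln (f x))"
  proof (rule Bochner_Integration.integrable_bound)
    show "integrable N (\<lambda>x. 1 + (f x)\<^sup>2)" using f_sq by auto
  qed (use ln_bounds(1)[OF f_nonneg] in \<open>auto intro: order_trans\<close>)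
qed simp

lemma integrable_ln_sq: "integrable M (\<lambda>x. (ln (f x))\<^sup>2)"
proof (subst integrable_M_iff)
  show "integrable N (\<lambda>x. f x * (ln (f x))\<^sup>2)"
  proof (rule Bochner_Integration.integrable_bound)
    show "integrable N (\<lambda>x. 4 + 4 * (f x)\<^sup>2)" using f_sq by auto
  qed (use ln_bounds(2)[OF f_nonneg] in \<open>auto intro: order_trans\<close>)
qed simp

lemma KL_eq_info: "KL M N = info"
proof -
  have "AE x in N. ennreal (f x) = RN_deriv N M x"
    by (rule N.RN_deriv_unique) (auto simp: density_f)
  then have "AE x in M. ennreal (f x) = RN_deriv N M x"
    by (subst density_f[symmetric]) (auto simp: AE_density)
  then have "AE x in M. entropy_density (exp 1) N M x = ln (f x)"
    by eventually_elim (metis comp_apply enn2real_ennreal entropy_density_def f_nonneg log_def ln_exp div_by_1)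
  then show ?thesis
    unfolding KL_def KL_divergence_def info_def
    by (intro integral_cong_AE) (auto simp: entropy_density_def)
qed

lemma info_pos:
  assumes "M \<noteq> N"
  shows "0 < info"
proof -
  interpret information_space N "exp 1" by unfold_locales simp
  have int: "integrable N (\<lambda>x. f x * log (exp 1) (f x))"
    using integrable_ln by (subst (asm) integrable_M_iff) (auto simp: log_def)
  have "0 < KL_divergence (exp 1) N (density N f)"
    by (rule KL_gt_0) (use f_nonneg int assms density_f M.prob_space_axioms in auto)
  then show ?thesis using KL_eq_info unfolding KL_def density_f by simp
qed

lemma prod_meas[measurable]:
  "finite I \<Longrightarrow> (\<lambda>y. \<Prod>i\<in>I. f (y i)) \<in> borel_measurable (PiM I (\<lambda>_. N))"
  by measurable

text \<open>In HOL \<open>ln 0 = 0\<close>, so the identity fails where some factor vanishes; such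
  points are null under \<open>M\<close>.\<close>

lemma AE_prod_exp:
  assumes "finite I"
  shows "AE y in PiM I (\<lambda>_. M). (\<Prod>i\<in>I. f (y i)) = exp (\<Sum>i\<in>I. ln (f (y i)))"
proof -
  interpret P: product_prob_space "\<lambda>_. M" I
    using M.prob_space_axioms by (auto intro!: product_prob_spaceI)
  have "AE y in PiM I (\<lambda>_. M). \<forall>i\<in>I. 0 < f (y i)"
    using assms AE_pos by (intro AE_finite_allI) (auto intro: P.AE_component)
  then show ?thesis
    by eventually_elim (use assms in \<open>simp add: exp_sum\<close>)
qed

text \<open>Common core of both tails. The event \<open>P\<close> has to be controlled only at
  points where the product is the exponential of the log-likelihood sum, which is
  \<open>M\<close>-almost everywhere.\<close>

lemma tail_bound:
  assumes I: "finite I" "card I = k" "k > 0" and e: "0 < e"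
    and P: "\<And>y. P y \<Longrightarrow> (\<Prod>i\<in>I. f (y i)) = exp (\<Sum>i\<in>I. ln (f (y i))) \<Longrightarrow>
      e * real k \<le> \<bar>(\<Sum>i\<in>I. ln (f (y i))) - real k * info\<bar>"
    and Pm[measurable]: "Measurable.pred (PiM I (\<lambda>_. N)) P"
  shows "measure (PiM I (\<lambda>_. M)) {y \<in> space (PiM I (\<lambda>_. N)). P y} \<le> info_var / (real k * e\<^sup>2)"
proof -
  interpret P: product_prob_space "\<lambda>_. M" I
    using M.prob_space_axioms by (auto intro!: product_prob_spaceI)
  have s[simp]: "space M = space N" using sets_M by (rule sets_eq_imp_space_eq)
  have m: "{y \<in> space (PiM I (\<lambda>_. M)). e * real k \<le> \<bar>(\<Sum>i\<in>I. ln (f (y i))) - real k * info\<bar>}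
      \<in> sets (PiM I (\<lambda>_. M))"
    by measurable
  have "measure (PiM I (\<lambda>_. M)) {y \<in> space (PiM I (\<lambda>_. N)). P y} \<le>
    measure (PiM I (\<lambda>_. M)) {y \<in> space (PiM I (\<lambda>_. M)).
      e * real k \<le> \<bar>(\<Sum>i\<in>I. ln (f (y i))) - real k * info\<bar>}"
    using AE_prod_exp[OF I(1)] P
    by (intro P.P.finite_measure_mono_AE) (auto simp: space_PiM m[unfolded space_PiM s])
  also have "\<dots> \<le> info_var / (real k * e\<^sup>2)"
    unfolding info_var_def info_def
    by (rule PiM_weak_law) (use I e integrable_ln integrable_ln_sq M.prob_space_axioms in auto)
  finally show ?thesis .
qed

lemma upper_tail:
  assumes I: "finite I" "card I = k" "k > 0" and s: "info < s"
  shows "measure (PiM I (\<lambda>_. M)) {y \<in> space (PiM I (\<lambda>_. N)). exp (s * k) < (\<Prod>i\<in>I. f (y i))}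
    \<le> info_var / (real k * (s - info)\<^sup>2)"
  by (rule tail_bound[OF I]) (use s I in \<open>auto simp: algebra_simps abs_if\<close>)

lemma lower_tail:
  assumes I: "finite I" "card I = k" "k > 0" and s: "s < info"
  shows "measure (PiM I (\<lambda>_. M)) {y \<in> space (PiM I (\<lambda>_. N)). (\<Prod>i\<in>I. f (y i)) \<le> exp (s * k)}
    \<le> info_var / (real k * (info - s)\<^sup>2)"
  by (rule tail_bound[OF I]) (use s I in \<open>auto simp: algebra_simps abs_if\<close>)

text \<open>Under \<open>N\<close> the product of the ratios has mean \<open>1\<close>, so Markov's
  inequality at level \<open>exp (s * k)\<close> applies; no information about \<open>info\<close>
  enters.\<close>

lemma false_alarm:
  assumes I: "finite I" "card I = k"
  shows "measure (PiM I (\<lambda>_. N)) {y \<in> space (PiM I (\<lambda>_. N)). exp (s * k) < (\<Prod>i\<in>I. f (y i))}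
    \<le> exp (- s * k)"
proof -
  interpret P: product_prob_space "\<lambda>_. N" I
    using N.prob_space_axioms by (auto intro!: product_prob_spaceI)
  have 1: "has_bochner_integral N f 1"
  proof (rule has_bochner_integral_nn_integral)
    have "(\<integral>\<^sup>+x. ennreal (f x) \<partial>N) = emeasure M (space M)"
      using sets_eq_imp_space_eq[OF sets_M]
      by (subst (1) density_f[symmetric]) (simp add: emeasure_density cong: nn_integral_cong)
    then show "(\<integral>\<^sup>+x. ennreal (f x) \<partial>N) = ennreal 1" by (simp add: M.emeasure_space_1)
  qed (use f_nonneg in auto)
  then have i: "integrable N f" "(\<integral>x. f x \<partial>N) = 1"
    by (auto simp: has_bochner_integral_iff)
  let ?P = "PiM I (\<lambda>_. N)"
  have "measure ?P {y \<in> space ?P. exp (s * k) < (\<Prod>i\<in>I. f (y i))}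
    \<le> measure ?P {y \<in> space ?P. exp (s * k) \<le> (\<Prod>i\<in>I. f (y i))}"
    using I by (intro P.P.finite_measure_mono) auto
  also have "\<dots> \<le> (\<integral>y. (\<Prod>i\<in>I. f (y i)) \<partial>?P) / exp (s * k)"
    using i I f_nonneg
    by (intro integral_Markov_inequality_measure[where A="{}"])
       (auto intro!: P.product_integrable_prod prod_nonneg)
  also have "\<dots> = exp (- s * k)"
    using P.product_integral_prod[OF I(1), of "\<lambda>_. f"] i by (simp add: exp_minus field_simps)
  finally show ?thesis .
qed

text \<open>Off the event that the likelihood ratio exceeds \<open>b\<close>, the density of the
  \<open>M\<close>-product against the \<open>N\<close>-product is at most \<open>b\<close>.\<close>

lemma change_of_measure:
  assumes I: "finite I" and A: "A \<in> sets (PiM I (\<lambda>_. N))" and b: "0 < b"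
  shows "measure (PiM I (\<lambda>_. M)) A \<le> b * measure (PiM I (\<lambda>_. N)) A
     + measure (PiM I (\<lambda>_. M)) {y \<in> space (PiM I (\<lambda>_. N)). b < (\<Prod>i\<in>I. f (y i))}"
proof -
  interpret P: product_prob_space "\<lambda>_. N" I
    using N.prob_space_axioms by (auto intro!: product_prob_spaceI)
  interpret Q: product_prob_space "\<lambda>_. M" I
    using M.prob_space_axioms by (auto intro!: product_prob_spaceI)
  let ?P = "PiM I (\<lambda>_. N)" and ?Q = "PiM I (\<lambda>_. M)"
  have Q: "?Q = density ?P (\<lambda>x. \<Prod>i\<in>I. ennreal (f (x i)))"
    by (rule PiM_density) (use I density_f N.prob_space_axioms M.prob_space_axioms in auto)
  let ?C = "{y \<in> space ?P. b < (\<Prod>i\<in>I. f (y i))}"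
  have C[measurable]: "?C \<in> sets ?P" using I by measurable
  have A[measurable]: "A \<in> sets ?P" by fact
  have SQ: "sets ?Q = sets ?P" by (simp cong: sets_PiM_cong)
  have "emeasure ?Q (A - ?C) = (\<integral>\<^sup>+x. (\<Prod>i\<in>I. ennreal (f (x i))) * indicator (A - ?C) x \<partial>?P)"
    unfolding Q using I by (intro emeasure_density) auto
  also have "\<dots> \<le> (\<integral>\<^sup>+x. ennreal b * indicator A x \<partial>?P)"
    using I A[THEN sets.sets_into_space] f_nonneg b
    by (intro nn_integral_mono) (auto simp: indicator_def prod_ennreal prod_nonneg not_less intro!: ennreal_leI)
  also have "\<dots> = ennreal (b * measure ?P A)"
    using b by (simp add: nn_integral_cmult P.P.emeasure_eq_measure ennreal_mult)
  finally have 1: "measure ?Q (A - ?C) \<le> b * measure ?P A"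
    using b by (simp add: Q.P.emeasure_eq_measure)
  have "measure ?Q A \<le> measure ?Q ((A - ?C) \<union> ?C)"
    by (intro Q.P.finite_measure_mono) (use A C SQ in auto)
  also have "\<dots> \<le> measure ?Q (A - ?C) + measure ?Q ?C"
    by (intro measure_Un_le) (use A C SQ in auto)
  finally show ?thesis using 1 by linarith
qed

end

section \<open>Laws of the signals under a strategy\<close>

declare mult_Suc [simp del] path.simps(2) [simp del]

lemma is_strategy_mono: "is_strategy X m T \<alpha> \<Longrightarrow> t \<le> T \<Longrightarrow> is_strategy X m t \<alpha>"
  by (auto simp: is_strategy_def)

lemma restrict_merge_prefix:
  fixes s t m :: nat
  shows "s \<le> t \<Longrightarrow> restrict (merge {..<t * m} J (h, y)) {..<s * m} = restrict h {..<s * m}"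
proof -
  assume "s \<le> t"
  then have "x < t * m" if "x < s * m" for x by (rule order.strict_trans2[OF that mult_le_mono1])
  then show ?thesis by (auto simp: restrict_def merge_def fun_eq_iff)
qed

lemma act_merge: "s \<le> t \<Longrightarrow> act \<alpha> m s (merge {..<t * m} J (h, y)) = act \<alpha> m s h"
  by (simp add: act_def restrict_merge_prefix)

lemma restrict_hspace: "h \<in> space (hspace X k) \<Longrightarrow> restrict h {..<k} = h"
  by (auto simp: hspace_def space_PiM)

lemma act_hspace: "h \<in> space (hspace X (t * m)) \<Longrightarrow> act \<alpha> m t h = \<alpha> t h"
  by (simp add: act_def restrict_hspace)

lemma measurable_hspace_restrict:
  "j \<le> k \<Longrightarrow> (\<lambda>x. restrict x {..<j}) \<in> hspace X k \<rightarrow>\<^sub>M hspace X j"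
  unfolding hspace_def by (intro measurable_restrict_subset) auto

lemma measurable_act:
  assumes "is_strategy X m T \<alpha>" "s < T" "s \<le> t"
  shows "act \<alpha> m s \<in> hspace X (t * m) \<rightarrow>\<^sub>M count_space UNIV"
proof -
  have "s * m \<le> t * m" using assms(3) by (rule mult_le_mono1)
  moreover have "\<alpha> s \<in> hspace X (s * m) \<rightarrow>\<^sub>M count_space UNIV"
    using assms by (simp add: is_strategy_def)
  ultimately have "(\<lambda>x. \<alpha> s (restrict x {..<s * m})) \<in> hspace X (t * m) \<rightarrow>\<^sub>M count_space UNIV"
    by (rule measurable_compose[OF measurable_hspace_restrict])
  then show ?thesis unfolding act_def[abs_def] .
qed

lemma hspace_Suc: "{..<t * m} \<union> {t * m..<Suc t * m} = {..<Suc t * m}"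
  by (auto simp: mult_Suc)

section \<open>Transition kernels and path laws\<close>

locale monitoring =
  fixes \<mu> :: "'a::finite \<Rightarrow> 'x::euclidean_space measure" and X :: "'x set"
  assumes prob: "\<And>a. prob_space (\<mu> a)"
    and sets_mu: "\<And>a. sets (\<mu> a) = sets (sig X)"
begin

abbreviation block :: "nat \<Rightarrow> nat \<Rightarrow> 'a \<Rightarrow> (nat \<Rightarrow> 'x) measure" where
  "block m t a \<equiv> PiM {t * m..<Suc t * m} (\<lambda>_. \<mu> a)"

abbreviation join :: "nat \<Rightarrow> nat \<Rightarrow> (nat \<Rightarrow> 'x) \<Rightarrow> (nat \<Rightarrow> 'x) \<Rightarrow> nat \<Rightarrow> 'x" where
  "join m t h y \<equiv> merge {..<t * m} {t * m..<Suc t * m} (h, y)"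

lemma prob_block: "prob_space (PiM I (\<lambda>_. \<mu> a))"
  by (intro prob_space_PiM prob)

lemma sets_block: "sets (PiM I (\<lambda>_. \<mu> a)) = sets (PiM I (\<lambda>_. sig X))"
  by (intro sets_PiM_cong refl sets_mu)

lemma space_block: "space (PiM I (\<lambda>_. \<mu> a)) = space (PiM I (\<lambda>_. sig X))"
  by (intro sets_eq_imp_space_eq sets_block)

lemma measurable_block:
  "F \<in> PiM I (\<lambda>_. sig X) \<rightarrow>\<^sub>M M \<Longrightarrow> F \<in> PiM I (\<lambda>_. \<mu> a) \<rightarrow>\<^sub>M M"
  using measurable_cong_sets[OF sets_block refl] by blast

lemma measurable_join:
  "case_prod (join m t) \<in> hspace X (t * m) \<Otimes>\<^sub>M PiM {t * m..<Suc t * m} (\<lambda>_. sig X) \<rightarrow>\<^sub>M hspace X (Suc t * m)"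
  unfolding hspace_def hspace_Suc[symmetric] split_beta' prod.collapse by (rule measurable_merge)

lemma measurable_join2:
  assumes "h \<in> space (hspace X (t * m))"
  shows "join m t h \<in> PiM {t * m..<Suc t * m} (\<lambda>_. sig X) \<rightarrow>\<^sub>M hspace X (Suc t * m)"
  using measurable_Pair2[OF measurable_join assms] by simp

text \<open>For a fixed action the kernel is a push-forward under a jointly measurable map. As there
  are finitely many actions, these kernels can be glued along the measurable choice
  \<open>\<alpha> t\<close>.\<close>

lemma kernel_measurable:
  assumes \<alpha>: "\<alpha> t \<in> hspace X (t * m) \<rightarrow>\<^sub>M count_space UNIV"
  shows "(\<lambda>h. distr (block m t (\<alpha> t h)) (hspace X (Suc t * m)) (join m t h))
    \<in> hspace X (t * m) \<rightarrow>\<^sub>M prob_algebra (hspace X (Suc t * m))"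
proof (rule measurable_prob_algebraI)
  fix h assume h: "h \<in> space (hspace X (t * m))"
  show "prob_space (distr (block m t (\<alpha> t h)) (hspace X (Suc t * m)) (join m t h))"
    by (rule prob_space.prob_space_distr[OF prob_block measurable_block[OF measurable_join2[OF h]]])
next
  have "(\<lambda>h. distr (block m t a) (hspace X (Suc t * m)) (join m t h))
    \<in> hspace X (t * m) \<rightarrow>\<^sub>M subprob_algebra (hspace X (Suc t * m))" for a
  proof (rule measurable_distr2[OF measurable_join])
    show "(\<lambda>h. block m t a) \<in> hspace X (t * m) \<rightarrow>\<^sub>M subprob_algebra (PiM {t * m..<Suc t * m} (\<lambda>_. sig X))"
      using prob_block[of "{t * m..<Suc t * m}" a, THEN prob_space_imp_subprob_space]
        sets_block[of "{t * m..<Suc t * m}" a]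
      by (intro measurable_const) (simp add: space_subprob_algebra)
  qed
  from measurable_compose_countable[OF this \<alpha>]
  show "(\<lambda>h. distr (block m t (\<alpha> t h)) (hspace X (Suc t * m)) (join m t h))
    \<in> hspace X (t * m) \<rightarrow>\<^sub>M subprob_algebra (hspace X (Suc t * m))" .
qed

lemma path_in:
  "is_strategy X m t \<alpha> \<Longrightarrow> path \<mu> X m \<alpha> t \<in> space (prob_algebra (hspace X (t * m)))"
proof (induction t)
  case 0
  have "(\<lambda>_. undefined) \<in> space (hspace X 0)" by (simp add: hspace_def space_PiM)
  then show ?case by (simp add: space_prob_algebra prob_space_return)
next
  case (Suc t)
  then have 1: "path \<mu> X m \<alpha> t \<in> space (prob_algebra (hspace X (t * m)))"
    using is_strategy_mono[of X m "Suc t" \<alpha> t] by simp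
  have 2: "(\<lambda>h. distr (block m t (\<alpha> t h)) (hspace X (Suc t * m)) (join m t h))
    \<in> hspace X (t * m) \<rightarrow>\<^sub>M prob_algebra (hspace X (Suc t * m))"
    using Suc.prems by (intro kernel_measurable) (auto simp: is_strategy_def)
  show ?case
    unfolding path.simps(2) space_prob_algebra mem_Collect_eq
    by (intro conjI prob_space_bind'[OF 1 2] sets_bind'[OF 1 2])
qed

lemma prob_path: "is_strategy X m t \<alpha> \<Longrightarrow> prob_space (path \<mu> X m \<alpha> t)"
  and sets_path: "is_strategy X m t \<alpha> \<Longrightarrow> sets (path \<mu> X m \<alpha> t) = sets (hspace X (t * m))"
  using path_in by (auto simp: space_prob_algebra)

lemma space_path: "is_strategy X m t \<alpha> \<Longrightarrow> space (path \<mu> X m \<alpha> t) = space (hspace X (t * m))"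
  by (intro sets_eq_imp_space_eq sets_path)

lemma measurable_path:
  "is_strategy X m t \<alpha> \<Longrightarrow> F \<in> hspace X (t * m) \<rightarrow>\<^sub>M M \<Longrightarrow> F \<in> path \<mu> X m \<alpha> t \<rightarrow>\<^sub>M M"
  by (subst measurable_cong_sets[OF sets_path refl])

lemma integrable_path:
  fixes F :: "_ \<Rightarrow> real"
  assumes "is_strategy X m t \<alpha>" "F \<in> borel_measurable (hspace X (t * m))"
    and "\<And>x. x \<in> space (hspace X (t * m)) \<Longrightarrow> \<bar>F x\<bar> \<le> B"
  shows "integrable (path \<mu> X m \<alpha> t) F"
proof -
  interpret prob_space "path \<mu> X m \<alpha> t" using assms by (intro prob_path)
  show ?thesis
    using assms by (intro integrable_const_bound[where B=B] measurable_path) (auto simp: space_path)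
qed

text \<open>Disintegration along the last period. Boundedness of \<open>F\<close> suffices, since it
  is applied to indicators, functions of actions and the potential; contracts, which may be
  unbounded, are never disintegrated.\<close>

lemma integral_path_Suc:
  fixes F :: "_ \<Rightarrow> real"
  assumes \<alpha>: "is_strategy X m (Suc t) \<alpha>" and F: "F \<in> borel_measurable (hspace X (Suc t * m))"
    and B: "\<And>x. x \<in> space (hspace X (Suc t * m)) \<Longrightarrow> \<bar>F x\<bar> \<le> B"
  shows "(\<integral>x. F x \<partial>path \<mu> X m \<alpha> (Suc t))
    = (\<integral>h. \<integral>y. F (join m t h y) \<partial>block m t (\<alpha> t h) \<partial>path \<mu> X m \<alpha> t)"
proof -
  have \<alpha>t: "is_strategy X m t \<alpha>" using is_strategy_mono[OF \<alpha>] by simp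
  have k: "(\<lambda>h. distr (block m t (\<alpha> t h)) (hspace X (Suc t * m)) (join m t h))
    \<in> hspace X (t * m) \<rightarrow>\<^sub>M prob_algebra (hspace X (Suc t * m))"
    using \<alpha> by (intro kernel_measurable) (auto simp: is_strategy_def)
  interpret P: prob_space "path \<mu> X m \<alpha> t" using \<alpha>t by (rule prob_path)
  have "(\<integral>x. F x \<partial>path \<mu> X m \<alpha> (Suc t))
    = (\<integral>h. \<integral>x. F x \<partial>distr (block m t (\<alpha> t h)) (hspace X (Suc t * m)) (join m t h) \<partial>path \<mu> X m \<alpha> t)"
    unfolding path.simps
  proof (rule integral_bind[where K="hspace X (Suc t * m)" and B=B and B'=1])
    show "AE h in path \<mu> X m \<alpha> t. emeasure (distr (block m t (\<alpha> t h)) (hspace X (Suc t * m)) (join m t h))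
       (space (distr (block m t (\<alpha> t h)) (hspace X (Suc t * m)) (join m t h))) \<le> ennreal 1"
      using measurable_space[OF k]
      by (intro AE_I2) (simp add: space_path[OF \<alpha>t] space_prob_algebra prob_space.emeasure_space_1 del: space_distr)
    show "(\<lambda>h. distr (block m t (\<alpha> t h)) (hspace X (Suc t * m)) (join m t h))
      \<in> path \<mu> X m \<alpha> t \<rightarrow>\<^sub>M subprob_algebra (hspace X (Suc t * m))"
      by (rule measurable_path[OF \<alpha>t measurable_prob_algebraD[OF k]])
  qed (use F B P.finite_measure_axioms in auto)
  also have "\<dots> = (\<integral>h. \<integral>y. F (join m t h y) \<partial>block m t (\<alpha> t h) \<partial>path \<mu> X m \<alpha> t)"
    using F
    by (intro Bochner_Integration.integral_cong refl integral_distr measurable_block measurable_join2)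
       (simp add: space_path[OF \<alpha>t])
  finally show ?thesis .
qed

text \<open>Consistency of the path laws: each further period only appends coordinates, and its
  kernel has total mass \<open>1\<close>.\<close>

lemma integral_path_restrict:
  fixes F :: "_ \<Rightarrow> real"
  assumes "is_strategy X m t \<alpha>" and "s \<le> t" and F: "F \<in> borel_measurable (hspace X (s * m))"
    and B: "\<And>x. x \<in> space (hspace X (s * m)) \<Longrightarrow> \<bar>F x\<bar> \<le> B"
  shows "(\<integral>x. F (restrict x {..<s * m}) \<partial>path \<mu> X m \<alpha> t) = (\<integral>x. F x \<partial>path \<mu> X m \<alpha> s)"
  using assms(2,1)
proof (induction t rule: dec_induct)
  case base
  then show ?case
    by (intro Bochner_Integration.integral_cong) (auto simp: space_path restrict_hspace)
next
  case (step t)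
  have \<alpha>: "is_strategy X m t \<alpha>" using is_strategy_mono[OF step.prems] by simp
  have le: "s * m \<le> Suc t * m" using step by (intro mult_le_mono1) simp
  have "(\<integral>x. F (restrict x {..<s * m}) \<partial>path \<mu> X m \<alpha> (Suc t))
    = (\<integral>h. \<integral>y. F (restrict (join m t h y) {..<s * m}) \<partial>block m t (\<alpha> t h) \<partial>path \<mu> X m \<alpha> t)"
  proof (rule integral_path_Suc[OF step.prems, where B=B])
    show "(\<lambda>x. F (restrict x {..<s * m})) \<in> borel_measurable (hspace X (Suc t * m))"
      by (rule measurable_compose[OF measurable_hspace_restrict[OF le] F])
    show "\<bar>F (restrict x {..<s * m})\<bar> \<le> B" if "x \<in> space (hspace X (Suc t * m))" for x
      using measurable_space[OF measurable_hspace_restrict[OF le] that] by (rule B)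
  qed
  also have "\<dots> = (\<integral>h. F (restrict h {..<s * m}) \<partial>path \<mu> X m \<alpha> t)"
    using step by (simp add: restrict_merge_prefix prob_space.prob_space[OF prob_block])
  also have "\<dots> = (\<integral>x. F x \<partial>path \<mu> X m \<alpha> s)" by (rule step.IH[OF \<alpha>])
  finally show ?case .
qed

lemma path_cong: "(\<And>s. s < t \<Longrightarrow> \<alpha> s = \<beta> s) \<Longrightarrow> path \<mu> X m \<alpha> t = path \<mu> X m \<beta> t"
  by (induction t) (auto simp: path.simps(2))

section \<open>Expected action frequencies\<close>

definition mean :: "nat \<Rightarrow> nat \<Rightarrow> (nat \<Rightarrow> (nat \<Rightarrow> 'x) \<Rightarrow> 'a) \<Rightarrow> ('a \<Rightarrow> real) \<Rightarrow> real" where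
  "mean m T \<alpha> \<phi> = (\<Sum>t<T. \<integral>h. \<phi> (\<alpha> t h) \<partial>path \<mu> X m \<alpha> t) / real T"

lemma bounded_finite: "\<bar>\<phi> (a :: 'a)\<bar> \<le> (\<Sum>b\<in>UNIV. \<bar>\<phi> b :: real\<bar>)"
  by (rule member_le_sum[of a UNIV "\<lambda>b. \<bar>\<phi> b\<bar>"]) auto

lemma measurable_payoff:
  assumes "is_strategy X m T \<alpha>" "s < T" "s \<le> t"
  shows "(\<lambda>x. \<phi> (act \<alpha> m s x) :: real) \<in> borel_measurable (hspace X (t * m))"
  by (rule measurable_compose[OF measurable_act[OF assms]]) simp

lemma integral_act:
  fixes \<phi> :: "'a \<Rightarrow> real"
  assumes "is_strategy X m T \<alpha>" "s < T"
  shows "(\<integral>x. \<phi> (act \<alpha> m s x) \<partial>path \<mu> X m \<alpha> T) = (\<integral>h. \<phi> (\<alpha> s h) \<partial>path \<mu> X m \<alpha> s)"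
  unfolding act_def
  by (rule integral_path_restrict[OF assms(1), where B="\<Sum>b\<in>UNIV. \<bar>\<phi> b\<bar>"])
     (use assms bounded_finite in \<open>auto simp: is_strategy_def\<close>)

lemma integrable_act:
  fixes \<phi> :: "'a \<Rightarrow> real"
  assumes "is_strategy X m T \<alpha>" "s < T"
  shows "integrable (path \<mu> X m \<alpha> T) (\<lambda>x. \<phi> (act \<alpha> m s x))"
  by (rule integrable_path[where B="\<Sum>b\<in>UNIV. \<bar>\<phi> b\<bar>"])
     (use assms bounded_finite in \<open>auto intro!: measurable_payoff\<close>)

lemma integrable_avg:
  fixes \<phi> :: "'a \<Rightarrow> real"
  assumes "is_strategy X m T \<alpha>"
  shows "integrable (path \<mu> X m \<alpha> T) (\<lambda>x. (\<Sum>t<T. \<phi> (act \<alpha> m t x)) / real T)"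
  using integrable_act[OF assms] by (intro integrable_divide_zero Bochner_Integration.integrable_sum) auto

text \<open>\<open>mean\<close> integrates each period over the law of its own history, so
  strategies that agree up to some period can be compared term by term. This identifies it with the
  average over the full path that occurs in the payoffs.\<close>

lemma integral_avg:
  fixes \<phi> :: "'a \<Rightarrow> real"
  assumes "is_strategy X m T \<alpha>"
  shows "(\<integral>x. (\<Sum>t<T. \<phi> (act \<alpha> m t x)) / real T \<partial>path \<mu> X m \<alpha> T) = mean m T \<alpha> \<phi>"
  using integrable_act[OF assms] integral_act[OF assms]
  by (simp add: mean_def Bochner_Integration.integral_sum)

lemma integrable_strategy:
  fixes \<phi> :: "'a \<Rightarrow> real"
  assumes "is_strategy X m T \<alpha>" "s < T"
  shows "integrable (path \<mu> X m \<alpha> s) (\<lambda>h. \<phi> (\<alpha> s h))"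
proof (rule integrable_path[where B="\<Sum>b\<in>UNIV. \<bar>\<phi> b\<bar>"])
  show "is_strategy X m s \<alpha>" using assms is_strategy_mono by fastforce
qed (use assms bounded_finite in \<open>auto simp: is_strategy_def\<close>)

text \<open>The expected occupation measure of the strategy. Gains and costs are additive over
  periods, so they depend on the strategy only through this point of the simplex.\<close>

definition freq :: "nat \<Rightarrow> nat \<Rightarrow> (nat \<Rightarrow> (nat \<Rightarrow> 'x) \<Rightarrow> 'a) \<Rightarrow> 'a \<Rightarrow> real" where
  "freq m T \<alpha> a = mean m T \<alpha> (\<lambda>b. if b = a then 1 else 0)"

lemma mean_eq_freq:
  assumes "is_strategy X m T \<alpha>"
  shows "mean m T \<alpha> \<phi> = (\<Sum>a\<in>UNIV. freq m T \<alpha> a * \<phi> a)"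
proof -
  have pick: "(\<Sum>a\<in>UNIV. (if b = a then 1 else 0) * \<phi> a) = \<phi> b" for b
  proof -
    have "(\<Sum>a\<in>UNIV. (if b = a then 1 else 0) * \<phi> a) = (\<Sum>a\<in>UNIV. if b = a then \<phi> a else 0)"
      by (intro sum.cong) auto
    then show ?thesis by simp
  qed
  have "(\<integral>h. \<phi> (\<alpha> t h) \<partial>path \<mu> X m \<alpha> t)
      = (\<Sum>a\<in>UNIV. (\<integral>h. (if \<alpha> t h = a then 1 else 0) \<partial>path \<mu> X m \<alpha> t) * \<phi> a)" if "t < T" for t
  proof -
    have "(\<integral>h. \<phi> (\<alpha> t h) \<partial>path \<mu> X m \<alpha> t)
      = (\<integral>h. (\<Sum>a\<in>UNIV. (if \<alpha> t h = a then 1 else 0) * \<phi> a) \<partial>path \<mu> X m \<alpha> t)"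
      by (simp only: pick)
    also have "\<dots> = (\<Sum>a\<in>UNIV. (\<integral>h. (if \<alpha> t h = a then 1 else 0) * \<phi> a \<partial>path \<mu> X m \<alpha> t))"
      by (rule Bochner_Integration.integral_sum)
         (rule integrable_strategy[OF assms that, of "\<lambda>b. (if b = a then 1 else 0) * \<phi> a" for a])
    finally show ?thesis by (simp only: integral_mult_left_zero)
  qed
  then have "(\<Sum>t<T. \<integral>h. \<phi> (\<alpha> t h) \<partial>path \<mu> X m \<alpha> t)
      = (\<Sum>t<T. \<Sum>a\<in>UNIV. (\<integral>h. (if \<alpha> t h = a then 1 else 0) \<partial>path \<mu> X m \<alpha> t) * \<phi> a)"
    by (intro sum.cong refl) simp
  also have "\<dots> = (\<Sum>a\<in>UNIV. \<Sum>t<T. (\<integral>h. (if \<alpha> t h = a then 1 else 0) \<partial>path \<mu> X m \<alpha> t) * \<phi> a)"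
    by (rule sum.swap)
  finally show ?thesis
    unfolding mean_def freq_def sum_distrib_right[symmetric] times_divide_eq_left sum_divide_distrib[symmetric]
    by (rule arg_cong)
qed

lemma freq_nonneg: "0 \<le> freq m T \<alpha> a"
  unfolding freq_def mean_def
  by (rule divide_nonneg_nonneg[OF sum_nonneg]) (auto intro: Bochner_Integration.integral_nonneg)

lemma sum_freq:
  assumes "is_strategy X m T \<alpha>" "T > 0"
  shows "(\<Sum>a\<in>UNIV. freq m T \<alpha> a) = 1"
proof -
  have "(\<integral>h. 1 \<partial>path \<mu> X m \<alpha> t) = (1::real)" if "t < T" for t
    using prob_space.prob_space[OF prob_path[OF is_strategy_mono[OF assms(1), of t]]] that by simp
  then have "(\<Sum>t<T. \<integral>h. 1 \<partial>path \<mu> X m \<alpha> t) = (\<Sum>t<T. 1::real)"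
    by (intro sum.cong) auto
  then have "mean m T \<alpha> (\<lambda>_. 1) = 1" using assms(2) unfolding mean_def by (simp only: sum_constant) simp
  then show ?thesis using mean_eq_freq[OF assms(1), of "\<lambda>_. 1"] by simp
qed

section \<open>Conditional probabilities and one-period comparisons\<close>

lemma measure_path_Suc:
  assumes \<alpha>: "is_strategy X m (Suc t) \<alpha>" and B: "B \<in> sets (hspace X (Suc t * m))"
  shows "measure (path \<mu> X m \<alpha> (Suc t)) B
    = (\<integral>h. measure (block m t (\<alpha> t h)) {y \<in> space (PiM {t * m..<Suc t * m} (\<lambda>_. sig X)). join m t h y \<in> B}
        \<partial>path \<mu> X m \<alpha> t)"
proof -
  have \<alpha>t: "is_strategy X m t \<alpha>" using is_strategy_mono[OF \<alpha>] by simp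
  have "measure (path \<mu> X m \<alpha> (Suc t)) B = (\<integral>x. indicator B x \<partial>path \<mu> X m \<alpha> (Suc t))"
    using sets.sets_into_space[OF B]
    by (subst Bochner_Integration.integral_indicator) (simp only: space_path[OF \<alpha>] Int_absorb2)
  also have "\<dots> = (\<integral>h. \<integral>y. indicator B (join m t h y) \<partial>block m t (\<alpha> t h) \<partial>path \<mu> X m \<alpha> t)"
    using B by (intro integral_path_Suc[OF \<alpha>, where B=1]) (auto simp: indicator_def)
  also have "\<dots> = (\<integral>h. measure (block m t (\<alpha> t h))
      {y \<in> space (PiM {t * m..<Suc t * m} (\<lambda>_. sig X)). join m t h y \<in> B} \<partial>path \<mu> X m \<alpha> t)"
  proof (intro Bochner_Integration.integral_cong refl)
    fix h assume "h \<in> space (path \<mu> X m \<alpha> t)"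
    then have h: "h \<in> space (hspace X (t * m))" by (simp add: space_path[OF \<alpha>t])
    let ?S = "{y \<in> space (PiM {t * m..<Suc t * m} (\<lambda>_. sig X)). join m t h y \<in> B}"
    have "?S = join m t h -` B \<inter> space (PiM {t * m..<Suc t * m} (\<lambda>_. sig X))" by auto
    then have S: "?S \<in> sets (block m t (\<alpha> t h))"
      using measurable_sets[OF measurable_join2[OF h] B] by (simp add: sets_block)
    have "(\<integral>y. indicator B (join m t h y) \<partial>block m t (\<alpha> t h)) = (\<integral>y. indicator ?S y \<partial>block m t (\<alpha> t h))"
      by (intro Bochner_Integration.integral_cong) (auto simp: indicator_def space_block)
    also have "\<dots> = measure (block m t (\<alpha> t h)) ?S"
      using sets.sets_into_space[OF S]
      by (subst Bochner_Integration.integral_indicator) (simp only: Int_absorb2)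
    finally show "(\<integral>y. indicator B (join m t h y) \<partial>block m t (\<alpha> t h)) = measure (block m t (\<alpha> t h)) ?S" .
  qed
  finally show ?thesis .
qed

lemma integrable_block_integral:
  fixes F :: "_ \<Rightarrow> real"
  assumes \<alpha>: "is_strategy X m (Suc t) \<alpha>" and F: "F \<in> borel_measurable (hspace X (Suc t * m))"
    and B: "\<And>x. x \<in> space (hspace X (Suc t * m)) \<Longrightarrow> \<bar>F x\<bar> \<le> B"
  shows "integrable (path \<mu> X m \<alpha> t) (\<lambda>h. \<integral>y. F (join m t h y) \<partial>block m t (\<alpha> t h))"
proof (rule integrable_path[where B=B])
  show \<alpha>t: "is_strategy X m t \<alpha>" using is_strategy_mono[OF \<alpha>] by simp
  have k: "(\<lambda>h. distr (block m t (\<alpha> t h)) (hspace X (Suc t * m)) (join m t h))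
    \<in> hspace X (t * m) \<rightarrow>\<^sub>M prob_algebra (hspace X (Suc t * m))"
    using \<alpha> by (intro kernel_measurable) (auto simp: is_strategy_def)
  have "(\<lambda>h. \<integral>x. F x \<partial>distr (block m t (\<alpha> t h)) (hspace X (Suc t * m)) (join m t h))
    \<in> borel_measurable (hspace X (t * m))"
    by (rule measurable_compose[OF measurable_prob_algebraD[OF k] integral_measurable_subprob_algebra[OF F]])
  also have "?this \<longleftrightarrow> (\<lambda>h. \<integral>y. F (join m t h y) \<partial>block m t (\<alpha> t h)) \<in> borel_measurable (hspace X (t * m))"
    using F by (intro measurable_cong) (auto simp: integral_distr[OF measurable_block[OF measurable_join2]])
  finally show "(\<lambda>h. \<integral>y. F (join m t h y) \<partial>block m t (\<alpha> t h)) \<in> borel_measurable (hspace X (t * m))" .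
  fix h assume h: "h \<in> space (hspace X (t * m))"
  interpret P: prob_space "block m t (\<alpha> t h)" by (rule prob_block)
  have j: "join m t h y \<in> space (hspace X (Suc t * m))" if "y \<in> space (block m t (\<alpha> t h))" for y
    using measurable_space[OF measurable_join2[OF h], of y] that by (simp add: space_block)
  have i: "integrable (block m t (\<alpha> t h)) (\<lambda>y. F (join m t h y))"
  proof (rule P.integrable_const_bound[where B=B])
    show "(\<lambda>y. F (join m t h y)) \<in> borel_measurable (block m t (\<alpha> t h))"
      by (rule measurable_block[OF measurable_compose[OF measurable_join2[OF h] F]])
  qed (use B j in auto)
  have "\<bar>\<integral>y. F (join m t h y) \<partial>block m t (\<alpha> t h)\<bar> \<le> (\<integral>y. \<bar>F (join m t h y)\<bar> \<partial>block m t (\<alpha> t h))"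
    by (rule integral_abs_bound)
  also have "\<dots> \<le> (\<integral>y. B \<partial>block m t (\<alpha> t h))"
    using i B j by (intro integral_mono) auto
  finally show "\<bar>\<integral>y. F (join m t h y) \<partial>block m t (\<alpha> t h)\<bar> \<le> B" by (simp add: P.prob_space)
qed

text \<open>The step behind both the supermartingale property of the potential and the bound on
  false alarms along the intended path.\<close>

lemma integral_path_Suc_mono:
  fixes F G :: "_ \<Rightarrow> real"
  assumes \<alpha>: "is_strategy X m (Suc t) \<alpha>" and F: "F \<in> borel_measurable (hspace X (Suc t * m))"
    and B: "\<And>x. x \<in> space (hspace X (Suc t * m)) \<Longrightarrow> \<bar>F x\<bar> \<le> B"
    and G: "integrable (path \<mu> X m \<alpha> t) G"
    and le: "\<And>h. h \<in> space (hspace X (t * m)) \<Longrightarrow> (\<integral>y. F (join m t h y) \<partial>block m t (\<alpha> t h)) \<le> G h"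
  shows "(\<integral>x. F x \<partial>path \<mu> X m \<alpha> (Suc t)) \<le> (\<integral>h. G h \<partial>path \<mu> X m \<alpha> t)"
proof -
  have "(\<integral>x. F x \<partial>path \<mu> X m \<alpha> (Suc t))
    = (\<integral>h. \<integral>y. F (join m t h y) \<partial>block m t (\<alpha> t h) \<partial>path \<mu> X m \<alpha> t)"
    by (rule integral_path_Suc[OF \<alpha> F B])
  also have "\<dots> \<le> (\<integral>h. G h \<partial>path \<mu> X m \<alpha> t)"
    using integrable_block_integral[OF \<alpha> F B] G le is_strategy_mono[OF \<alpha>, of t]
    by (intro integral_mono) (auto simp: space_path)
  finally show ?thesis .
qed

lemma integrable_block_measure:
  assumes \<alpha>: "is_strategy X m (Suc t) \<alpha>" and B: "B \<in> sets (hspace X (Suc t * m))"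
  shows "integrable (path \<mu> X m \<alpha> t) (\<lambda>h. measure (block m t (\<alpha> t h))
    {y \<in> space (PiM {t * m..<Suc t * m} (\<lambda>_. sig X)). join m t h y \<in> B})"
proof (rule integrable_path[where B=1])
  show \<alpha>t: "is_strategy X m t \<alpha>" using is_strategy_mono[OF \<alpha>] by simp
  have k: "(\<lambda>h. distr (block m t (\<alpha> t h)) (hspace X (Suc t * m)) (join m t h))
    \<in> hspace X (t * m) \<rightarrow>\<^sub>M prob_algebra (hspace X (Suc t * m))"
    using \<alpha> by (intro kernel_measurable) (auto simp: is_strategy_def)
  have "(\<lambda>h. measure (distr (block m t (\<alpha> t h)) (hspace X (Suc t * m)) (join m t h)) B)
    \<in> borel_measurable (hspace X (t * m))"
    by (rule measurable_compose[OF measurable_prob_algebraD[OF k] measurable_measure_subprob_algebra[OF B]])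
  also have "?this \<longleftrightarrow> (\<lambda>h. measure (block m t (\<alpha> t h))
    {y \<in> space (PiM {t * m..<Suc t * m} (\<lambda>_. sig X)). join m t h y \<in> B}) \<in> borel_measurable (hspace X (t * m))"
    using B
    by (intro measurable_cong)
       (auto simp: measure_distr[OF measurable_block[OF measurable_join2]] space_block
         intro!: arg_cong2[where f=measure])
  finally show "(\<lambda>h. measure (block m t (\<alpha> t h))
    {y \<in> space (PiM {t * m..<Suc t * m} (\<lambda>_. sig X)). join m t h y \<in> B}) \<in> borel_measurable (hspace X (t * m))" .
qed (use prob_space.prob_le_1[OF prob_block] in auto)

end

section \<open>Concave utility and the first-best problem\<close>

locale utility =
  fixes u u' u'' :: "real \<Rightarrow> real" and w :: real
  assumes u_d1: "\<And>x. x \<ge> w \<Longrightarrow> (u has_real_derivative u' x) (at x within {w..})"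
    and u_d2: "\<And>x. x \<ge> w \<Longrightarrow> (u' has_real_derivative u'' x) (at x within {w..})"
    and u''_cont: "continuous_on {w..} u''"
    and u'_pos: "\<And>x. x \<ge> w \<Longrightarrow> u' x > 0"
    and u''_neg: "\<And>x. x \<ge> w \<Longrightarrow> u'' x < 0"
begin

lemma mvt_from:
  assumes d: "\<And>x. x \<ge> w \<Longrightarrow> (f has_real_derivative f' x) (at x within {w..})"
    and "w \<le> a" "a < b"
  shows "\<exists>z. a < z \<and> z < b \<and> f b - f a = f' z * (b - a)"
proof -
  have "\<exists>z\<in>{a<..<b}. f b - f a = (*) (f' z) (b - a)"
  proof (rule mvt_simple[OF \<open>a < b\<close>])
    fix x assume "a \<le> x" "x \<le> b"
    then show "(f has_derivative (*) (f' x)) (at x within {a..b})"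
      using d[of x] assms
      by (intro has_derivative_subset[of f "(*) (f' x)" x "{w..}" "{a..b}"]) (auto simp: has_field_derivative_def)
  qed
  then show ?thesis by auto
qed

lemma u'_antimono: "w \<le> x \<Longrightarrow> x \<le> y \<Longrightarrow> u' y \<le> u' x"
proof (cases "x = y")
  case False
  assume a: "w \<le> x" "x \<le> y"
  then obtain z where "x < z" "u' y - u' x = u'' z * (y - x)"
    using mvt_from[OF u_d2, of x y] False by auto
  moreover from this have "u'' z * (y - x) \<le> 0"
    using u''_neg[of z] a by (intro mult_nonpos_nonneg) auto
  ultimately show ?thesis by simp
qed simp

lemma u'_strict_antimono: "w \<le> x \<Longrightarrow> x < y \<Longrightarrow> u' y < u' x"
proof -
  assume a: "w \<le> x" "x < y"
  then obtain z where z: "x < z" "u' y - u' x = u'' z * (y - x)"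
    using mvt_from[OF u_d2, of x y] by auto
  moreover have "u'' z * (y - x) < 0" using u''_neg[of z] a z by (intro mult_neg_pos) auto
  ultimately show ?thesis by simp
qed

lemma tangent_strict:
  assumes "w \<le> x" "w \<le> y" "x \<noteq> y"
  shows "u x < u y + u' y * (x - y)"
proof (cases "x < y")
  case True
  then obtain z where z: "x < z" "z < y" "u y - u x = u' z * (y - x)"
    using mvt_from[OF u_d1, of x y] assms by auto
  have "u' y * (y - x) < u' z * (y - x)"
    using u'_strict_antimono[of z y] z assms True by (intro mult_strict_right_mono) auto
  then show ?thesis using z by (simp add: algebra_simps)
next
  case False
  then obtain z where z: "y < z" "z < x" "u x - u y = u' z * (x - y)"
    using mvt_from[OF u_d1, of y x] assms by auto
  have "u' z * (x - y) < u' y * (x - y)"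
    using u'_strict_antimono[of y z] z assms False by (intro mult_strict_right_mono) auto
  then show ?thesis using z by (simp add: algebra_simps)
qed

lemma tangent: "w \<le> x \<Longrightarrow> w \<le> y \<Longrightarrow> u x \<le> u y + u' y * (x - y)"
  using tangent_strict[of x y] by (cases "x = y") auto

lemma slope_lower: "w \<le> x \<Longrightarrow> x \<le> y \<Longrightarrow> y \<le> Y \<Longrightarrow> u' Y * (y - x) \<le> u y - u x"
  using tangent[of x y] mult_right_mono[OF u'_antimono[of y Y], of "y - x"]
  by (simp add: algebra_simps)

lemma slope_upper: "w \<le> x \<Longrightarrow> x \<le> y \<Longrightarrow> u y - u x \<le> u' w * (y - x)"
  using tangent[of y x] mult_right_mono[OF u'_antimono[of w x], of "y - x"]
  by (simp add: algebra_simps)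

lemma u_strict_mono: "w \<le> x \<Longrightarrow> x < y \<Longrightarrow> u x < u y"
  using slope_lower[of x y y] u'_pos[of y] mult_pos_pos[of "u' y" "y - x"] by linarith

lemma u_mono: "w \<le> x \<Longrightarrow> x \<le> y \<Longrightarrow> u x \<le> u y"
  using u_strict_mono[of x y] by (cases "x = y") auto

lemma u_le_cancel: "w \<le> x \<Longrightarrow> w \<le> y \<Longrightarrow> u x \<le> u y \<longleftrightarrow> x \<le> y"
  using u_strict_mono[of y x] u_mono[of x y] by fastforce

lemma inj_u: "inj_on u {w..}"
proof (rule linorder_inj_onI')
  fix x y assume "x \<in> {w..}" "x < y"
  then show "u x \<noteq> u y" using u_strict_mono[of x y] by auto
qed

lemma u_hinv: "v \<in> u ` {w..} \<Longrightarrow> u (hinv u w v) = v"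
  unfolding hinv_def by (rule f_the_inv_into_f[OF inj_u])

lemma hinv_ge: "v \<in> u ` {w..} \<Longrightarrow> w \<le> hinv u w v"
  unfolding hinv_def using the_inv_into_into[OF inj_u _ order_refl] by auto

lemma hinv_u: "w \<le> x \<Longrightarrow> hinv u w (u x) = x"
  unfolding hinv_def by (rule the_inv_into_f_f[OF inj_u]) simp

lemma u_cont: "continuous_on {w..} u"
  using u_d1 by (intro DERIV_continuous_on) auto

lemma range_downward:
  assumes "w \<le> y" "u w \<le> v" "v \<le> u y"
  shows "v \<in> u ` {w..}"
proof -
  have "\<exists>x\<ge>w. x \<le> y \<and> u x = v"
    using assms by (intro IVT') (auto intro: continuous_on_subset[OF u_cont])
  then show ?thesis by auto
qed

lemma hinv_interior:
  assumes "v \<in> interior (u ` {w..})"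
  shows "w < hinv u w v" "u w < v" "\<exists>y > hinv u w v. u y > v"
proof -
  from assms have v: "v \<in> u ` {w..}" using interior_subset by blast
  obtain e where e: "e > 0" "ball v e \<subseteq> u ` {w..}" using assms by (meson mem_interior)
  have "v - e / 2 \<in> u ` {w..}" using e by (intro subsetD[OF e(2)]) (auto simp: dist_real_def)
  then obtain x where x: "x \<ge> w" "u x = v - e / 2" by auto
  then show uw: "u w < v" using e u_mono[of w x] by auto
  show "w < hinv u w v" using uw u_hinv[OF v] hinv_ge[OF v] by (cases "hinv u w v = w") auto
  have "v + e / 2 \<in> u ` {w..}" using e by (intro subsetD[OF e(2)]) (auto simp: dist_real_def)
  then obtain y where y: "y \<ge> w" "u y = v + e / 2" by auto
  have "hinv u w v < y"
    using u_le_cancel[of y "hinv u w v"] y e u_hinv[OF v] hinv_ge[OF v] by auto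
  then show "\<exists>y > hinv u w v. u y > v" using y e by auto
qed

text \<open>The continuous, negative \<open>u''\<close> stays below a negative constant on the
  compact interval up to \<open>Y\<close>, and half its absolute value serves as
  \<open>\<sigma>\<close>. The cap \<open>Y\<close> is there because the curvature may fade at
  infinity.\<close>

lemma strong_tangent:
  assumes "w \<le> Y"
  shows "\<exists>\<sigma>>0. \<forall>x y. w \<le> x \<longrightarrow> x \<le> y \<longrightarrow> y \<le> Y \<longrightarrow> u x + \<sigma> * (y - x)\<^sup>2 \<le> u y + u' y * (x - y)"
proof -
  have "continuous_on {w..Y} u''" by (rule continuous_on_subset[OF u''_cont]) auto
  then obtain m where m: "m \<in> {w..Y}" "\<And>x. x \<in> {w..Y} \<Longrightarrow> u'' x \<le> u'' m"
    using continuous_attains_sup[of "{w..Y}" u''] assms by auto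
  define \<sigma> where "\<sigma> = - u'' m / 2"
  have \<sigma>: "\<sigma> > 0" using u''_neg[of m] m by (auto simp: \<sigma>_def)
  have "u x + \<sigma> * (y - x)\<^sup>2 \<le> u y + u' y * (x - y)" if xy: "w \<le> x" "x \<le> y" "y \<le> Y" for x y
  proof (cases "x = y")
    case False
    \<comment> \<open>\<open>\<phi>\<close> is the slack of the claim as a function of the left
      argument. It vanishes at \<open>y\<close>, and its derivative is nonpositive to the left of
      \<open>y\<close>.\<close>
    define \<phi> where "\<phi> s = u y + u' y * (s - y) - u s - \<sigma> * (y - s)\<^sup>2" for s
    define \<phi>' where "\<phi>' s = u' y - u' s + 2 * \<sigma> * (y - s)" for s
    have "(\<phi> has_real_derivative \<phi>' s) (at s within {w..})" if "s \<ge> w" for s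
      unfolding \<phi>_def[abs_def] \<phi>'_def
      by (rule derivative_eq_intros u_d1[OF that] refl | simp add: algebra_simps)+
    from mvt_from[OF this xy(1), of y] xy False obtain z
      where z: "x < z" "z < y" "\<phi> y - \<phi> x = \<phi>' z * (y - x)" by auto
    obtain \<xi> where \<xi>: "z < \<xi>" "\<xi> < y" "u' y - u' z = u'' \<xi> * (y - z)"
      using mvt_from[OF u_d2, of z y] xy z by auto
    have "u'' \<xi> * (y - z) \<le> u'' m * (y - z)" using m \<xi> z xy by (intro mult_right_mono) auto
    then have "\<phi>' z \<le> 0" using \<xi> by (simp add: \<phi>'_def \<sigma>_def)
    then have "\<phi>' z * (y - x) \<le> 0" using xy by (intro mult_nonpos_nonneg) auto
    then have "\<phi> x \<ge> 0" using z by (simp add: \<phi>_def)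
    then show ?thesis by (simp add: \<phi>_def)
  qed simp
  then show ?thesis using \<sigma> by auto
qed

end

section \<open>The static problem over lotteries of actions\<close>

locale static_problem = utility +
  fixes c g :: "'a::finite \<Rightarrow> real" and astar :: 'a
  assumes c_int: "range c \<subseteq> interior (u ` {w..})"
    and c_distinct: "\<And>a. a \<noteq> astar \<Longrightarrow> c a \<noteq> c astar"
begin

definition "ystar = hinv u w (c astar)"
definition "GFB = g astar - ystar"

lemma c_range: "c a \<in> u ` {w..}"
  using c_int interior_subset by blast

lemma ystar: "w < ystar" "u ystar = c astar"
  using hinv_interior[of "c astar"] u_hinv[OF c_range] c_int by (auto simp: ystar_def)

lemma c_gt: "u w < c a"
  using hinv_interior(2)[of "c a"] c_int by auto

text \<open>The point of cost \<open>c a\<close> and gain \<open>g a\<close> lies on the tangent, at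
  \<open>astar\<close>, to the principal's indifference curve of level \<open>GFB\<close>; that
  curve has slope \<open>1 / u' ystar\<close> there.\<close>

definition tangent_to :: "'a \<Rightarrow> bool" where
  "tangent_to a \<longleftrightarrow> u' ystar * (g a - g astar) = c a - c astar"

text \<open>A randomisation between two actions is the only one that the richness assumption
  provides, and it is enough to exclude that the line of slope \<open>1 / u' ystar\<close> through
  the first-best point touches the other points on both sides.\<close>

lemma mixing_tangent:
  assumes \<theta>: "0 < \<theta>" "\<theta> \<le> 1"
    and mix: "\<And>a b p y. 0 < p \<Longrightarrow> p < 1 \<Longrightarrow> a \<noteq> astar \<Longrightarrow> w \<le> y \<Longrightarrow>
      c astar + \<theta> * (p * c a + (1 - p) * c b - c astar) \<le> u y \<Longrightarrow>
      g astar + \<theta> * (p * g a + (1 - p) * g b - g astar) - y < GFB"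
  shows "u' ystar * (g a - g astar) \<le> c a - c astar"
    and "tangent_to a \<Longrightarrow> tangent_to b \<Longrightarrow> c a < c astar \<Longrightarrow> c astar < c b \<Longrightarrow> False"
proof -
  show "u' ystar * (g a - g astar) \<le> c a - c astar"
  proof (rule ccontr)
    assume neg: "\<not> ?thesis"
    then have a: "a \<noteq> astar" by auto
    \<comment> \<open>Move weight \<open>l\<close> from \<open>astar\<close> to \<open>a\<close> and
      change the wage by exactly the resulting gain \<open>l * d\<close>. The principal stays at
      \<open>GFB\<close>, while the agent's slack \<open>D l\<close> has positive derivative at
      \<open>0\<close>, so a small \<open>l\<close> contradicts strictness. The lottery has
      probability \<open>l / \<theta>\<close> for \<open>a\<close>, hence the requirement
      \<open>l < \<theta>\<close>.\<close>
    define d where "d = g a - g astar"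
    define D where "D l = u (ystar + l * d) - c astar - l * (c a - c astar)" for l
    have "(u has_real_derivative u' ystar) (at ystar)"
      using u_d1[of ystar] ystar(1) at_within_interior[of ystar "{w..}"] by (simp add: interior_real_atLeast)
    then have "(u has_real_derivative u' ystar) (at (ystar + 0 * d))" by simp
    then have "(D has_real_derivative u' ystar * d - (c a - c astar)) (at 0)"
      unfolding D_def[abs_def]
      by (auto intro!: derivative_eq_intros DERIV_chain'[where g=u, of _ d])
    from DERIV_pos_inc_right[OF this] neg obtain e
      where e: "e > 0" "\<And>l. 0 < l \<Longrightarrow> l < e \<Longrightarrow> D 0 < D (0 + l)" by (auto simp: d_def)
    have "((\<lambda>l. ystar + l * d) \<longlongrightarrow> ystar + 0 * d) (at_right 0)" by (intro tendsto_intros)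
    then have "\<forall>\<^sub>F l in at_right 0. w < ystar + l * d"
      using ystar by (intro order_tendstoD) auto
    moreover have "\<forall>\<^sub>F l in at_right (0::real). l < min e \<theta>"
      using e \<theta> by (intro order_tendstoD(2)[OF tendsto_ident_at]) auto
    moreover have "\<forall>\<^sub>F l in at_right (0::real). 0 < l" by (simp add: eventually_at_right_less)
    ultimately have "\<forall>\<^sub>F l in at_right (0::real). w < ystar + l * d \<and> l < min e \<theta> \<and> 0 < l"
      by eventually_elim auto
    then obtain l where l: "w < ystar + l * d" "l < e" "l < \<theta>" "0 < l"
      using eventually_happens[of _ "at_right (0::real)"] by auto
    have "D 0 < D l" using e l by auto
    then have "c astar + l * (c a - c astar) \<le> u (ystar + l * d)" by (simp add: D_def ystar)
    moreover have "\<theta> * (l / \<theta> * x + (1 - l / \<theta>) * y - y) = l * (x - y)" for x y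
      using \<theta> by (simp add: field_simps)
    ultimately have "g astar + l * (g a - g astar) - (ystar + l * d) < GFB"
      using mix[of "l / \<theta>" a "ystar + l * d" astar] l \<theta> a by simp
    then show False by (simp add: d_def GFB_def)
  qed
  assume t: "tangent_to a" "tangent_to b" and c: "c a < c astar" "c astar < c b"
  \<comment> \<open>This \<open>p\<close> makes the expected cost equal to \<open>c astar\<close>.
    Tangency then makes the expected gain equal to \<open>g astar\<close>, so the mixture would
    attain \<open>GFB\<close> at wage \<open>ystar\<close>.\<close>
  define p where "p = (c b - c astar) / (c b - c a)"
  have p: "0 < p" "p < 1" using c by (auto simp: p_def field_simps)
  have "p * (c b - c a) = c b - c astar" using c by (simp add: p_def)
  then have pc: "p * c a + (1 - p) * c b = c astar" by (simp add: algebra_simps)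
  have "u' ystar * (p * g a + (1 - p) * g b - g astar)
      = p * (u' ystar * (g a - g astar)) + (1 - p) * (u' ystar * (g b - g astar))"
    by (simp add: algebra_simps)
  also have "\<dots> = p * c a + (1 - p) * c b - c astar"
    using t unfolding tangent_to_def by (simp only:) (simp add: algebra_simps)
  finally have "p * g a + (1 - p) * g b = g astar"
    using pc u'_pos[of ystar] ystar by auto
  then show False
    using mix[of p a ystar b] p pc c ystar by (auto simp: GFB_def)
qed

text \<open>A lottery attaining \<open>GFB\<close> would turn every tangent inequality into an
  equality: the wage is \<open>ystar\<close>, the mean cost is \<open>c astar\<close>, and each
  action in the support is tangent. As other actions have costs different from
  \<open>c astar\<close>, the support contains tangent actions on both sides, which
  \<open>t2\<close> excludes.\<close>

lemma gap_of_tangent: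
  assumes t1: "\<And>a. u' ystar * (g a - g astar) \<le> c a - c astar"
    and t2: "\<And>a b. tangent_to a \<Longrightarrow> tangent_to b \<Longrightarrow> c a < c astar \<Longrightarrow> c astar < c b \<Longrightarrow> False"
    and p: "\<And>a. 0 \<le> p a" "(\<Sum>a\<in>UNIV. p a) = 1" "p astar < 1"
    and y: "w \<le> y" "(\<Sum>a\<in>UNIV. p a * c a) \<le> u y"
  shows "(\<Sum>a\<in>UNIV. p a * g a) - y < GFB"
proof (rule ccontr)
  assume "\<not> ?thesis"
  then have y1: "y - ystar \<le> (\<Sum>a\<in>UNIV. p a * g a) - g astar" by (simp add: GFB_def)
  have pd: "(\<Sum>a\<in>UNIV. p a * (f a - f astar)) = (\<Sum>a\<in>UNIV. p a * f a) - f astar" for f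
    using p(2) by (simp add: right_diff_distrib sum_subtractf sum_distrib_right[symmetric])
  have up: "u' ystar > 0" using u'_pos[of ystar] ystar by simp
  define S where "S = (\<Sum>a\<in>UNIV. p a * (c a - c astar))"
  define R where "R = (\<Sum>a\<in>UNIV. p a * (u' ystar * (g a - g astar)))"
  have R: "R = u' ystar * ((\<Sum>a\<in>UNIV. p a * g a) - g astar)"
    unfolding R_def pd[symmetric] sum_distrib_left by (intro sum.cong) auto
  have S: "S = (\<Sum>a\<in>UNIV. p a * c a) - c astar" unfolding S_def pd ..
  have RS: "R \<le> S" unfolding R_def S_def using t1 p by (intro sum_mono mult_left_mono) auto
  have 1: "u' ystar * (y - ystar) \<le> R" unfolding R using y1 up by simp
  have yy: "y = ystar"
  proof (rule ccontr)
    assume "y \<noteq> ystar"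
    from tangent_strict[OF y(1) _ this] have "u y - c astar < u' ystar * (y - ystar)"
      using ystar by auto
    then show False using 1 RS S y(2) by simp
  qed
  then have S0: "S = 0" "R = 0" using 1 RS S y(2) ystar by auto
  have nn: "0 \<le> p a * (c a - c astar - u' ystar * (g a - g astar))" for a
    using t1[of a] p(1)[of a] by (intro mult_nonneg_nonneg) auto
  have "(\<Sum>a\<in>UNIV. p a * (c a - c astar - u' ystar * (g a - g astar))) = S - R"
    unfolding S_def R_def by (simp add: sum_subtractf[symmetric] right_diff_distrib)
  then have "\<forall>a\<in>UNIV. p a * (c a - c astar - u' ystar * (g a - g astar)) = 0"
    using S0 nn by (subst sum_nonneg_eq_0_iff[symmetric]) auto
  then have tan: "tangent_to a" if "p a > 0" for a using that by (metis UNIV_I eq_iff_diff_eq_0 less_irrefl mult_eq_0_iff tangent_to_def)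
  have "\<exists>a. a \<noteq> astar \<and> p a > 0"
  proof (rule ccontr)
    assume "\<not> ?thesis"
    then have "p a = 0" if "a \<noteq> astar" for a using p(1)[of a] that by (metis less_eq_real_def)
    then have "(\<Sum>a\<in>UNIV. p a) = (\<Sum>a\<in>{astar}. p a)" by (intro sum.mono_neutral_right) auto
    then show False using p by simp
  qed
  then obtain e where e: "e \<noteq> astar" "p e > 0" by auto
  \<comment> \<open>A weighted sum equal to zero with a positive term has a negative one; this
    supplies an action on the other side of \<open>c astar\<close>.\<close>
  have ex: "\<exists>b. p b * f b < 0" if "(\<Sum>a\<in>UNIV. p a * f a) = 0" "p e * f e > 0" for f
  proof (rule ccontr)
    assume "\<not> ?thesis"
    then have "(\<forall>a\<in>UNIV. p a * f a = 0)"
      using that(1) by (subst sum_nonneg_eq_0_iff[symmetric]) (auto simp: not_less)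
    then show False using that(2) by (metis UNIV_I less_irrefl)
  qed
  show False
  proof (cases "c e < c astar")
    case True
    have "(\<Sum>a\<in>UNIV. p a * - (c a - c astar)) = 0"
      using S0 unfolding S_def mult_minus_right sum_negf by simp
    moreover have "p e * - (c e - c astar) > 0" using True e by (intro mult_pos_pos) auto
    ultimately obtain b where "p b * - (c b - c astar) < 0"
      using ex[of "\<lambda>a. - (c a - c astar)"] by blast
    then have "p b > 0" "c astar < c b"
      using p(1)[of b] by (auto simp: mult_less_0_iff)
    then show False using t2[OF tan tan, of e b] e True by auto
  next
    case False
    then have "c astar < c e" using c_distinct[OF e(1)] by auto
    moreover obtain b where "p b * (c b - c astar) < 0"
      using ex[of "\<lambda>a. c a - c astar"] S0 \<open>c astar < c e\<close> e by (auto simp: S_def)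
    then have "p b > 0" "c b < c astar"
      using p(1)[of b] by (auto simp: mult_less_0_iff)
    ultimately show False using t2[OF tan tan, of b e] e by auto
  qed
qed

text \<open>A strict inequality at each point of a compact set of lotteries and wages improves to a
  uniform one.\<close>

lemma uniform_gap:
  assumes strict: "\<And>p y. (\<And>a. 0 \<le> p a) \<Longrightarrow> (\<Sum>a\<in>UNIV. p a) = 1 \<Longrightarrow> p astar < 1 \<Longrightarrow> w \<le> y \<Longrightarrow>
      (\<Sum>a\<in>UNIV. p a * c a) \<le> u y \<Longrightarrow> (\<Sum>a\<in>UNIV. p a * g a) - y < GFB"
    and \<eta>: "\<eta> > 0"
  shows "\<exists>L>0. \<forall>p y. (\<forall>a. 0 \<le> p a) \<longrightarrow> (\<Sum>a\<in>UNIV. p a) = 1 \<longrightarrow> p astar \<le> 1 - \<eta> \<longrightarrow> w \<le> y \<longrightarrow>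
      (\<Sum>a\<in>UNIV. p a * c a) \<le> u y \<longrightarrow> (\<Sum>a\<in>UNIV. p a * g a) - y \<le> GFB - L"
proof -
  define gM where "gM = (\<Sum>a\<in>UNIV. \<bar>g a\<bar>)"
  \<comment> \<open>Wages above \<open>Y\<close> already lose more than \<open>1\<close>, since the
    expected gain never exceeds \<open>gM\<close>; only wages up to \<open>Y\<close> have to be
    covered by compactness.\<close>
  define Y where "Y = max w (gM - GFB + 1)"
  have gM: "(\<Sum>a\<in>UNIV. p a * g a) \<le> gM" if "\<And>a. 0 \<le> p a" "(\<Sum>a\<in>UNIV. p a) = 1" for p
    unfolding gM_def
  proof (rule sum_mono)
    fix a
    have "p a \<le> (\<Sum>a\<in>UNIV. p a)" using that(1) by (intro member_le_sum) auto
    then have "p a * \<bar>g a\<bar> \<le> \<bar>g a\<bar>" using that by (intro mult_left_le_one_le) auto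
    moreover have "p a * g a \<le> p a * \<bar>g a\<bar>" using that by (intro mult_left_mono) auto
    ultimately show "p a * g a \<le> \<bar>g a\<bar>" by simp
  qed
  define C where "C = (cbox 0 1 \<inter> {p :: real^'a. (\<Sum>a\<in>UNIV. p $ a) = 1} \<inter> {p. p $ astar \<le> 1 - \<eta>}) \<times> {w..Y}"
  define K where "K = {q \<in> C. (\<Sum>a\<in>UNIV. fst q $ a * c a) \<le> u (snd q)}"
  have C: "compact C" unfolding C_def
    by (intro compact_Times compact_Int_closed compact_cbox compact_Icc closed_Collect_eq closed_Collect_le
        continuous_intros)
  have "continuous_on C (\<lambda>q. u (snd q))"
    by (rule continuous_on_compose2[OF u_cont]) (auto simp: C_def intro!: continuous_intros)
  then have "closed K" unfolding K_def
    by (intro continuous_on_closed_Collect_le compact_imp_closed[OF C]) (intro continuous_intros)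
  then have "compact K"
    using compact_Int_closed[OF C, of K] by (simp add: K_def Int_absorb1 Collect_subset)
  have inK: "((\<chi> a. p a), y) \<in> K"
    if "\<forall>a. 0 \<le> p a" "(\<Sum>a\<in>UNIV. p a) = 1" "p astar \<le> 1 - \<eta>" "w \<le> y" "y \<le> Y"
      "(\<Sum>a\<in>UNIV. p a * c a) \<le> u y" for p y
  proof -
    have "p a \<le> (\<Sum>a\<in>UNIV. p a)" for a using that(1) by (intro member_le_sum) auto
    then show ?thesis using that by (auto simp: K_def C_def mem_box_cart)
  qed
  let ?f = "\<lambda>q :: (real^'a) \<times> real. (\<Sum>a\<in>UNIV. fst q $ a * g a) - snd q"
  have "\<exists>L>0. \<forall>q\<in>K. ?f q \<le> GFB - L"
  proof (cases "K = {}")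
    case True then show ?thesis by (auto intro: exI[of _ 1])
  next
    case False
    have "continuous_on K ?f" by (intro continuous_intros)
    from continuous_attains_sup[OF \<open>compact K\<close> False this] obtain q where
      q: "q \<in> K" "\<And>r. r \<in> K \<Longrightarrow> ?f r \<le> ?f q" by auto
    have "?f q < GFB"
      by (rule strict) (use q(1) \<eta> in \<open>auto simp: K_def C_def mem_box_cart\<close>)
    then show ?thesis using q by (intro exI[of _ "GFB - ?f q"]) auto
  qed
  then obtain L where L: "L > 0" "\<And>q. q \<in> K \<Longrightarrow> ?f q \<le> GFB - L" by auto
  have "(\<Sum>a\<in>UNIV. p a * g a) - y \<le> GFB - min L 1"
    if "\<forall>a. 0 \<le> p a" "(\<Sum>a\<in>UNIV. p a) = 1" "p astar \<le> 1 - \<eta>" "w \<le> y"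
      "(\<Sum>a\<in>UNIV. p a * c a) \<le> u y" for p y
  proof (cases "y \<le> Y")
    case True
    show ?thesis using L(2)[OF inK[OF that(1-4) True that(5)]] by simp
  next
    case False
    then show ?thesis using gM[of p] that by (auto simp: Y_def)
  qed
  then show ?thesis using L(1) by (intro exI[of _ "min L 1"]) auto
qed

end

text \<open>Dividing the logarithm by \<open>k\<close> removes the constants \<open>C\<close>, so
  bounds at every exponent strictly on either side of \<open>K\<close> determine the rate. Replacing
  \<open>k\<close> by \<open>n = k * T\<close> divides it by \<open>T\<close>.\<close>

lemma ln_rate_limit:
  fixes D :: "nat \<Rightarrow> real"
  assumes "T > 0" "K > 0"
    and lo: "\<And>s. s > K \<Longrightarrow> \<exists>C>0. \<forall>\<^sub>F k in sequentially. C * exp (- s * real k) \<le> D k"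
    and up: "\<And>s. 0 < s \<Longrightarrow> s < K \<Longrightarrow> \<exists>C>0. \<forall>\<^sub>F k in sequentially. D k \<le> C * exp (- s * real k)"
  shows "\<forall>\<^sub>F k in sequentially. D k > 0"
    and "(\<lambda>k. ln (D k) / real (k * T)) \<longlonglongrightarrow> - (K / real T)"
proof -
  obtain C where C: "C > 0" "\<forall>\<^sub>F k in sequentially. C * exp (- (K + 1) * real k) \<le> D k"
    using lo[of "K + 1"] by auto
  show pos: "\<forall>\<^sub>F k in sequentially. D k > 0"
    using C(2) by eventually_elim (use C(1) in \<open>auto intro: less_le_trans[of 0 "C * exp _"]\<close>)
  have small: "\<forall>\<^sub>F k in sequentially. \<bar>ln C\<bar> < e * real k" if "e > 0" for C e :: real
    using eventually_gt_at_top[of "nat \<lceil>\<bar>ln C\<bar> / e\<rceil>"]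
  proof eventually_elim
    case (elim k)
    then have "\<bar>ln C\<bar> / e < real k" by linarith
    then show ?case using that by (simp add: field_simps)
  qed
  have "(\<lambda>k. ln (D k) / real k) \<longlonglongrightarrow> - K"
  proof (rule order_tendstoI)
    fix a assume a: "a < - K"
    \<comment> \<open>The midpoint of \<open>K\<close> and \<open>-a\<close>: the distance left to
      \<open>-a\<close> absorbs \<open>ln C / k\<close>.\<close>
    define s where "s = (K - a) / 2"
    have s: "s > K" "0 < - a - s" using a by (auto simp: s_def)
    obtain C where C: "C > 0" "\<forall>\<^sub>F k in sequentially. C * exp (- s * real k) \<le> D k"
      using lo[OF s(1)] by auto
    show "\<forall>\<^sub>F k in sequentially. a < ln (D k) / real k"
      using C(2) pos small[OF s(2), of C] eventually_gt_at_top[of 0]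
    proof eventually_elim
      case (elim k)
      have "ln (C * exp (- s * real k)) \<le> ln (D k)" using elim C by (subst ln_le_cancel_iff) auto
      then have "ln C - s * real k \<le> ln (D k)" using C by (simp add: ln_mult)
      then have "a * real k < ln (D k)" using elim(3) by (simp add: algebra_simps)
      then show ?case using elim by (simp add: field_simps)
    qed
  next
    fix a assume a: "- K < a"
    \<comment> \<open>The midpoint of \<open>K\<close> and \<open>-a\<close> may fail to be positive
      when \<open>a\<close> is large; the maximum with \<open>K / 2\<close> keeps \<open>s\<close>
      between \<open>0\<close> and \<open>K\<close>.\<close>
    define s where "s = max (K / 2) ((K - a) / 2)"
    have s: "0 < s" "s < K" "0 < a + s" using a \<open>K > 0\<close> by (auto simp: s_def max_def field_simps)
    obtain C where C: "C > 0" "\<forall>\<^sub>F k in sequentially. D k \<le> C * exp (- s * real k)"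
      using up[OF s(1,2)] by auto
    show "\<forall>\<^sub>F k in sequentially. ln (D k) / real k < a"
      using C(2) pos small[OF s(3), of C] eventually_gt_at_top[of 0]
    proof eventually_elim
      case (elim k)
      have "ln (D k) \<le> ln (C * exp (- s * real k))" using elim C by (subst ln_le_cancel_iff) auto
      then have "ln (D k) \<le> ln C - s * real k" using C by (simp add: ln_mult)
      then have "ln (D k) < a * real k" using elim(3) by (simp add: algebra_simps)
      then show ?case using elim by (simp add: field_simps)
    qed
  qed
  then have "(\<lambda>k. ln (D k) / real k / real T) \<longlonglongrightarrow> - K / real T"
    by (intro tendsto_divide tendsto_const) (use assms in auto)
  then show "(\<lambda>k. ln (D k) / real (k * T)) \<longlonglongrightarrow> - (K / real T)"
    by (simp add: divide_divide_eq_left)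
qed

section \<open>Costs and benefits of strategies\<close>

locale agency = monitoring \<mu> X + static_problem u u' u'' w c g astar
  for \<mu> :: "'a::finite \<Rightarrow> 'x::euclidean_space measure" and X :: "'x set"
    and u u' u'' :: "real \<Rightarrow> real" and w :: real and c g :: "'a \<Rightarrow> real" and astar :: 'a +
  fixes T :: nat
  assumes T_pos: "T > 0"
    and distinct: "inj \<mu>"
    and abs_cont: "\<And>a a'. absolutely_continuous (\<mu> a) (\<mu> a')"
    and moments: "\<And>a a' l. l > 0 \<Longrightarrow>
        integrable (\<mu> a) (\<lambda>x. enn2real (RN_deriv (\<mu> a) (\<mu> a') x) powr l)"
    and rich: "\<And>p a. 0 < p \<Longrightarrow> p < 1 \<Longrightarrow> \<exists>Y\<in>sets (sig X). measure (\<mu> a) Y = p"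
    and fb_strict: "\<And>n \<alpha>. n > 0 \<Longrightarrow> T dvd n \<Longrightarrow> is_strategy X (n div T) T \<alpha> \<Longrightarrow>
        \<not> (AE x in path \<mu> X (n div T) \<alpha> T. \<forall>t<T. act \<alpha> (n div T) t x = astar) \<Longrightarrow>
        fb_value \<mu> X T n u w c g \<alpha> < fb_value \<mu> X T n u w c g (\<lambda>_ _. astar)"
    and c_lower: "\<exists>a. c a < c astar"
begin

definition ratio :: "'a \<Rightarrow> 'x \<Rightarrow> real" where
  "ratio a x = enn2real (RN_deriv (\<mu> astar) (\<mu> a) x)"

text \<open>Absolute continuity makes the Radon-Nikodym derivative an almost everywhere finite
  density, and the moment assumption at exponent \<open>2\<close> gives its square
  integrability.\<close>

lemma likelihood: "likelihood_ratio (\<mu> astar) (\<mu> a) (ratio a)"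
proof -
  interpret N: prob_space "\<mu> astar" by (rule prob)
  interpret M: prob_space "\<mu> a" by (rule prob)
  have s: "sets (\<mu> a) = sets (\<mu> astar)" by (simp add: sets_mu)
  show ?thesis
  proof
    have "AE x in \<mu> astar. ennreal (ratio a x) = RN_deriv (\<mu> astar) (\<mu> a) x"
      using N.RN_deriv_finite[OF M.sigma_finite_measure_axioms abs_cont s]
      by eventually_elim (simp add: ratio_def less_top[symmetric])
    then have "density (\<mu> astar) (\<lambda>x. ennreal (ratio a x)) = density (\<mu> astar) (RN_deriv (\<mu> astar) (\<mu> a))"
      by (intro density_cong) (auto simp: ratio_def[abs_def])
    then show "density (\<mu> astar) (\<lambda>x. ennreal (ratio a x)) = \<mu> a"
      using N.density_RN_deriv[OF abs_cont s] by simp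
    have "x powr 2 = x\<^sup>2" if "x \<ge> 0" for x :: real
      using that by (cases "x = 0") auto
    then show "integrable (\<mu> astar) (\<lambda>x. (ratio a x)\<^sup>2)"
      using moments[of 2 astar a] by (simp add: ratio_def)
  qed (auto simp: ratio_def[abs_def])
qed

lemma mult_div: "(k * T) div T = k"
  using T_pos by simp

lemma hspace_commute: "hspace X (k * T) = hspace X (T * k)"
  by (simp add: mult.commute)

lemma mean_const: "is_strategy X k T \<alpha> \<Longrightarrow> freq k T \<alpha> a = 1 \<Longrightarrow> mean k T \<alpha> \<phi> = \<phi> a"
proof -
  assume \<alpha>: "is_strategy X k T \<alpha>" and a: "freq k T \<alpha> a = 1"
  have "(\<Sum>b\<in>UNIV - {a}. freq k T \<alpha> b) = 0"
    using sum_freq[OF \<alpha> T_pos] a by (simp add: sum_diff1)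
  then have "\<forall>b\<in>UNIV - {a}. freq k T \<alpha> b = 0"
    by (subst sum_nonneg_eq_0_iff[symmetric]) (auto simp: freq_nonneg)
  then have "(\<Sum>b\<in>UNIV. freq k T \<alpha> b * \<phi> b) = (\<Sum>b\<in>{a}. freq k T \<alpha> b * \<phi> b)"
    by (intro sum.mono_neutral_right) auto
  then show ?thesis using mean_eq_freq[OF \<alpha>] a by simp
qed

lemma freq_le_1: "is_strategy X k T \<alpha> \<Longrightarrow> freq k T \<alpha> a \<le> 1"
  using member_le_sum[of a UNIV "freq k T \<alpha>"] sum_freq[OF _ T_pos, of k \<alpha>] freq_nonneg by simp

lemma mean_le: "is_strategy X k T \<alpha> \<Longrightarrow> mean k T \<alpha> \<phi> \<le> (\<Sum>a\<in>UNIV. \<bar>\<phi> a\<bar>)"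
proof -
  assume \<alpha>: "is_strategy X k T \<alpha>"
  have "freq k T \<alpha> a * \<phi> a \<le> \<bar>\<phi> a\<bar>" for a
  proof -
    have "freq k T \<alpha> a * \<phi> a \<le> freq k T \<alpha> a * \<bar>\<phi> a\<bar>" by (intro mult_left_mono freq_nonneg) auto
    also have "\<dots> \<le> \<bar>\<phi> a\<bar>" by (intro mult_left_le_one_le freq_nonneg freq_le_1[OF \<alpha>]) auto
    finally show ?thesis .
  qed
  then show ?thesis unfolding mean_eq_freq[OF \<alpha>] by (intro sum_mono) auto
qed

section \<open>Payoffs and the first-best value\<close>

lemma agent_util_eq:
  assumes "is_strategy X k T \<alpha>" "integrable (path \<mu> X k \<alpha> T) v"
  shows "agent_util \<mu> X T (k * T) c \<alpha> v = (\<integral>x. v x \<partial>path \<mu> X k \<alpha> T) - mean k T \<alpha> c"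
  unfolding agent_util_def mult_div
  by (subst Bochner_Integration.integral_diff[OF assms(2) integrable_avg[OF assms(1)]])
     (simp only: integral_avg[OF assms(1)])

lemma princ_pay_eq:
  assumes "is_strategy X k T \<alpha>" "integrable (path \<mu> X k \<alpha> T) (\<lambda>x. hinv u w (v x))"
  shows "princ_pay \<mu> X T (k * T) u w g \<alpha> v = mean k T \<alpha> g - (\<integral>x. hinv u w (v x) \<partial>path \<mu> X k \<alpha> T)"
  unfolding princ_pay_def mult_div
  by (subst Bochner_Integration.integral_diff[OF integrable_avg[OF assms(1)] assms(2)])
     (simp only: integral_avg[OF assms(1)])

lemma contract_range:
  assumes "is_contract X (k * T) u w v" "is_strategy X k T \<alpha>" "x \<in> space (path \<mu> X k \<alpha> T)"
  shows "v x \<in> u ` {w..}"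
  using assms by (simp add: is_contract_def space_path hspace_commute)

lemma wage_ge:
  assumes "fb_feasible \<mu> X T (k * T) u w c \<alpha> v"
  shows "w \<le> (\<integral>x. hinv u w (v x) \<partial>path \<mu> X k \<alpha> T)"
proof -
  have \<alpha>: "is_strategy X k T \<alpha>" and con: "is_contract X (k * T) u w v"
    and ih: "integrable (path \<mu> X k \<alpha> T) (\<lambda>x. hinv u w (v x))"
    using assms by (auto simp: fb_feasible_def mult_div)
  interpret P: prob_space "path \<mu> X k \<alpha> T" by (rule prob_path[OF \<alpha>])
  have "(\<integral>x. w \<partial>path \<mu> X k \<alpha> T) \<le> (\<integral>x. hinv u w (v x) \<partial>path \<mu> X k \<alpha> T)"
    using ih hinv_ge[OF contract_range[OF con \<alpha>]] by (intro integral_mono) auto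
  then show ?thesis by (simp add: P.prob_space)
qed

text \<open>The first bound is Jensen's inequality through the tangent at the mean wage
  \<open>y\<close>; the second is (IR).\<close>

lemma expected_utility_le:
  assumes "fb_feasible \<mu> X T (k * T) u w c \<alpha> v"
  defines "y \<equiv> (\<integral>x. hinv u w (v x) \<partial>path \<mu> X k \<alpha> T)"
  shows "(\<integral>x. v x \<partial>path \<mu> X k \<alpha> T) \<le> u y" "mean k T \<alpha> c \<le> (\<integral>x. v x \<partial>path \<mu> X k \<alpha> T)"
proof -
  have \<alpha>: "is_strategy X k T \<alpha>" and con: "is_contract X (k * T) u w v"
    and iv: "integrable (path \<mu> X k \<alpha> T) v"
    and ih: "integrable (path \<mu> X k \<alpha> T) (\<lambda>x. hinv u w (v x))"
    using assms by (auto simp: fb_feasible_def mult_div)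
  interpret P: prob_space "path \<mu> X k \<alpha> T" by (rule prob_path[OF \<alpha>])
  have yw: "w \<le> y" unfolding y_def by (rule wage_ge[OF assms(1)])
  have "(\<integral>x. v x \<partial>path \<mu> X k \<alpha> T)
      \<le> (\<integral>x. u y + u' y * (hinv u w (v x) - y) \<partial>path \<mu> X k \<alpha> T)"
  proof (rule integral_mono[OF iv])
    show "integrable (path \<mu> X k \<alpha> T) (\<lambda>x. u y + u' y * (hinv u w (v x) - y))" using ih by auto
    fix x assume "x \<in> space (path \<mu> X k \<alpha> T)"
    note r = contract_range[OF con \<alpha> this]
    show "v x \<le> u y + u' y * (hinv u w (v x) - y)"
      using tangent[OF hinv_ge[OF r] yw] u_hinv[OF r] by simp
  qed
  also have "\<dots> = u y" using ih by (simp add: P.prob_space y_def)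
  finally show "(\<integral>x. v x \<partial>path \<mu> X k \<alpha> T) \<le> u y" .
  show "mean k T \<alpha> c \<le> (\<integral>x. v x \<partial>path \<mu> X k \<alpha> T)"
    using assms(1) agent_util_eq[OF \<alpha> iv] by (simp add: fb_feasible_def)
qed

text \<open>Provides the upper bounds without which the real-valued \<open>Sup\<close> in the
  problem values could not be compared with single payoffs.\<close>

lemma princ_pay_le:
  assumes "fb_feasible \<mu> X T (k * T) u w c \<alpha> v"
  shows "princ_pay \<mu> X T (k * T) u w g \<alpha> v \<le> (\<Sum>a\<in>UNIV. \<bar>g a\<bar>) - w"
proof -
  have \<alpha>: "is_strategy X k T \<alpha>"
    and ih: "integrable (path \<mu> X k \<alpha> T) (\<lambda>x. hinv u w (v x))"
    using assms by (auto simp: fb_feasible_def mult_div)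
  show ?thesis using princ_pay_eq[OF \<alpha> ih] mean_le[OF \<alpha>, of g] wage_ge[OF assms] by simp
qed

lemma fb_value_ge:
  assumes \<alpha>: "is_strategy X k T \<alpha>" and y: "w \<le> y" "mean k T \<alpha> c \<le> u y"
  shows "mean k T \<alpha> g - y \<le> fb_value \<mu> X T (k * T) u w c g \<alpha>"
  unfolding fb_value_def
proof (rule cSup_upper)
  interpret P: prob_space "path \<mu> X k \<alpha> T" by (rule prob_path[OF \<alpha>])
  have "fb_feasible \<mu> X T (k * T) u w c \<alpha> (\<lambda>_. u y)"
    using \<alpha> y agent_util_eq[OF \<alpha>, of "\<lambda>_. u y"]
    by (auto simp: fb_feasible_def mult_div is_contract_def P.prob_space)
  moreover have "princ_pay \<mu> X T (k * T) u w g \<alpha> (\<lambda>_. u y) = mean k T \<alpha> g - y"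
    using y by (subst princ_pay_eq[OF \<alpha>]) (auto simp: P.prob_space hinv_u)
  ultimately show "mean k T \<alpha> g - y
    \<in> {princ_pay \<mu> X T (k * T) u w g \<alpha> v |v. fb_feasible \<mu> X T (k * T) u w c \<alpha> v}" by force
  show "bdd_above {princ_pay \<mu> X T (k * T) u w g \<alpha> v |v. fb_feasible \<mu> X T (k * T) u w c \<alpha> v}"
    using princ_pay_le by (intro bdd_aboveI[of _ "(\<Sum>a\<in>UNIV. \<bar>g a\<bar>) - w"]) auto
qed

lemma const_strategy: "is_strategy X k t (\<lambda>_ _. a)"
  by (simp add: is_strategy_def)

lemma freq_const_strategy: "freq k T (\<lambda>_ _. a) b = (if a = b then 1 else 0)"
  using T_pos prob_space.prob_space[OF prob_path[OF const_strategy]]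
  by (simp add: freq_def mean_def)

lemma mean_const_strategy: "mean k T (\<lambda>_ _. a) \<phi> = \<phi> a"
  by (rule mean_const[OF const_strategy]) (simp add: freq_const_strategy)

lemma fb_value_astar: "fb_value \<mu> X T (k * T) u w c g (\<lambda>_ _. astar) \<le> GFB"
  unfolding fb_value_def
proof (rule cSup_least)
  interpret P: prob_space "path \<mu> X k (\<lambda>_ _. astar) T" by (rule prob_path[OF const_strategy])
  have "fb_feasible \<mu> X T (k * T) u w c (\<lambda>_ _. astar) (\<lambda>_. u ystar)"
    using ystar c_range agent_util_eq[OF const_strategy, of k astar "\<lambda>_. u ystar"] const_strategy
    by (auto simp: fb_feasible_def mult_div is_contract_def P.prob_space mean_const_strategy)
  then show "{princ_pay \<mu> X T (k * T) u w g (\<lambda>_ _. astar) v |v. fb_feasible \<mu> X T (k * T) u w c (\<lambda>_ _. astar) v} \<noteq> {}"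
    by auto
next
  fix z assume "z \<in> {princ_pay \<mu> X T (k * T) u w g (\<lambda>_ _. astar) v |v. fb_feasible \<mu> X T (k * T) u w c (\<lambda>_ _. astar) v}"
  then obtain v where v: "fb_feasible \<mu> X T (k * T) u w c (\<lambda>_ _. astar) v"
    "z = princ_pay \<mu> X T (k * T) u w g (\<lambda>_ _. astar) v" by auto
  have "u ystar \<le> u (\<integral>x. hinv u w (v x) \<partial>path \<mu> X k (\<lambda>_ _. astar) T)"
    using expected_utility_le[OF v(1)] by (simp add: ystar mean_const_strategy)
  then have "ystar \<le> (\<integral>x. hinv u w (v x) \<partial>path \<mu> X k (\<lambda>_ _. astar) T)"
    using u_le_cancel[OF _ wage_ge[OF v(1)], of ystar] ystar(1) by simp
  then show "z \<le> GFB"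
    using v by (subst v(2), subst princ_pay_eq[OF const_strategy])
      (auto simp: fb_feasible_def mult_div mean_const_strategy GFB_def)
qed

lemma freq_AE:
  assumes \<alpha>: "is_strategy X k T \<alpha>"
    and ae: "AE x in path \<mu> X k \<alpha> T. \<forall>t<T. act \<alpha> k t x = a"
  shows "freq k T \<alpha> a = 1"
proof -
  interpret P: prob_space "path \<mu> X k \<alpha> T" by (rule prob_path[OF \<alpha>])
  have "freq k T \<alpha> a = (\<integral>x. (\<Sum>t<T. if act \<alpha> k t x = a then 1 else 0) / real T \<partial>path \<mu> X k \<alpha> T)"
    unfolding freq_def by (rule integral_avg[OF \<alpha>, symmetric])
  also have "\<dots> = (\<integral>x. 1 \<partial>path \<mu> X k \<alpha> T)"
  proof (rule integral_cong_AE)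
    show "AE x in path \<mu> X k \<alpha> T. (\<Sum>t<T. if act \<alpha> k t x = a then 1 else 0) / real T = 1"
      using ae by eventually_elim (use T_pos in simp)
    show "(\<lambda>x. (\<Sum>t<T. if act \<alpha> k t x = a then 1 else 0) / real T)
      \<in> borel_measurable (path \<mu> X k \<alpha> T)"
      by (rule borel_measurable_integrable[OF integrable_avg[OF \<alpha>]])
  qed simp
  finally show ?thesis by (simp add: P.prob_space)
qed

text \<open>By \<open>freq_AE\<close>, a frequency below \<open>1\<close> means that the strategy
  leaves \<open>astar\<close> with positive probability, so \<open>fb_strict\<close> applies.
  Offering the constant wage \<open>y\<close> converts it into an inequality between means.\<close>

lemma strict_below_GFB:
  assumes \<alpha>: "is_strategy X k T \<alpha>" and k: "k > 0" and f: "freq k T \<alpha> astar < 1"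
    and y: "w \<le> y" "mean k T \<alpha> c \<le> u y"
  shows "mean k T \<alpha> g - y < GFB"
proof -
  have "\<not> (AE x in path \<mu> X k \<alpha> T. \<forall>t<T. act \<alpha> k t x = astar)"
    using freq_AE[OF \<alpha>, of astar] f by auto
  then have "fb_value \<mu> X T (k * T) u w c g \<alpha> < fb_value \<mu> X T (k * T) u w c g (\<lambda>_ _. astar)"
    using fb_strict[of "k * T" \<alpha>, unfolded mult_div] k T_pos \<alpha> by simp
  then show ?thesis using fb_value_ge[OF \<alpha> y] fb_value_astar[of k] by simp
qed

lemma below_GFB:
  assumes \<alpha>: "is_strategy X k T \<alpha>" and k: "k > 0"
    and y: "w \<le> y" "mean k T \<alpha> c \<le> u y"
  shows "mean k T \<alpha> g - y \<le> GFB"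
proof (cases "freq k T \<alpha> astar < 1")
  case True
  then show ?thesis using strict_below_GFB[OF \<alpha> k _ y] by simp
next
  case False
  then have f: "freq k T \<alpha> astar = 1" using freq_le_1[OF \<alpha>, of astar] by simp
  have "u ystar \<le> u y" using y mean_const[OF \<alpha> f] ystar by simp
  then show ?thesis
    using u_le_cancel[of ystar y] ystar y mean_const[OF \<alpha> f] by (simp add: GFB_def)
qed

section \<open>Lotteries over actions and a uniform gap\<close>

lemma block_one:
  fixes \<psi> :: "'x \<Rightarrow> real"
  assumes "\<psi> \<in> borel_measurable (sig X)"
  shows "(\<integral>y. \<psi> (y 0) \<partial>block 1 0 a) = (\<integral>x. \<psi> x \<partial>\<mu> a)"
proof -
  interpret P: product_prob_space "\<lambda>_. \<mu> a" "{0 * 1..<Suc 0 * 1}"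
    using prob by (auto intro!: product_prob_spaceI)
  have [measurable]: "\<psi> \<in> borel_measurable (\<mu> a)"
    using assms measurable_cong_sets[OF sets_mu refl] by blast
  have "(\<integral>y. \<psi> (y 0) \<partial>block 1 0 a) = (\<integral>x. \<psi> x \<partial>distr (block 1 0 a) (\<mu> a) (\<lambda>y. y 0))"
    by (intro integral_distr[symmetric]) auto
  also have "distr (block 1 0 a) (\<mu> a) (\<lambda>y. y 0) = \<mu> a"
    using P.PiM_component[of 0] by simp
  finally show ?thesis .
qed

text \<open>Take one signal per period. After \<open>astar\<close> in the first period, the second
  action is chosen according to whether the first signal falls into a set of probability
  \<open>p\<close>; all other periods use \<open>astar\<close>. The lottery thus carries weight
  \<open>1 / T\<close>, and it requires a second period.\<close>

lemma mixing:
  assumes T: "T > 1" and p: "0 < p" "p < 1" and a: "a \<noteq> astar" and y: "w \<le> y"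
    and cu: "c astar + 1 / real T * (p * c a + (1 - p) * c b - c astar) \<le> u y"
  shows "g astar + 1 / real T * (p * g a + (1 - p) * g b - g astar) - y < GFB"
proof -
  obtain Y where Y: "Y \<in> sets (sig X)" "measure (\<mu> astar) Y = p" using rich[OF p] by blast
  define \<alpha> :: "nat \<Rightarrow> (nat \<Rightarrow> 'x) \<Rightarrow> 'a" where
    "\<alpha> t h = (if t = 1 then if h 0 \<in> Y then a else b else astar)" for t h
  have "{h \<in> space (hspace X 1). h 0 \<in> Y} \<in> sets (hspace X 1)"
    unfolding hspace_def using Y(1) by measurable
  then have "(\<lambda>h. if h 0 \<in> Y then a else b) \<in> hspace X 1 \<rightarrow>\<^sub>M count_space UNIV"
    by (intro measurable_If) auto
  then have s: "is_strategy X 1 t \<alpha>" for t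
    unfolding is_strategy_def
  proof (intro allI impI)
    fix s show "\<alpha> s \<in> hspace X (s * 1) \<rightarrow>\<^sub>M count_space UNIV"
      using \<open>_ \<in> hspace X 1 \<rightarrow>\<^sub>M count_space UNIV\<close> by (cases "s = 1") (simp_all add: \<alpha>_def[abs_def])
  qed
  have mean: "mean 1 T \<alpha> \<phi> = \<phi> astar + 1 / real T * (p * \<phi> a + (1 - p) * \<phi> b - \<phi> astar)" for \<phi>
  proof -
    define J where "J t = (\<integral>h. \<phi> (\<alpha> t h) \<partial>path \<mu> X 1 \<alpha> t)" for t
    have 0: "J t = \<phi> astar" if "t \<noteq> 1" for t
      using that prob_space.prob_space[OF prob_path[OF s]] by (simp add: J_def \<alpha>_def)
    interpret M: prob_space "\<mu> astar" by (rule prob)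
    have Y': "Y \<in> sets (\<mu> astar)" using Y by (simp add: sets_mu)
    have "\<alpha> (Suc 0) \<in> hspace X (Suc 0 * 1) \<rightarrow>\<^sub>M count_space UNIV"
      using s[of "Suc (Suc 0)"] by (simp add: is_strategy_def)
    then have "(\<lambda>h. \<phi> (\<alpha> (Suc 0) h)) \<in> borel_measurable (hspace X (Suc 0 * 1))"
      by (rule measurable_compose) simp
    from integral_path_Suc[OF s this bounded_finite]
    have "J 1 = (\<integral>h. \<integral>y. \<phi> (\<alpha> 1 (join 1 0 h y)) \<partial>block 1 0 (\<alpha> 0 h) \<partial>path \<mu> X 1 \<alpha> 0)"
      unfolding J_def by simp
    also have "\<dots> = (\<integral>h. \<integral>y. (if y 0 \<in> Y then \<phi> a else \<phi> b) \<partial>block 1 0 astar \<partial>path \<mu> X 1 \<alpha> 0)"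
    proof -
      have "\<alpha> 0 = (\<lambda>_. astar)" by (simp add: \<alpha>_def[abs_def])
      moreover have "\<phi> (\<alpha> 1 (join 1 0 h y)) = (if y 0 \<in> Y then \<phi> a else \<phi> b)" for h y
        by (simp add: \<alpha>_def merge_def mult_Suc)
      ultimately show ?thesis by (simp only:)
    qed
    also have "\<dots> = (\<integral>h. \<integral>x. (if x \<in> Y then \<phi> a else \<phi> b) \<partial>\<mu> astar \<partial>path \<mu> X 1 \<alpha> 0)"
      using Y(1) by (subst block_one) (auto intro!: measurable_If_set simp: sets.Int_space_eq2)
    also have "\<dots> = (\<integral>x. (if x \<in> Y then \<phi> a else \<phi> b) \<partial>\<mu> astar)"
      using prob_space.prob_space[OF prob_path[OF s, of 0]] by simp
    also have "\<dots> = (\<integral>x. \<phi> b + (\<phi> a - \<phi> b) * indicator Y x \<partial>\<mu> astar)"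
      by (intro Bochner_Integration.integral_cong) (auto simp: indicator_def)
    also have "\<dots> = \<phi> b + (\<phi> a - \<phi> b) * p"
    proof -
      have "integrable (\<mu> astar) (indicator Y :: 'x \<Rightarrow> real)"
        using Y' by (intro integrable_real_indicator) (auto simp: M.emeasure_eq_measure)
      then show ?thesis
        using Y' Y(2) sets.sets_into_space[OF Y']
        by (subst Bochner_Integration.integral_add) (auto simp: M.prob_space Int_absorb2)
    qed
    also have "\<dots> = p * \<phi> a + (1 - p) * \<phi> b" by (simp add: algebra_simps)
    finally have 1: "J 1 = p * \<phi> a + (1 - p) * \<phi> b" .
    have "(\<Sum>t<T. J t) = J 1 + (\<Sum>t\<in>{..<T} - {1}. J t)"
      using T by (intro sum.remove) auto
    also have "(\<Sum>t\<in>{..<T} - {1}. J t) = (\<Sum>t\<in>{..<T} - {1}. \<phi> astar)"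
      by (intro sum.cong) (auto simp: 0)
    also have "\<dots> = (real T - 1) * \<phi> astar" using T by (simp add: of_nat_diff)
    finally have S: "(\<Sum>t<T. J t) = J 1 + (real T - 1) * \<phi> astar" .
    have "mean 1 T \<alpha> \<phi> = (\<Sum>t<T. J t) / real T" unfolding mean_def J_def ..
    then show ?thesis unfolding S 1 using T by (simp add: field_simps)
  qed
  have "freq 1 T \<alpha> astar < 1"
  proof -
    have "(1 - p) * (if b = astar then 1 else 0) \<le> 1 - p" using p by auto
    then have "1 / real T * ((1 - p) * (if b = astar then 1 else 0) - 1) < 0"
      using p T by (intro mult_pos_neg) auto
    then show ?thesis unfolding freq_def mean using a by simp
  qed
  then show ?thesis
    using strict_below_GFB[OF s[of T] _ _ y] cu unfolding mean by simp
qed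

definition last_prob :: "nat \<Rightarrow> (nat \<Rightarrow> (nat \<Rightarrow> 'x) \<Rightarrow> 'a) \<Rightarrow> real" where
  "last_prob k \<alpha> = (\<integral>h. (if \<alpha> (T - 1) h = astar then 1 else 0) \<partial>path \<mu> X k \<alpha> (T - 1))"

lemma freq_last: "is_strategy X k T \<alpha> \<Longrightarrow> freq k T \<alpha> astar \<le> 1 - (1 - last_prob k \<alpha>) / real T"
proof -
  assume \<alpha>: "is_strategy X k T \<alpha>"
  define J where "J t = (\<integral>h. (if \<alpha> t h = astar then 1 else 0::real) \<partial>path \<mu> X k \<alpha> t)" for t
  have J: "J t \<le> 1" if "t < T" for t
  proof -
    have \<alpha>t: "is_strategy X k t \<alpha>" using is_strategy_mono[OF \<alpha>] that by simp
    interpret P: prob_space "path \<mu> X k \<alpha> t" by (rule prob_path[OF \<alpha>t])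
    have "J t \<le> (\<integral>h. 1 \<partial>path \<mu> X k \<alpha> t)"
      unfolding J_def using integrable_strategy[OF \<alpha> that, of "\<lambda>a. if a = astar then 1 else 0"]
      by (intro integral_mono) auto
    then show ?thesis by (simp add: P.prob_space)
  qed
  have "(\<Sum>t<T. J t) = J (T - 1) + (\<Sum>t\<in>{..<T} - {T - 1}. J t)"
    using T_pos by (intro sum.remove) auto
  also have "\<dots> \<le> J (T - 1) + (\<Sum>t\<in>{..<T} - {T - 1}. 1)"
    using J by (intro add_mono sum_mono) auto
  also have "\<dots> = J (T - 1) + real T - 1" using T_pos by (simp add: of_nat_diff)
  finally show ?thesis using T_pos
    by (simp add: freq_def mean_def last_prob_def J_def[symmetric] field_simps)
qed

text \<open>The point is that \<open>L\<close> is chosen before \<open>k\<close>. With one period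
  the action is deterministic and a minimum over finitely many actions suffices; with several
  periods the compactness of the simplex is used.\<close>

lemma gap_if_last_prob_small:
  "\<exists>L>0. \<forall>k \<alpha> y. k > 0 \<longrightarrow> is_strategy X k T \<alpha> \<longrightarrow> last_prob k \<alpha> < 1 / 2 \<longrightarrow> w \<le> y \<longrightarrow>
     mean k T \<alpha> c \<le> u y \<longrightarrow> mean k T \<alpha> g - y \<le> GFB - L"
proof (cases "T = 1")
  case True
  \<comment> \<open>The value \<open>1\<close> at \<open>astar\<close> is a placeholder that keeps
    the minimum over all actions positive.\<close>
  define D where "D a = (if a = astar then 1 else GFB - (g a - hinv u w (c a)))" for a
  have D: "0 < D a" for a
    using strict_below_GFB[OF const_strategy[of 1 T a], of "hinv u w (c a)"] hinv_ge[OF c_range] u_hinv[OF c_range]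
    by (auto simp: D_def mean_const_strategy freq_const_strategy)
  have "mean k T \<alpha> g - y \<le> GFB - Min (range D)"
    if "k > 0" "is_strategy X k T \<alpha>" "last_prob k \<alpha> < 1 / 2" "w \<le> y" "mean k T \<alpha> c \<le> u y" for k \<alpha> y
  proof -
    \<comment> \<open>Before the first period the only history is the empty one, represented by
      \<open>\<lambda>_. undefined\<close>.\<close>
    define a where "a = \<alpha> 0 (\<lambda>_. undefined)"
    have s: "space (path \<mu> X k \<alpha> 0) = {\<lambda>_. undefined}" by (simp add: hspace_def space_PiM)
    interpret P: prob_space "path \<mu> X k \<alpha> 0"
      using prob_path[OF is_strategy_mono[OF that(2)]] by blast
    have J: "(\<integral>h. \<phi> (\<alpha> 0 h) \<partial>path \<mu> X k \<alpha> 0) = \<phi> a" for \<phi> :: "'a \<Rightarrow> real"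
    proof -
      have "(\<integral>h. \<phi> (\<alpha> 0 h) \<partial>path \<mu> X k \<alpha> 0) = (\<integral>h. \<phi> a \<partial>path \<mu> X k \<alpha> 0)"
        by (intro Bochner_Integration.integral_cong refl) (simp only: s singleton_iff a_def)
      then show ?thesis by (simp add: P.prob_space del: path.simps)
    qed
    have m: "mean k T \<alpha> \<phi> = \<phi> a" for \<phi> by (simp add: mean_def True J del: path.simps)
    have "last_prob k \<alpha> = (if a = astar then 1 else 0)"
      unfolding last_prob_def using J[of "\<lambda>a. if a = astar then 1 else 0"] True by simp
    then have "a \<noteq> astar" using that by auto
    moreover have "hinv u w (c a) \<le> y"
      using u_le_cancel[OF hinv_ge[OF c_range] that(4), of a] that(5) u_hinv[OF c_range] by (simp add: m)
    moreover have "Min (range D) \<le> D a" by simp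
    ultimately show ?thesis unfolding m by (simp add: D_def[of a])
  qed
  then show ?thesis using D by (intro exI[of _ "Min (range D)"]) auto
next
  case False
  then have T: "T > 1" using T_pos by simp
  note mt = mixing_tangent[OF _ _ mixing[OF T]]
  have t1: "u' ystar * (g a - g astar) \<le> c a - c astar" for a
    using mt(1) T by simp
  have t2: "tangent_to a \<Longrightarrow> tangent_to b \<Longrightarrow> c a < c astar \<Longrightarrow> c astar < c b \<Longrightarrow> False" for a b
    using mt(2)[of a b] T by simp
  have strict: "(\<Sum>a\<in>UNIV. p a * g a) - y < GFB"
    if "\<And>a. 0 \<le> p a" "(\<Sum>a\<in>UNIV. p a) = 1" "p astar < 1" "w \<le> y"
      "(\<Sum>a\<in>UNIV. p a * c a) \<le> u y" for p y
    by (rule gap_of_tangent[OF t1]) (use t2 that in auto)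
  \<comment> \<open>Missing \<open>astar\<close> in the last period with probability above
    \<open>1 / 2\<close> lowers its overall frequency by at least
    \<open>1 / (2 * T)\<close>.\<close>
  obtain L where L: "L > 0" "\<forall>p y. (\<forall>a. 0 \<le> p a) \<longrightarrow> (\<Sum>a\<in>UNIV. p a) = 1 \<longrightarrow>
      p astar \<le> 1 - 1 / (2 * real T) \<longrightarrow> w \<le> y \<longrightarrow>
      (\<Sum>a\<in>UNIV. p a * c a) \<le> u y \<longrightarrow> (\<Sum>a\<in>UNIV. p a * g a) - y \<le> GFB - L"
    using uniform_gap[of "1 / (2 * real T)", OF strict] T by auto
  have "mean k T \<alpha> g - y \<le> GFB - L"
    if "k > 0" "is_strategy X k T \<alpha>" "last_prob k \<alpha> < 1 / 2" "w \<le> y" "mean k T \<alpha> c \<le> u y" for k \<alpha> y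
  proof -
    have "1 / (2 * real T) \<le> (1 - last_prob k \<alpha>) / real T"
      using that(3) T by (simp add: field_simps)
    then have "freq k T \<alpha> astar \<le> 1 - 1 / (2 * real T)" using freq_last[OF that(2)] by linarith
    then show ?thesis
      using L(2) that freq_nonneg sum_freq[OF that(2) T_pos] by (simp add: mean_eq_freq[OF that(2)])
  qed
  then show ?thesis using L by blast
qed

end

section \<open>The lower bound on the loss\<close>

context agency
begin

text \<open>Only histories at which \<open>astar\<close> was due are changed, so each affected
  history saves exactly \<open>c astar - c a\<close>. No later action can react to the
  deviation.\<close>

definition deviate :: "(nat \<Rightarrow> (nat \<Rightarrow> 'x) \<Rightarrow> 'a) \<Rightarrow> 'a \<Rightarrow> nat \<Rightarrow> (nat \<Rightarrow> 'x) \<Rightarrow> 'a" where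
  "deviate \<alpha> a = \<alpha>(T - 1 := (\<lambda>h. if \<alpha> (T - 1) h = astar then a else \<alpha> (T - 1) h))"

lemma deviation_cost:
  fixes a :: 'a
  assumes \<alpha>: "is_strategy X k T \<alpha>"
  defines "\<alpha>' \<equiv> deviate \<alpha> a"
  shows "is_strategy X k T \<alpha>'"
    and "mean k T \<alpha> c - mean k T \<alpha>' c = (c astar - c a) * last_prob k \<alpha> / real T"
proof -
  have "\<alpha> (T - 1) \<in> hspace X ((T - 1) * k) \<rightarrow>\<^sub>M count_space UNIV"
    using \<alpha> T_pos by (simp add: is_strategy_def)
  then have m: "(\<lambda>h. if \<alpha> (T - 1) h = astar then a else \<alpha> (T - 1) h)
    \<in> hspace X ((T - 1) * k) \<rightarrow>\<^sub>M count_space UNIV"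
    by (rule measurable_compose[where g="\<lambda>b. if b = astar then a else b"]) simp
  then show \<alpha>': "is_strategy X k T \<alpha>'"
    using \<alpha> by (auto simp: is_strategy_def \<alpha>'_def deviate_def)
  have p: "path \<mu> X k \<alpha>' s = path \<mu> X k \<alpha> s" if "s < T" for s
    using that by (intro path_cong) (auto simp: \<alpha>'_def deviate_def)
  define J where "J s = (\<integral>h. c (\<alpha> s h) \<partial>path \<mu> X k \<alpha> s)" for s
  define J' where "J' s = (\<integral>h. c (\<alpha>' s h) \<partial>path \<mu> X k \<alpha>' s)" for s
  have "J s - J' s = (if s = T - 1 then (c astar - c a) * last_prob k \<alpha> else 0)" if s: "s < T" for s
  proof (cases "s = T - 1")
    case True
    have "J s - J' s = (\<integral>h. c (\<alpha> s h) - c (\<alpha>' s h) \<partial>path \<mu> X k \<alpha> s)"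
      unfolding J_def J'_def p[OF s]
      using integrable_strategy[OF \<alpha> s, of c] integrable_strategy[OF \<alpha>' s, of c] p[OF s]
      by (intro Bochner_Integration.integral_diff[symmetric]) auto
    also have "\<dots> = (\<integral>h. (c astar - c a) * (if \<alpha> (T - 1) h = astar then 1 else 0) \<partial>path \<mu> X k \<alpha> (T - 1))"
      unfolding True by (intro Bochner_Integration.integral_cong) (auto simp: \<alpha>'_def deviate_def)
    finally show ?thesis using True by (simp add: last_prob_def)
  next
    case False
    then have "\<alpha>' s = \<alpha> s" by (simp add: \<alpha>'_def deviate_def)
    then show ?thesis using False p[OF s] by (simp add: J_def J'_def)
  qed
  then have "(\<Sum>s<T. J s - J' s) = (\<Sum>s<T. if s = T - 1 then (c astar - c a) * last_prob k \<alpha> else 0)"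
    by (intro sum.cong) auto
  also have "\<dots> = (c astar - c a) * last_prob k \<alpha>" using T_pos by simp
  finally show "mean k T \<alpha> c - mean k T \<alpha>' c = (c astar - c a) * last_prob k \<alpha> / real T"
    by (simp add: mean_def J_def[symmetric] J'_def[symmetric] sum_subtractf diff_divide_distrib[symmetric])
qed

text \<open>The history before the last period has the same law under both strategies. Given that
  history, only one block of \<open>k\<close> signals changes law, so
  \<open>change_of_measure\<close> applies conditionally; the likelihood cost is that of
  \<open>n / T\<close> signals rather than \<open>n\<close>.\<close>

lemma deviation_likelihood:
  fixes a :: 'a
  assumes \<alpha>: "is_strategy X k T \<alpha>" and k: "k > 0" and B: "B \<in> sets (hspace X (T * k))"
    and s: "KL (\<mu> a) (\<mu> astar) < s" and a: "a \<noteq> astar"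
  defines "\<alpha>' \<equiv> deviate \<alpha> a"
  shows "measure (path \<mu> X k \<alpha>' T) B \<le> exp (s * k) * measure (path \<mu> X k \<alpha> T) B
    + likelihood_ratio.info_var (\<mu> a) (ratio a) / (real k * (s - KL (\<mu> a) (\<mu> astar))\<^sup>2)"
proof -
  interpret L: likelihood_ratio "\<mu> astar" "\<mu> a" "ratio a" by (rule likelihood)
  define t where "t = T - 1"
  have T: "T = Suc t" using T_pos by (simp add: t_def)
  let ?I = "{t * k..<Suc t * k}"
  have I: "finite ?I" "card ?I = k" by (auto simp: mult_Suc)
  define S where "S h = {y \<in> space (PiM ?I (\<lambda>_. sig X)). join k t h y \<in> B}" for h
  have B': "B \<in> sets (hspace X (Suc t * k))" using B T by simp
  have \<alpha>': "is_strategy X k T \<alpha>'" unfolding \<alpha>'_def by (rule deviation_cost[OF \<alpha>])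
  have \<alpha>t: "is_strategy X k t \<alpha>" using is_strategy_mono[OF \<alpha>] T by simp
  have p: "path \<mu> X k \<alpha>' t = path \<mu> X k \<alpha> t"
    by (intro path_cong) (auto simp: \<alpha>'_def deviate_def t_def)
  define \<delta> where "\<delta> = L.info_var / (real k * (s - KL (\<mu> a) (\<mu> astar))\<^sup>2)"
  have "0 \<le> L.info_var" unfolding L.info_var_def by simp
  then have \<delta>: "0 \<le> \<delta>" unfolding \<delta>_def by simp
  interpret P: prob_space "path \<mu> X k \<alpha> t" by (rule prob_path[OF \<alpha>t])
  have "measure (path \<mu> X k \<alpha>' T) B = (\<integral>h. measure (block k t (\<alpha>' t h)) (S h) \<partial>path \<mu> X k \<alpha> t)"
    using measure_path_Suc[OF \<alpha>'[unfolded T] B'] by (simp add: T p S_def)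
  also have "\<dots> \<le> (\<integral>h. exp (s * k) * measure (block k t (\<alpha> t h)) (S h) + \<delta> \<partial>path \<mu> X k \<alpha> t)"
  proof (rule integral_mono)
    show "integrable (path \<mu> X k \<alpha> t) (\<lambda>h. measure (block k t (\<alpha>' t h)) (S h))"
      using integrable_block_measure[OF \<alpha>'[unfolded T] B'] by (simp add: p S_def)
    show "integrable (path \<mu> X k \<alpha> t) (\<lambda>h. exp (s * k) * measure (block k t (\<alpha> t h)) (S h) + \<delta>)"
      using integrable_block_measure[OF \<alpha>[unfolded T] B'] by (simp add: S_def)
    fix h assume "h \<in> space (path \<mu> X k \<alpha> t)"
    then have h: "h \<in> space (hspace X (t * k))" by (simp add: space_path[OF \<alpha>t])
    have "S h = join k t h -` B \<inter> space (PiM ?I (\<lambda>_. sig X))" by (auto simp: S_def)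
    then have "S h \<in> sets (PiM ?I (\<lambda>_. sig X))"
      using measurable_sets[OF measurable_join2[OF h] B'] by simp
    then have Sh: "S h \<in> sets (PiM ?I (\<lambda>_. \<mu> astar))" by (simp add: sets_block)
    show "measure (block k t (\<alpha>' t h)) (S h) \<le> exp (s * k) * measure (block k t (\<alpha> t h)) (S h) + \<delta>"
    proof (cases "\<alpha> t h = astar")
      case True
      then have "measure (block k t (\<alpha>' t h)) (S h) = measure (block k t a) (S h)"
        by (simp add: \<alpha>'_def deviate_def t_def)
      also have "\<dots> \<le> exp (s * k) * measure (block k t astar) (S h)
        + measure (block k t a) {y \<in> space (block k t astar). exp (s * k) < (\<Prod>i\<in>?I. ratio a (y i))}"
        by (rule L.change_of_measure[OF I(1) Sh]) simp
      also have "\<dots> \<le> exp (s * k) * measure (block k t astar) (S h) + \<delta>"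
        using L.upper_tail[OF I k, of s] s by (simp add: \<delta>_def L.KL_eq_info)
      finally show ?thesis using True by simp
    next
      case False
      \<comment> \<open>Nothing changes after such a history, but the common factor
        \<open>exp (s * k)\<close> must still be at least \<open>1\<close>; positivity of the
        divergence ensures this.\<close>
      have "0 < L.info" using L.info_pos a distinct by (auto dest: injD)
      then have "1 \<le> exp (s * k)" using s by (simp add: L.KL_eq_info)
      then have "1 * measure (block k t (\<alpha> t h)) (S h) \<le> exp (s * k) * measure (block k t (\<alpha> t h)) (S h)"
        by (intro mult_right_mono) auto
      then show ?thesis using False \<delta> by (simp add: \<alpha>'_def deviate_def t_def)
    qed
  qed
  also have "\<dots> = exp (s * k) * (\<integral>h. measure (block k t (\<alpha> t h)) (S h) \<partial>path \<mu> X k \<alpha> t) + \<delta>"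
    using integrable_block_measure[OF \<alpha>[unfolded T] B'] by (simp add: S_def P.prob_space)
  also have "(\<integral>h. measure (block k t (\<alpha> t h)) (S h) \<partial>path \<mu> X k \<alpha> t) = measure (path \<mu> X k \<alpha> T) B"
    using measure_path_Suc[OF \<alpha>[unfolded T] B'] by (simp add: T S_def)
  finally show ?thesis by (simp add: \<delta>_def)
qed

lemma mean_ge_uw: "is_strategy X k T \<alpha> \<Longrightarrow> u w \<le> mean k T \<alpha> c"
proof -
  assume \<alpha>: "is_strategy X k T \<alpha>"
  have "u w = (\<Sum>a\<in>UNIV. freq k T \<alpha> a * u w)"
    using sum_freq[OF \<alpha> T_pos] by (simp add: sum_distrib_right[symmetric])
  also have "\<dots> \<le> (\<Sum>a\<in>UNIV. freq k T \<alpha> a * c a)"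
    using c_gt by (intro sum_mono mult_left_mono freq_nonneg less_imp_le)
  finally show ?thesis using mean_eq_freq[OF \<alpha>] by simp
qed

text \<open>Strong concavity of \<open>u\<close> turns wage dispersion into a loss of expected utility, for which the
  principal has to compensate the agent at a cost of at least \<open>1 / u' w\<close> per unit of utility.\<close>

lemma dispersion_loss:
  assumes feas: "fb_feasible \<mu> X T (k * T) u w c \<alpha> v" and k: "k > 0"
    and \<sigma>: "\<sigma> > 0" "\<And>x y. w \<le> x \<Longrightarrow> x \<le> y \<Longrightarrow> y \<le> Y \<Longrightarrow> u x + \<sigma> * (y - x)\<^sup>2 \<le> u y + u' y * (x - y)"
    and e: "e > 0"
  defines "y \<equiv> (\<integral>x. hinv u w (v x) \<partial>path \<mu> X k \<alpha> T)"
  assumes Y: "y \<le> Y"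
  shows "princ_pay \<mu> X T (k * T) u w g \<alpha> v
    \<le> GFB - \<sigma> * (e / u' w)\<^sup>2 / u' w * measure (path \<mu> X k \<alpha> T) {x \<in> space (path \<mu> X k \<alpha> T). v x \<le> u y - e}"
proof -
  have \<alpha>: "is_strategy X k T \<alpha>" and con: "is_contract X (k * T) u w v"
    and iv: "integrable (path \<mu> X k \<alpha> T) v"
    and ih: "integrable (path \<mu> X k \<alpha> T) (\<lambda>x. hinv u w (v x))"
    using feas by (auto simp: fb_feasible_def mult_div)
  let ?P = "path \<mu> X k \<alpha> T"
  interpret P: prob_space ?P by (rule prob_path[OF \<alpha>])
  have yw: "w \<le> y" unfolding y_def by (rule wage_ge[OF feas])
  have uw: "u' w > 0" using u'_pos by simp
  \<comment> \<open>Slopes of \<open>u\<close> are at most \<open>u' w\<close>, so a payment at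
    least \<open>e\<close> below \<open>u y\<close> means a wage at least \<open>e / u' w\<close>
    below \<open>y\<close>. Strong concavity charges \<open>\<sigma>\<close> times the square of
    that distance.\<close>
  define \<rho> where "\<rho> = \<sigma> * (e / u' w)\<^sup>2"
  let ?B = "{x \<in> space ?P. v x \<le> u y - e}"
  have B: "?B \<in> sets ?P" using borel_measurable_integrable[OF iv] by measurable
  have iB: "integrable ?P (indicator ?B :: _ \<Rightarrow> real)"
    using B by (intro integrable_real_indicator) (auto simp: P.emeasure_eq_measure)
  have "(\<integral>x. v x + \<rho> * indicator ?B x \<partial>?P) \<le> (\<integral>x. u y + u' y * (hinv u w (v x) - y) \<partial>?P)"
  proof (rule integral_mono)
    show "integrable ?P (\<lambda>x. v x + \<rho> * indicator ?B x)" using iv iB by auto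
    show "integrable ?P (\<lambda>x. u y + u' y * (hinv u w (v x) - y))" using ih by auto
    fix x assume x: "x \<in> space ?P"
    note r = contract_range[OF con \<alpha> x]
    define z where "z = hinv u w (v x)"
    have z: "w \<le> z" "u z = v x" unfolding z_def using hinv_ge[OF r] u_hinv[OF r] by auto
    show "v x + \<rho> * indicator ?B x \<le> u y + u' y * (hinv u w (v x) - y)"
    proof (cases "x \<in> ?B")
      case True
      then have vz: "u z \<le> u y - e" using z by simp
      then have zy: "z \<le> y" using u_le_cancel[OF z(1) yw] e by simp
      have "e \<le> u' w * (y - z)" using slope_upper[OF z(1) zy] vz by simp
      then have "e / u' w \<le> y - z" using uw by (simp add: field_simps)
      then have "(e / u' w)\<^sup>2 \<le> (y - z)\<^sup>2" using e uw by (intro power_mono) auto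
      then have "\<rho> \<le> \<sigma> * (y - z)\<^sup>2" unfolding \<rho>_def using \<sigma>(1) by (intro mult_left_mono) auto
      then show ?thesis using \<sigma>(2)[OF z(1) zy Y] True z by (simp add: z_def[symmetric])
    next
      case False
      then show ?thesis using tangent[OF z(1) yw] z by (simp add: z_def[symmetric])
    qed
  qed
  also have "\<dots> = u y" using ih by (simp add: P.prob_space y_def)
  also have "(\<integral>x. v x + \<rho> * indicator ?B x \<partial>?P) = (\<integral>x. v x \<partial>?P) + \<rho> * measure ?P ?B"
    using iv iB B sets.sets_into_space[OF B] by (simp add: Int_absorb2)
  finally have 1: "mean k T \<alpha> c + \<rho> * measure ?P ?B \<le> u y"
    using expected_utility_le(2)[OF feas] by simp
  have \<rho>: "0 \<le> \<rho> * measure ?P ?B" using \<sigma>(1) by (simp add: \<rho>_def)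
  then have r: "mean k T \<alpha> c \<in> u ` {w..}"
    using 1 by (intro range_downward[OF yw mean_ge_uw[OF \<alpha>]]) simp
  \<comment> \<open>The sure wage that just covers the expected cost. It would give the principal at
    most \<open>GFB\<close>, so \<open>y - y2\<close> is a lower bound for the loss.\<close>
  define y2 where "y2 = hinv u w (mean k T \<alpha> c)"
  have y2: "w \<le> y2" "u y2 = mean k T \<alpha> c" unfolding y2_def using hinv_ge[OF r] u_hinv[OF r] by auto
  have "y2 \<le> y" using u_le_cancel[OF y2(1) yw] y2 1 \<rho> by simp
  from slope_upper[OF y2(1) this] have "\<rho> * measure ?P ?B \<le> u' w * (y - y2)" using 1 y2 by simp
  then have "\<rho> / u' w * measure ?P ?B \<le> y - y2" using uw by (simp add: field_simps)
  moreover have "mean k T \<alpha> g - y2 \<le> GFB" using below_GFB[OF \<alpha> k y2(1)] y2 by simp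
  moreover have "princ_pay \<mu> X T (k * T) u w g \<alpha> v = mean k T \<alpha> g - y"
    unfolding y_def by (rule princ_pay_eq[OF \<alpha> ih])
  ultimately show ?thesis by (simp add: \<rho>_def)
qed

text \<open>If \<open>astar\<close> is rare in the last period, or if the mean wage exceeds
  \<open>Y\<close>, the loss is bounded below by a constant. Otherwise (IC) against
  \<open>deviate \<alpha> a\<close> forces low payments; the cap on the mean wage makes the
  concavity constant uniform over contracts.\<close>

lemma loss_lower:
  assumes a: "c a < c astar" and s: "KL (\<mu> a) (\<mu> astar) < s"
  shows "\<exists>C>0. \<forall>\<^sub>F k in sequentially. \<forall>\<alpha> v. sb_feasible \<mu> X T (k * T) u w c \<alpha> v \<longrightarrow>
    princ_pay \<mu> X T (k * T) u w g \<alpha> v \<le> GFB - C * exp (- s * real k)"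
proof -
  interpret L: likelihood_ratio "\<mu> astar" "\<mu> a" "ratio a" by (rule likelihood)
  have "\<mu> a \<noteq> \<mu> astar" using a distinct by (auto dest: injD)
  then have s0: "0 < s" using L.info_pos s by (simp add: L.KL_eq_info)
  obtain L where L: "L > 0" "\<And>k \<alpha> y. k > 0 \<Longrightarrow> is_strategy X k T \<alpha> \<Longrightarrow> last_prob k \<alpha> < 1 / 2 \<Longrightarrow> w \<le> y \<Longrightarrow>
     mean k T \<alpha> c \<le> u y \<Longrightarrow> mean k T \<alpha> g - y \<le> GFB - L"
    using gap_if_last_prob_small by blast
  \<comment> \<open>The cost saved by the deviation when \<open>astar\<close> has probability at
    least \<open>1 / 2\<close> in the last period.\<close>
  define \<kappa> where "\<kappa> = (c astar - c a) / (2 * real T)"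
  have \<kappa>: "\<kappa> > 0" using a T_pos by (simp add: \<kappa>_def)
  define Y where "Y = max w ((\<Sum>a\<in>UNIV. \<bar>g a\<bar>) - GFB + 1)"
  have Y: "w \<le> Y" by (simp add: Y_def)
  obtain \<sigma> where \<sigma>: "\<sigma> > 0" "\<And>x y. w \<le> x \<Longrightarrow> x \<le> y \<Longrightarrow> y \<le> Y \<Longrightarrow>
      u x + \<sigma> * (y - x)\<^sup>2 \<le> u y + u' y * (x - y)"
    using strong_tangent[OF Y] by blast
  \<comment> \<open>A payment falls short of \<open>u y\<close> by at most \<open>u Y - u w\<close>;
    the added \<open>1\<close> keeps \<open>\<Delta>\<close> positive even if
    \<open>Y = w\<close>.\<close>
  define \<Delta> where "\<Delta> = u Y - u w + 1"
  have \<Delta>: "\<Delta> > 0" using u_mono[OF order_refl Y] by (simp add: \<Delta>_def)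
  \<comment> \<open>Under the deviation the mean payment is at most \<open>u y - \<kappa>\<close>.
    Half of this shortfall must come from payments of at most \<open>u y - \<kappa> / 2\<close>,
    which therefore have probability at least \<open>\<beta>\<close>.\<close>
  define \<beta> where "\<beta> = \<kappa> / (2 * \<Delta>)"
  have \<beta>: "\<beta> > 0" using \<kappa> \<Delta> by (simp add: \<beta>_def)
  have uw: "u' w > 0" using u'_pos by simp
  define \<rho> where "\<rho> = \<sigma> * (\<kappa> / 2 / u' w)\<^sup>2 / u' w"
  have \<rho>: "\<rho> > 0" using \<sigma> uw \<kappa> by (simp add: \<rho>_def)
  \<comment> \<open>The smallest of the losses in the three regimes; half of \<open>\<beta>\<close>
    is given up to the tail term \<open>\<delta> k\<close>.\<close>
  define C where "C = min (min L 1) (\<rho> * (\<beta> / 2))"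
  have C: "C > 0" using L \<rho> \<beta> by (simp add: C_def)
  define \<delta> where "\<delta> k = L.info_var / (real k * (s - KL (\<mu> a) (\<mu> astar))\<^sup>2)" for k
  have "\<delta> \<longlonglongrightarrow> 0"
  proof -
    have "(\<lambda>k. L.info_var / (s - KL (\<mu> a) (\<mu> astar))\<^sup>2 * (1 / real k)) \<longlonglongrightarrow>
        L.info_var / (s - KL (\<mu> a) (\<mu> astar))\<^sup>2 * 0"
      by (intro tendsto_mult tendsto_const lim_1_over_n)
    then show ?thesis by (simp add: \<delta>_def[abs_def] mult.commute)
  qed
  then have "\<forall>\<^sub>F k in sequentially. \<delta> k < \<beta> / 2" using \<beta> by (intro order_tendstoD) auto
  then have "\<forall>\<^sub>F k in sequentially. \<forall>\<alpha> v. sb_feasible \<mu> X T (k * T) u w c \<alpha> v \<longrightarrow>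
    princ_pay \<mu> X T (k * T) u w g \<alpha> v \<le> GFB - C * exp (- s * real k)"
    using eventually_gt_at_top[of 0]
  proof (eventually_elim, intro allI impI)
    fix k \<alpha> v
    assume \<delta>k: "\<delta> k < \<beta> / 2" and k: "0 < k" and sb: "sb_feasible \<mu> X T (k * T) u w c \<alpha> v"
    have fb: "fb_feasible \<mu> X T (k * T) u w c \<alpha> v" using sb by (simp add: sb_feasible_def)
    have \<alpha>: "is_strategy X k T \<alpha>" and con: "is_contract X (k * T) u w v"
      and iv: "integrable (path \<mu> X k \<alpha> T) v"
      and ih: "integrable (path \<mu> X k \<alpha> T) (\<lambda>x. hinv u w (v x))"
      using fb by (auto simp: fb_feasible_def mult_div)
    define y where "y = (\<integral>x. hinv u w (v x) \<partial>path \<mu> X k \<alpha> T)"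
    have yw: "w \<le> y" unfolding y_def by (rule wage_ge[OF fb])
    have uy: "(\<integral>x. v x \<partial>path \<mu> X k \<alpha> T) \<le> u y" "mean k T \<alpha> c \<le> u y"
      using expected_utility_le[OF fb] by (auto simp: y_def)
    have pay: "princ_pay \<mu> X T (k * T) u w g \<alpha> v = mean k T \<alpha> g - y"
      unfolding y_def by (rule princ_pay_eq[OF \<alpha> ih])
    have e1: "C * exp (- s * real k) \<le> C" using C s0 by simp
    show "princ_pay \<mu> X T (k * T) u w g \<alpha> v \<le> GFB - C * exp (- s * real k)"
    proof (cases "last_prob k \<alpha> < 1 / 2 \<or> Y < y")
      case True
      then show ?thesis
      proof
        assume "last_prob k \<alpha> < 1 / 2"
        from L(2)[OF k \<alpha> this yw uy(2)] e1 show ?thesis by (simp add: pay C_def)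
      next
        assume "Y < y"
        then show ?thesis using mean_le[OF \<alpha>, of g] e1 by (simp add: pay C_def Y_def)
      qed
    next
      case False
      then have lp: "1 / 2 \<le> last_prob k \<alpha>" and yY: "y \<le> Y" by auto
      define \<alpha>' where "\<alpha>' = deviate \<alpha> a"
      have \<alpha>': "is_strategy X k T \<alpha>'" unfolding \<alpha>'_def by (rule deviation_cost[OF \<alpha>])
      interpret P': prob_space "path \<mu> X k \<alpha>' T" by (rule prob_path[OF \<alpha>'])
      have iv': "integrable (path \<mu> X k \<alpha>' T) v"
        and ic: "agent_util \<mu> X T (k * T) c \<alpha>' v \<le> agent_util \<mu> X T (k * T) c \<alpha> v"
        using sb \<alpha>' by (auto simp: sb_feasible_def mult_div)
      have "\<kappa> \<le> mean k T \<alpha> c - mean k T \<alpha>' c"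
      proof -
        have "\<kappa> = (c astar - c a) * (1 / 2) / real T" by (simp add: \<kappa>_def)
        also have "\<dots> \<le> (c astar - c a) * last_prob k \<alpha> / real T"
          using a lp by (intro divide_right_mono mult_left_mono) auto
        also have "\<dots> = mean k T \<alpha> c - mean k T \<alpha>' c"
          unfolding \<alpha>'_def by (rule deviation_cost(2)[OF \<alpha>, symmetric])
        finally show ?thesis .
      qed
      then have v': "(\<integral>x. v x \<partial>path \<mu> X k \<alpha>' T) \<le> u y - \<kappa>"
        using ic uy(1) by (simp add: agent_util_eq[OF \<alpha> iv] agent_util_eq[OF \<alpha>' iv'])
      define B where "B = {x \<in> space (hspace X (T * k)). v x \<le> u y - \<kappa> / 2}"
      have "v \<in> borel_measurable (hspace X (T * k))"
        using con by (simp add: is_contract_def hspace_commute)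
      then have B: "B \<in> sets (hspace X (T * k))" unfolding B_def by measurable
      then have B': "B \<in> sets (path \<mu> X k \<alpha>' T)" by (simp add: sets_path[OF \<alpha>'])
      have iB: "integrable (path \<mu> X k \<alpha>' T) (indicator B :: _ \<Rightarrow> real)"
        using B' by (intro integrable_real_indicator) (auto simp: P'.emeasure_eq_measure)
      have "(\<integral>x. (u y - \<kappa> / 2) - \<Delta> * indicator B x \<partial>path \<mu> X k \<alpha>' T) \<le> (\<integral>x. v x \<partial>path \<mu> X k \<alpha>' T)"
      proof (rule integral_mono[OF _ iv'])
        show "integrable (path \<mu> X k \<alpha>' T) (\<lambda>x. (u y - \<kappa> / 2) - \<Delta> * indicator B x)"
          using iB by auto
        fix x assume x: "x \<in> space (path \<mu> X k \<alpha>' T)"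
        then obtain z where "v x = u z" "w \<le> z" using contract_range[OF con \<alpha>' x] by auto
        then have "u w \<le> v x" using u_mono[of w z] by simp
        moreover have "u y \<le> u Y" by (rule u_mono[OF yw yY])
        ultimately show "(u y - \<kappa> / 2) - \<Delta> * indicator B x \<le> v x"
          using x \<kappa> by (auto simp: B_def indicator_def \<Delta>_def space_path[OF \<alpha>'])
      qed
      also have "(\<integral>x. (u y - \<kappa> / 2) - \<Delta> * indicator B x \<partial>path \<mu> X k \<alpha>' T)
          = u y - \<kappa> / 2 - \<Delta> * measure (path \<mu> X k \<alpha>' T) B"
        using iB B' sets.sets_into_space[OF B'] by (simp add: P'.prob_space Int_absorb2)
      finally have "\<kappa> / 2 \<le> \<Delta> * measure (path \<mu> X k \<alpha>' T) B" using v' by simp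
      then have "\<beta> \<le> measure (path \<mu> X k \<alpha>' T) B" using \<Delta> by (simp add: \<beta>_def field_simps)
      also have "\<dots> \<le> exp (s * k) * measure (path \<mu> X k \<alpha> T) B + \<delta> k"
        unfolding \<alpha>'_def \<delta>_def by (rule deviation_likelihood[OF \<alpha> k B s]) (use a in auto)
      finally have "\<beta> / 2 \<le> exp (s * k) * measure (path \<mu> X k \<alpha> T) B" using \<delta>k by simp
      then have "exp (- s * k) * (\<beta> / 2) \<le> exp (- s * k) * (exp (s * k) * measure (path \<mu> X k \<alpha> T) B)"
        by (intro mult_left_mono) auto
      then have PB: "exp (- s * k) * (\<beta> / 2) \<le> measure (path \<mu> X k \<alpha> T) B"
        by (simp add: mult.assoc[symmetric] exp_add[symmetric])
      have "princ_pay \<mu> X T (k * T) u w g \<alpha> v \<le> GFB - \<rho> * measure (path \<mu> X k \<alpha> T) B"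
        unfolding \<rho>_def B_def y_def space_path[OF \<alpha>, symmetric]
        by (rule dispersion_loss[where Y=Y, OF fb k \<sigma>]) (use \<kappa> yY in \<open>auto simp: y_def\<close>)
      moreover have "C * exp (- s * k) \<le> \<rho> * measure (path \<mu> X k \<alpha> T) B"
      proof -
        have "C * exp (- s * k) \<le> \<rho> * (\<beta> / 2) * exp (- s * k)"
          by (intro mult_right_mono) (auto simp: C_def)
        also have "\<dots> = \<rho> * (exp (- s * k) * (\<beta> / 2))" by simp
        also have "\<dots> \<le> \<rho> * measure (path \<mu> X k \<alpha> T) B" using PB \<rho> by (intro mult_left_mono) auto
        finally show ?thesis .
      qed
      ultimately show ?thesis by simp
    qed
  qed
  then show ?thesis using C by blast
qed

end

section \<open>The binary contract\<close>

context agency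
begin

text \<open>Only cheaper actions are tested for: costlier ones are deterred by their own
  cost.\<close>

definition rejects :: "real \<Rightarrow> nat \<Rightarrow> nat \<Rightarrow> (nat \<Rightarrow> 'x) \<Rightarrow> bool" where
  "rejects s k t y \<longleftrightarrow> (\<exists>a. c a < c astar \<and> exp (s * k) < (\<Prod>i\<in>{t * k..<Suc t * k}. ratio a (y i)))"

definition rejected :: "real \<Rightarrow> nat \<Rightarrow> nat \<Rightarrow> (nat \<Rightarrow> 'x) \<Rightarrow> bool" where
  "rejected s k t x \<longleftrightarrow> (\<exists>r<t. rejects s k r x)"

definition reject_prob :: "real \<Rightarrow> nat \<Rightarrow> nat \<Rightarrow> 'a \<Rightarrow> real" where
  "reject_prob s k t a =
     measure (block k t a) {y \<in> space (PiM {t * k..<Suc t * k} (\<lambda>_. sig X)). rejects s k t y}"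

lemma ratio_measurable: "ratio a \<in> borel_measurable (sig X)"
proof -
  interpret L: likelihood_ratio "\<mu> astar" "\<mu> a" "ratio a" by (rule likelihood)
  show ?thesis using L.f_meas measurable_cong_sets[OF sets_mu refl] by blast
qed

lemma rejects_measurable:
  assumes "{t * k..<Suc t * k} \<subseteq> I"
  shows "Measurable.pred (PiM I (\<lambda>_. sig X)) (rejects s k t)"
proof -
  have "(\<lambda>y. ratio a (y i)) \<in> borel_measurable (PiM I (\<lambda>_. sig X))" if "i \<in> {t * k..<Suc t * k}" for a i
    using assms that by (intro measurable_compose[OF _ ratio_measurable] measurable_component_singleton) auto
  then have [measurable]: "(\<lambda>y. \<Prod>i\<in>{t * k..<Suc t * k}. ratio a (y i)) \<in> borel_measurable (PiM I (\<lambda>_. sig X))" for a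
    by (rule borel_measurable_prod)
  show ?thesis unfolding rejects_def[abs_def] by measurable
qed

lemma block_index_less: "r < t \<Longrightarrow> i < Suc r * k \<Longrightarrow> i < t * (k :: nat)"
  by (erule order.strict_trans2[OF _ mult_le_mono1]) simp

lemma rejected_measurable: "t * k \<le> n \<Longrightarrow> Measurable.pred (hspace X n) (rejected s k t)"
proof -
  assume n: "t * k \<le> n"
  have "Measurable.pred (hspace X n) (rejects s k r)" if "r < t" for r
    unfolding hspace_def
  proof (rule rejects_measurable, rule subsetI)
    fix i assume "i \<in> {r * k..<Suc r * k}"
    then have "i < t * k" using block_index_less[OF that, of i k] by simp
    then show "i \<in> {..<n}" using n by simp
  qed
  then have "Measurable.pred (hspace X n) (\<lambda>x. \<exists>r\<in>{..<t}. rejects s k r x)"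
    by (intro pred_intros_finite) auto
  also have "(\<lambda>x. \<exists>r\<in>{..<t}. rejects s k r x) = rejected s k t"
    by (auto simp: rejected_def fun_eq_iff)
  finally show ?thesis .
qed

lemma rejects_cong: "(\<And>i. i \<in> {t * k..<Suc t * k} \<Longrightarrow> x i = y i) \<Longrightarrow> rejects s k t x = rejects s k t y"
  by (simp add: rejects_def)

lemma rejects_join: "rejects s k t (join k t h y) = rejects s k t y"
  by (rule rejects_cong) (auto simp: merge_def)

lemma rejected_cong: "(\<And>i. i < t * k \<Longrightarrow> x i = y i) \<Longrightarrow> rejected s k t x = rejected s k t y"
proof -
  assume eq: "\<And>i. i < t * k \<Longrightarrow> x i = y i"
  have "rejects s k r x = rejects s k r y" if "r < t" for r
  proof (rule rejects_cong)
    fix i assume "i \<in> {r * k..<Suc r * k}"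
    then show "x i = y i" using block_index_less[OF that, of i] by (intro eq) simp
  qed
  then show ?thesis by (auto simp: rejected_def)
qed

lemma rejected_join: "rejected s k t (join k t h y) = rejected s k t h"
  by (rule rejected_cong) (simp add: merge_def)

lemma rejected_restrict: "rejected s k t (restrict x {..<t * k}) = rejected s k t x"
  by (rule rejected_cong) simp

lemma rejected_Suc_join: "rejected s k (Suc t) (join k t h y) \<longleftrightarrow> rejected s k t h \<or> rejects s k t y"
  using rejected_join[of s k t h y] rejects_join[of s k t h y] by (auto simp: rejected_def less_Suc_eq)

lemma integral_rejected:
  "(\<integral>y. (if rejected s k (Suc t) (join k t h y) then A else B) \<partial>block k t a)
    = (if rejected s k t h then A else reject_prob s k t a * A + (1 - reject_prob s k t a) * B)"
proof -
  interpret P: prob_space "block k t a" by (rule prob_block)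
  let ?S = "{y \<in> space (PiM {t * k..<Suc t * k} (\<lambda>_. sig X)). rejects s k t y}"
  have S: "?S \<in> sets (block k t a)"
    unfolding sets_block using rejects_measurable[of t k "{t * k..<Suc t * k}" s] by simp
  have iS: "integrable (block k t a) (indicator ?S :: _ \<Rightarrow> real)"
    using S by (intro integrable_real_indicator) (auto simp: P.emeasure_eq_measure)
  show ?thesis
  proof (cases "rejected s k t h")
    case True
    then show ?thesis by (simp add: rejected_Suc_join P.prob_space)
  next
    case False
    then have "(\<integral>y. (if rejected s k (Suc t) (join k t h y) then A else B) \<partial>block k t a)
      = (\<integral>y. B + (A - B) * indicator ?S y \<partial>block k t a)"
      by (intro Bochner_Integration.integral_cong) (auto simp: rejected_Suc_join indicator_def space_block)
    also have "\<dots> = B + (A - B) * reject_prob s k t a"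
      using iS S sets.sets_into_space[OF S]
      by (subst Bochner_Integration.integral_add) (auto simp: P.prob_space Int_absorb2 reject_prob_def)
    finally show ?thesis using False by (simp add: algebra_simps)
  qed
qed

text \<open>A union bound over the individual tests, each with the false-alarm bound; counting all
  actions gives the factor \<open>CARD('a)\<close>.\<close>

lemma reject_prob_astar: "reject_prob s k t astar \<le> real CARD('a) * exp (- s * k)"
proof -
  interpret P: prob_space "block k t astar" by (rule prob_block)
  let ?I = "{t * k..<Suc t * k}"
  have I: "finite ?I" "card ?I = k" by (auto simp: mult_Suc)
  let ?S = "\<lambda>a. {y \<in> space (block k t astar). exp (s * k) < (\<Prod>i\<in>?I. ratio a (y i))}"
  have S: "?S a \<in> sets (block k t astar)" for a
  proof -
    interpret L: likelihood_ratio "\<mu> astar" "\<mu> a" "ratio a" by (rule likelihood)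
    note [measurable] = L.prod_meas[OF I(1)]
    show ?thesis by measurable
  qed
  have "reject_prob s k t astar \<le> measure (block k t astar) (\<Union>a\<in>UNIV. ?S a)"
    unfolding reject_prob_def using S
    by (intro P.finite_measure_mono) (auto simp: rejects_def space_block)
  also have "\<dots> \<le> (\<Sum>a\<in>UNIV. measure (block k t astar) (?S a))"
    using S by (intro P.finite_measure_subadditive_finite) auto
  also have "\<dots> \<le> (\<Sum>a\<in>(UNIV::'a set). exp (- s * k))"
  proof (rule sum_mono)
    fix a
    interpret L: likelihood_ratio "\<mu> astar" "\<mu> a" "ratio a" by (rule likelihood)
    show "measure (block k t astar) (?S a) \<le> exp (- s * k)" by (rule L.false_alarm[OF I])
  qed
  finally show ?thesis by simp
qed

text \<open>Whenever the block is not rejected, the ratio for the action actually played is at most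
  \<open>exp (s * k)\<close>, an atypically small value under its own law.\<close>

lemma reject_prob_shirk:
  assumes a: "c a < c astar" and k: "k > 0" and s: "s < KL (\<mu> a) (\<mu> astar)"
  shows "1 - likelihood_ratio.info_var (\<mu> a) (ratio a) / (real k * (KL (\<mu> a) (\<mu> astar) - s)\<^sup>2)
    \<le> reject_prob s k t a"
proof -
  interpret P: prob_space "block k t a" by (rule prob_block)
  interpret L: likelihood_ratio "\<mu> astar" "\<mu> a" "ratio a" by (rule likelihood)
  let ?I = "{t * k..<Suc t * k}"
  have I: "finite ?I" "card ?I = k" by (auto simp: mult_Suc)
  let ?S = "{y \<in> space (block k t a). rejects s k t y}"
  have S: "?S \<in> sets (block k t a)"
    using rejects_measurable[of t k "{t * k..<Suc t * k}" s] by (simp add: sets_block space_block)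
  let ?B = "{y \<in> space (block k t astar). (\<Prod>i\<in>?I. ratio a (y i)) \<le> exp (s * k)}"
  note [measurable] = L.prod_meas[OF I(1)]
  have "?B \<in> sets (block k t astar)" by measurable
  then have B: "?B \<in> sets (block k t a)" by (simp add: sets_block)
  have "1 = measure (block k t a) (space (block k t a))" by (rule P.prob_space[symmetric])
  also have "\<dots> \<le> measure (block k t a) (?S \<union> ?B)"
  proof (rule P.finite_measure_mono)
    show "space (block k t a) \<subseteq> ?S \<union> ?B"
    proof
      fix y assume y: "y \<in> space (block k t a)"
      then have "y \<in> space (block k t astar)" by (simp add: space_block)
      moreover have "rejects s k t y" if "exp (s * k) < (\<Prod>i\<in>?I. ratio a (y i))"
        using that a unfolding rejects_def by blast
      ultimately show "y \<in> ?S \<union> ?B" using y by (auto simp: not_less[symmetric])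
    qed
  qed (use S B in blast)
  also have "\<dots> \<le> measure (block k t a) ?S + measure (block k t a) ?B"
    by (rule measure_Un_le[OF S B])
  also have "measure (block k t a) ?B \<le> L.info_var / (real k * (L.info - s)\<^sup>2)"
    by (rule L.lower_tail[OF I k]) (use s in \<open>simp add: L.KL_eq_info\<close>)
  finally show ?thesis by (simp add: reject_prob_def space_block L.KL_eq_info)
qed

lemma reject_prob_bounds: "0 \<le> reject_prob s k t a" "reject_prob s k t a \<le> 1"
  using prob_space.prob_le_1[OF prob_block] by (auto simp: reject_prob_def)

end

text \<open>The wage drops to its minimum as soon as one period looks like shirking.  From then on the
  agent plays a cheapest action \<open>amin\<close>; before that, \<open>astar\<close> is optimal in every period.\<close>

locale binary_contract = agency \<mu> X u u' u'' w c g astar T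
  for \<mu> :: "'a::finite \<Rightarrow> 'x::euclidean_space measure" and X :: "'x set"
    and u u' u'' :: "real \<Rightarrow> real" and w :: real and c g :: "'a \<Rightarrow> real" and astar :: 'a and T :: nat +
  fixes k :: nat and s vH q \<delta> M :: real and amin :: 'a
  assumes amin: "\<And>a. c amin \<le> c a"
    and vH: "vH \<in> u ` {w..}" "c astar + real T * q * (vH - u w) \<le> vH"
    and q: "0 \<le> q" "\<And>t. t < T \<Longrightarrow> reject_prob s k t astar \<le> q" "real T * q < 1"
    and \<delta>: "\<And>a t. t < T \<Longrightarrow> c a < c astar \<Longrightarrow> 1 - \<delta> \<le> reject_prob s k t a"
    and costly: "\<And>a. c astar < c a \<Longrightarrow> real T * q * (vH - u w) \<le> c a - c astar"
    and M: "0 < M" "M \<le> (vH - u w) - (real T - 1) * ((c astar - c amin) / real T) - real T * q * (vH - u w)"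
    and shirk: "\<delta> + q < 1" "(c astar - c amin) / real T \<le> (1 - \<delta> - q) * M"
begin

text \<open>\<open>D\<close> is the stake after the last period, and \<open>d\<close> the largest
  cost saving in one period. In every remaining period the continuation gap shrinks by
  \<open>d\<close>, the extra cost of staying on the intended path.\<close>

definition "D = vH - u w"
definition "d = (c astar - c amin) / real T"

definition rej :: "nat \<Rightarrow> real" where "rej j = u w - real j * c amin / real T"

text \<open>\<open>rej j\<close> and \<open>unrej j\<close> are the agent's continuation values with \<open>j\<close> periods left.\<close>

primrec unrej :: "nat \<Rightarrow> real" where
  "unrej 0 = vH"
| "unrej (Suc j) = reject_prob s k (T - Suc j) astar * rej j
     + (1 - reject_prob s k (T - Suc j) astar) * unrej j - c astar / real T"

definition contract :: "(nat \<Rightarrow> 'x) \<Rightarrow> real" where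
  "contract x = (if rejected s k T x then u w else vH)"

definition strategy :: "nat \<Rightarrow> (nat \<Rightarrow> 'x) \<Rightarrow> 'a" where
  "strategy t h = (if rejected s k t h then amin else astar)"

lemma d_nonneg: "0 \<le> d"
  using amin[of astar] T_pos by (simp add: d_def)

lemma D_pos: "0 < D"
proof -
  have "0 \<le> real T * q * D"
  proof (rule ccontr)
    assume neg: "\<not> ?thesis"
    have "u w \<le> vH" using vH(1) u_mono[of w] by auto
    then have "0 \<le> real T * q * D" using q(1) by (simp add: D_def)
    with neg show False by simp
  qed
  moreover have "0 \<le> (real T - 1) * d" using d_nonneg T_pos by simp
  ultimately show ?thesis using M by (simp add: D_def[symmetric] d_def[symmetric])
qed

section \<open>Continuation gaps and one-shot deviations\<close>

lemma gap_Suc: "unrej (Suc j) - rej (Suc j)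
    = (unrej j - rej j) - d - reject_prob s k (T - Suc j) astar * (unrej j - rej j)"
  by (simp add: rej_def d_def algebra_simps add_divide_distrib diff_divide_distrib)

lemma M_le: "j < T \<Longrightarrow> M \<le> D - real j * d - real j * q * D"
proof -
  assume "j < T"
  then have "real j \<le> real T - 1" by linarith
  then have "real j * d \<le> (real T - 1) * d" "real j * (q * D) \<le> real T * (q * D)"
    using d_nonneg D_pos q(1) by (auto intro!: mult_right_mono)
  then show ?thesis using M by (simp add: D_def[symmetric] d_def[symmetric] mult.assoc)
qed

text \<open>Each remaining period costs an unrejected agent an extra \<open>d\<close> and a
  false-alarm risk worth at most \<open>q * D\<close>. The bound by \<open>M\<close> is needed up to
  \<open>T - 1\<close> remaining periods, the stake seen when the first action is chosen; its
  positivity also drives the induction by fixing the sign of the false-alarm term.\<close>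

lemma gap_bounds:
  "j \<le> T \<Longrightarrow> D - real j * d - real j * q * D \<le> unrej j - rej j \<and> unrej j - rej j \<le> D
     \<and> (j < T \<longrightarrow> M \<le> unrej j - rej j)"
proof (induction j)
  case 0
  then show ?case using M_le[of 0] T_pos by (simp add: D_def rej_def)
next
  case (Suc j)
  define E where "E = unrej j - rej j"
  have E: "D - real j * d - real j * q * D \<le> E" "E \<le> D" "M \<le> E"
    using Suc by (auto simp: E_def)
  let ?r = "reject_prob s k (T - Suc j) astar"
  have r: "0 \<le> ?r * E" "?r * E \<le> q * D"
    using E M(1) q(2)[of "T - Suc j"] reject_prob_bounds T_pos q(1) by (auto intro!: mult_mono mult_nonneg_nonneg)
  have "D - real (Suc j) * d - real (Suc j) * q * D \<le> E - d - ?r * E"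
    using E(1) r(2) by (simp add: algebra_simps)
  moreover have "E - d - ?r * E \<le> D" using E r d_nonneg by simp
  ultimately show ?case
    using M_le[of "Suc j"] by (auto simp: gap_Suc E_def[symmetric] simp del: unrej.simps)
qed

text \<open>A one-shot deviation check. A cheaper action saves at most \<open>d\<close>, but its
  extra rejection risk times a gap of at least \<open>M\<close> outweighs this. A costlier action
  could at best avoid the false-alarm loss \<open>q * D\<close>, which is below its extra
  cost.\<close>

lemma best_action:
  assumes "t < T"
  shows "reject_prob s k t a * rej (T - Suc t) + (1 - reject_prob s k t a) * unrej (T - Suc t) - c a / real T
    \<le> unrej (T - t)"
proof -
  define j where "j = T - Suc t"
  have j: "T - t = Suc j" "T - Suc j = t" "j < T" using assms by (auto simp: j_def)
  define E where "E = unrej j - rej j"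
  have E: "E \<le> D" "M \<le> E" using gap_bounds[of j] j by (auto simp: E_def)
  let ?r = "reject_prob s k t astar" and ?ra = "reject_prob s k t a"
  have r: "0 \<le> ?r" "?r \<le> q" "0 \<le> ?ra" using reject_prob_bounds q(2)[OF assms] by auto
  have "(c astar - c a) / real T \<le> (?ra - ?r) * E"
  proof (cases "c a" "c astar" rule: linorder_cases)
    case less
    have "(c astar - c a) / real T \<le> d"
      unfolding d_def using amin[of a] by (intro divide_right_mono) auto
    also have "\<dots> \<le> (1 - \<delta> - q) * M" using shirk(2) by (simp add: d_def)
    also have "\<dots> \<le> (?ra - ?r) * E"
      using shirk(1) \<delta>[OF assms less] r E M(1) by (intro mult_mono) auto
    finally show ?thesis .
  next
    case equal
    then have "a = astar" using c_distinct by blast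
    then show ?thesis by simp
  next
    case greater
    have "(?r - ?ra) * E \<le> q * E" using r E M(1) by (intro mult_right_mono) auto
    also have "\<dots> \<le> q * D" using E q(1) by (intro mult_left_mono) auto
    also have "\<dots> \<le> (c a - c astar) / real T"
      using costly[OF greater] T_pos by (simp add: D_def field_simps)
    finally show ?thesis by (simp add: algebra_simps diff_divide_distrib)
  qed
  then show ?thesis
    by (simp add: j j_def[symmetric] E_def algebra_simps diff_divide_distrib)
qed

text \<open>Continuation value net of costs already incurred. It interpolates between the constant
  \<open>unrej T\<close> before the first period and the agent's realised payoff at the end.\<close>

definition \<Phi> :: "(nat \<Rightarrow> (nat \<Rightarrow> 'x) \<Rightarrow> 'a) \<Rightarrow> nat \<Rightarrow> (nat \<Rightarrow> 'x) \<Rightarrow> real" where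
  "\<Phi> \<alpha> t x = (if rejected s k t x then rej (T - t) else unrej (T - t))
     - (\<Sum>r<t. c (act \<alpha> k r x)) / real T"

lemma \<Phi>_measurable: "is_strategy X k T \<alpha> \<Longrightarrow> t \<le> T \<Longrightarrow> \<Phi> \<alpha> t \<in> borel_measurable (hspace X (t * k))"
proof -
  assume \<alpha>: "is_strategy X k T \<alpha>" and t: "t \<le> T"
  have [measurable]: "Measurable.pred (hspace X (t * k)) (rejected s k t)"
    by (rule rejected_measurable) simp
  have [measurable]: "(\<lambda>x. (\<Sum>r<t. c (act \<alpha> k r x))) \<in> borel_measurable (hspace X (t * k))"
    using t by (intro borel_measurable_sum measurable_payoff[OF \<alpha>]) auto
  show ?thesis unfolding \<Phi>_def[abs_def] by measurable
qed

lemma \<Phi>_bounded: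
  "\<bar>\<Phi> \<alpha> t x\<bar> \<le> \<bar>rej (T - t)\<bar> + \<bar>unrej (T - t)\<bar> + real t * (\<Sum>b\<in>UNIV. \<bar>c b\<bar>) / real T"
proof -
  have "\<bar>\<Sum>r<t. c (act \<alpha> k r x)\<bar> \<le> (\<Sum>r<t. \<bar>c (act \<alpha> k r x)\<bar>)" by (rule sum_abs)
  also have "\<dots> \<le> (\<Sum>r<t. \<Sum>b\<in>UNIV. \<bar>c b\<bar>)" by (intro sum_mono bounded_finite)
  finally have "\<bar>(\<Sum>r<t. c (act \<alpha> k r x)) / real T\<bar> \<le> real t * (\<Sum>b\<in>UNIV. \<bar>c b\<bar>) / real T"
    by (simp add: divide_right_mono)
  moreover have "\<bar>(if P then a else b) - x\<bar> \<le> \<bar>a\<bar> + \<bar>b\<bar> + z" if "\<bar>x\<bar> \<le> z" for P and a b x z :: real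
    using that by (cases P) auto
  ultimately show ?thesis unfolding \<Phi>_def by blast
qed

lemma \<Phi>_step:
  assumes h: "h \<in> space (hspace X (t * k))"
  shows "(\<integral>y. \<Phi> \<alpha> (Suc t) (join k t h y) \<partial>block k t (\<alpha> t h))
    = (if rejected s k t h then rej (T - Suc t)
       else reject_prob s k t (\<alpha> t h) * rej (T - Suc t) + (1 - reject_prob s k t (\<alpha> t h)) * unrej (T - Suc t))
      - c (\<alpha> t h) / real T - (\<Sum>r<t. c (act \<alpha> k r h)) / real T"
proof -
  interpret P: prob_space "block k t (\<alpha> t h)" by (rule prob_block)
  let ?A = "rej (T - Suc t)" and ?B = "unrej (T - Suc t)"
  let ?C = "c (\<alpha> t h) / real T + (\<Sum>r<t. c (act \<alpha> k r h)) / real T"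
  have "Measurable.pred (PiM {t * k..<Suc t * k} (\<lambda>_. sig X)) (\<lambda>y. rejected s k (Suc t) (join k t h y))"
    by (rule measurable_compose[OF measurable_join2[OF h] rejected_measurable]) simp
  then have [measurable]: "Measurable.pred (block k t (\<alpha> t h)) (\<lambda>y. rejected s k (Suc t) (join k t h y))"
    by (rule measurable_block)
  have i: "integrable (block k t (\<alpha> t h)) (\<lambda>y. if rejected s k (Suc t) (join k t h y) then ?A else ?B)"
    by (rule P.integrable_const_bound[where B="\<bar>?A\<bar> + \<bar>?B\<bar>"]) auto
  have "\<Phi> \<alpha> (Suc t) (join k t h y) = (if rejected s k (Suc t) (join k t h y) then ?A else ?B) - ?C" for y
    by (simp add: \<Phi>_def act_merge act_hspace[OF h] add_divide_distrib del: unrej.simps)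
  then show ?thesis
    using i by (simp add: P.prob_space integral_rejected del: unrej.simps)
qed

text \<open>After a rejection no action costs less than \<open>amin\<close>, whose cost is built
  into \<open>rej\<close>; before one, \<open>best_action\<close> applies.\<close>

lemma \<Phi>_decreasing:
  assumes \<alpha>: "is_strategy X k T \<alpha>" and t: "t < T"
  shows "(\<integral>x. \<Phi> \<alpha> (Suc t) x \<partial>path \<mu> X k \<alpha> (Suc t)) \<le> (\<integral>x. \<Phi> \<alpha> t x \<partial>path \<mu> X k \<alpha> t)"
proof (rule integral_path_Suc_mono[OF is_strategy_mono[OF \<alpha>] \<Phi>_measurable[OF \<alpha>] \<Phi>_bounded])
  show "integrable (path \<mu> X k \<alpha> t) (\<Phi> \<alpha> t)"
    using t by (intro integrable_path[OF is_strategy_mono[OF \<alpha>] \<Phi>_measurable[OF \<alpha>] \<Phi>_bounded]) auto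
  fix h assume h: "h \<in> space (hspace X (t * k))"
  have "rej (T - Suc t) - c (\<alpha> t h) / real T \<le> rej (T - t)"
  proof -
    have "c amin / real T \<le> c (\<alpha> t h) / real T" using amin by (intro divide_right_mono) auto
    moreover have "rej (T - t) = rej (T - Suc t) - c amin / real T"
      using t by (simp add: rej_def of_nat_diff Suc_diff_Suc[symmetric] field_simps)
    ultimately show ?thesis by simp
  qed
  then show "(\<integral>y. \<Phi> \<alpha> (Suc t) (join k t h y) \<partial>block k t (\<alpha> t h)) \<le> \<Phi> \<alpha> t h"
    unfolding \<Phi>_step[OF h] using best_action[OF t, of "\<alpha> t h"] by (simp add: \<Phi>_def)
qed (use t in auto)

lemma strategy: "is_strategy X k t strategy"
  unfolding is_strategy_def
proof (intro allI impI)
  fix r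
  have [measurable]: "Measurable.pred (hspace X (r * k)) (rejected s k r)"
    by (rule rejected_measurable) simp
  show "strategy r \<in> hspace X (r * k) \<rightarrow>\<^sub>M count_space UNIV"
    unfolding strategy_def[abs_def] by measurable
qed

lemma \<Phi>_martingale:
  assumes t: "t < T"
  shows "(\<integral>x. \<Phi> strategy (Suc t) x \<partial>path \<mu> X k strategy (Suc t)) = (\<integral>x. \<Phi> strategy t x \<partial>path \<mu> X k strategy t)"
proof -
  have "(\<integral>x. \<Phi> strategy (Suc t) x \<partial>path \<mu> X k strategy (Suc t))
    = (\<integral>h. \<integral>y. \<Phi> strategy (Suc t) (join k t h y) \<partial>block k t (strategy t h) \<partial>path \<mu> X k strategy t)"
    by (rule integral_path_Suc[OF strategy \<Phi>_measurable[OF strategy] \<Phi>_bounded]) (use t in auto)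
  also have "\<dots> = (\<integral>x. \<Phi> strategy t x \<partial>path \<mu> X k strategy t)"
  proof (intro Bochner_Integration.integral_cong refl)
    fix h assume "h \<in> space (path \<mu> X k strategy t)"
    then have h: "h \<in> space (hspace X (t * k))" by (simp add: space_path[OF strategy])
    \<comment> \<open>\<open>unrej\<close> recurses over the remaining periods,
      \<open>strategy\<close> over the elapsed ones; these identities match the two indices.\<close>
    have T: "T - t = Suc (T - Suc t)" "T - Suc (T - Suc t) = t" using t by auto
    show "(\<integral>y. \<Phi> strategy (Suc t) (join k t h y) \<partial>block k t (strategy t h)) = \<Phi> strategy t h"
      unfolding \<Phi>_step[OF h] unfolding \<Phi>_def
      by (simp add: strategy_def T rej_def algebra_simps add_divide_distrib)
  qed
  finally show ?thesis .
qed

lemma \<Phi>_0: "is_strategy X k T \<alpha> \<Longrightarrow> (\<integral>x. \<Phi> \<alpha> 0 x \<partial>path \<mu> X k \<alpha> 0) = unrej T"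
  using prob_space.prob_space[OF prob_path[OF is_strategy_mono, of k T \<alpha> 0]]
  by (simp add: \<Phi>_def[abs_def] rejected_def del: path.simps)

lemma agent_util_\<Phi>: "agent_util \<mu> X T (k * T) c \<alpha> contract = (\<integral>x. \<Phi> \<alpha> T x \<partial>path \<mu> X k \<alpha> T)"
  unfolding agent_util_def mult_div \<Phi>_def contract_def by (simp add: rej_def cong: if_cong)

lemma contract_optimal:
  assumes \<alpha>: "is_strategy X k T \<alpha>"
  shows "agent_util \<mu> X T (k * T) c \<alpha> contract \<le> unrej T"
proof -
  have "(\<integral>x. \<Phi> \<alpha> t x \<partial>path \<mu> X k \<alpha> t) \<le> unrej T" if "t \<le> T" for t
    using that
  proof (induction t)
    case 0 then show ?case using \<Phi>_0[OF \<alpha>] by simp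
  next
    case (Suc t) then show ?case using \<Phi>_decreasing[OF \<alpha>, of t] by simp
  qed
  then show ?thesis unfolding agent_util_\<Phi> by simp
qed

lemma strategy_value: "agent_util \<mu> X T (k * T) c strategy contract = unrej T"
proof -
  have "(\<integral>x. \<Phi> strategy t x \<partial>path \<mu> X k strategy t) = unrej T" if "t \<le> T" for t
    using that
  proof (induction t)
    case 0 then show ?case using \<Phi>_0[OF strategy] by simp
  next
    case (Suc t) then show ?case using \<Phi>_martingale[of t] by simp
  qed
  then show ?thesis unfolding agent_util_\<Phi> by simp
qed

text \<open>The (IR) constraint. The total extra cost \<open>T * d\<close> cancels against the
  difference of costs, and the premium of \<open>vH\<close> over \<open>c astar\<close> covers the
  false alarms.\<close>

lemma unrej_nonneg: "0 \<le> unrej T"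
proof -
  have "real T * d = c astar - c amin" "rej T = u w - c amin" using T_pos by (auto simp: d_def rej_def)
  then show ?thesis using gap_bounds[of T] vH(2) by (simp add: D_def[symmetric]) (simp add: D_def)
qed

section \<open>Feasibility, false alarms and the principal's payoff\<close>

lemma contract_values: "contract x \<in> {u w, vH}"
  by (simp add: contract_def)

lemma contract_measurable: "contract \<in> borel_measurable (hspace X (T * k))"
proof -
  have [measurable]: "Measurable.pred (hspace X (T * k)) (rejected s k T)"
    by (rule rejected_measurable) simp
  show ?thesis unfolding contract_def[abs_def] by measurable
qed

lemma contract_integrable:
  "is_strategy X k T \<alpha> \<Longrightarrow> integrable (path \<mu> X k \<alpha> T) (\<lambda>x. f (contract x) :: real)"
proof (rule integrable_path[where B="\<bar>f (u w)\<bar> + \<bar>f vH\<bar>"])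
  have [measurable]: "Measurable.pred (hspace X (T * k)) (rejected s k T)"
    by (rule rejected_measurable) simp
  show "(\<lambda>x. f (contract x)) \<in> borel_measurable (hspace X (T * k))"
    unfolding contract_def[abs_def] if_distrib[of f] by measurable
qed (auto simp: contract_def)

lemma feasible: "sb_feasible \<mu> X T (k * T) u w c strategy contract"
proof -
  have "is_contract X (k * T) u w contract"
    using contract_measurable contract_values vH(1) unfolding is_contract_def hspace_commute by fastforce
  then show ?thesis
    using strategy contract_integrable[of _ "\<lambda>v. v"] contract_integrable[OF strategy, of "hinv u w"] contract_optimal unrej_nonneg
    by (auto simp: sb_feasible_def fb_feasible_def mult_div strategy_value)
qed

lemma rejected_prob:
  "t \<le> T \<Longrightarrow> (\<integral>x. (if rejected s k t x then 1 else 0) \<partial>path \<mu> X k strategy t) \<le> real t * q"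
proof (induction t)
  case 0 then show ?case by (simp add: rejected_def del: path.simps)
next
  case (Suc t)
  interpret P: prob_space "path \<mu> X k strategy t" by (rule prob_path[OF strategy])
  have m: "Measurable.pred (hspace X (r * k)) (rejected s k r)" for r
    by (rule rejected_measurable) simp
  have i: "integrable (path \<mu> X k strategy t) (\<lambda>h. if rejected s k t h then 1 else 0 :: real)"
    by (rule integrable_path[OF strategy, where B=1]) (use m[of t] in auto)
  have "(\<integral>x. (if rejected s k (Suc t) x then 1 else 0) \<partial>path \<mu> X k strategy (Suc t))
    \<le> (\<integral>h. (if rejected s k t h then 1 else 0) + q \<partial>path \<mu> X k strategy t)"
  proof (rule integral_path_Suc_mono[OF strategy, where B=1])
    show "(\<lambda>x. if rejected s k (Suc t) x then 1 else 0 :: real) \<in> borel_measurable (hspace X (Suc t * k))"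
      using m[of "Suc t"] by measurable
    show "integrable (path \<mu> X k strategy t) (\<lambda>h. (if rejected s k t h then 1 else 0 :: real) + q)"
      using i by auto
    fix h
    show "(\<integral>y. (if rejected s k (Suc t) (join k t h y) then 1 else 0) \<partial>block k t (strategy t h))
      \<le> (if rejected s k t h then 1 else 0) + q"
      unfolding integral_rejected using q(1) q(2)[of t] Suc.prems by (simp add: strategy_def)
  qed auto
  also have "\<dots> = (\<integral>h. (if rejected s k t h then 1 else 0) \<partial>path \<mu> X k strategy t) + q"
    using i by (simp add: P.prob_space)
  also have "\<dots> \<le> real (Suc t) * q" using Suc by (simp add: algebra_simps)
  finally show ?case .
qed

text \<open>A rejection changes the average gain by at most twice the bound on \<open>g\<close>, and
  the wage only drops; on the intended path it has probability at most \<open>T * q\<close>.\<close>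

lemma payoff:
  "g astar - hinv u w vH - 2 * (\<Sum>b\<in>UNIV. \<bar>g b\<bar>) * (real T * q)
    \<le> princ_pay \<mu> X T (k * T) u w g strategy contract"
proof -
  interpret P: prob_space "path \<mu> X k strategy T" by (rule prob_path[OF strategy])
  define G where "G = (\<Sum>b\<in>UNIV. \<bar>g b\<bar>)"
  have gG: "\<bar>g b\<bar> \<le> G" for b unfolding G_def by (rule bounded_finite)
  then have gl: "- G \<le> g b" for b using abs_le_D2[of "g b" G] by (simp add: minus_le_iff[of G])
  define R :: "(nat \<Rightarrow> 'x) \<Rightarrow> real" where "R x = (if rejected s k T x then 1 else 0)" for x
  have iR: "integrable (path \<mu> X k strategy T) R"
    unfolding R_def by (rule integrable_path[OF strategy, where B=1])
       (use rejected_measurable[of T k "T * k" s] in auto)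
  have "g astar - hinv u w vH - 2 * G * (real T * q)
    \<le> g astar - hinv u w vH - 2 * G * (\<integral>x. R x \<partial>path \<mu> X k strategy T)"
    using rejected_prob[of T, folded R_def] gG[of astar] by (intro diff_left_mono mult_left_mono) auto
  also have "\<dots> = (\<integral>x. g astar - hinv u w vH - 2 * G * R x \<partial>path \<mu> X k strategy T)"
    using iR by (simp add: P.prob_space)
  also have "\<dots> \<le> princ_pay \<mu> X T (k * T) u w g strategy contract"
    unfolding princ_pay_def mult_div
  proof (rule integral_mono)
    show "integrable (path \<mu> X k strategy T) (\<lambda>x. g astar - hinv u w vH - 2 * G * R x)"
      using iR by (intro Bochner_Integration.integrable_diff integrable_mult_right) auto
    show "integrable (path \<mu> X k strategy T)
      (\<lambda>x. (\<Sum>t<T. g (act strategy k t x)) / real T - hinv u w (contract x))"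
      by (rule Bochner_Integration.integrable_diff[OF integrable_avg[OF strategy] contract_integrable[OF strategy, of "hinv u w"]])
    fix x
    show "g astar - hinv u w vH - 2 * G * R x
      \<le> (\<Sum>t<T. g (act strategy k t x)) / real T - hinv u w (contract x)"
    proof (cases "rejected s k T x")
      case True
      have "(\<Sum>t<T. - G) \<le> (\<Sum>t<T. g (act strategy k t x))"
        by (intro sum_mono gl)
      then have "- G \<le> (\<Sum>t<T. g (act strategy k t x)) / real T" using T_pos by (simp add: field_simps)
      moreover have "hinv u w (contract x) = w" using True by (simp add: contract_def hinv_u)
      moreover have "w \<le> hinv u w vH" by (rule hinv_ge[OF vH(1)])
      ultimately show ?thesis using gG[of astar] True by (simp add: R_def)
    next
      case False
      have "act strategy k t x = astar" if "t < T" for t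
      proof -
        have "\<not> rejected s k t x" using False that by (auto simp: rejected_def)
        then show ?thesis by (simp add: act_def strategy_def rejected_restrict)
      qed
      then have "(\<Sum>t<T. g (act strategy k t x)) / real T = g astar" using T_pos by simp
      then show ?thesis using False by (simp add: contract_def R_def)
    qed
  qed
  finally show ?thesis by (simp add: G_def)
qed

text \<open>Both payments must occur at actual signal vectors. A positive rejection probability
  provides a rejected first block, and a false-alarm probability below \<open>1\<close> provides a
  vector that is never rejected.\<close>

lemma two_values:
  assumes X: "reject_prob s k 0 a > 0"
  shows "card (contract ` space (hspace X (k * T))) = 2"
proof -
  have "\<exists>y\<in>space (PiM {0 * k..<Suc 0 * k} (\<lambda>_. sig X)). rejects s k 0 y"
  proof (rule ccontr)
    assume "\<not> ?thesis"
    then have "{y \<in> space (PiM {0 * k..<Suc 0 * k} (\<lambda>_. sig X)). rejects s k 0 y} = {}" by auto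
    then have "reject_prob s k 0 a = 0" unfolding reject_prob_def by (simp only: measure_empty)
    then show False using X by simp
  qed
  then obtain y where y: "y \<in> space (PiM {0 * k..<Suc 0 * k} (\<lambda>_. sig X))" "rejects s k 0 y" by auto
  \<comment> \<open>Repeating the rejected block fills the other periods with signals that lie in
    \<open>X\<close>.\<close>
  define x where "x = restrict (\<lambda>i. y (i mod k)) {..<k * T}"
  have x: "x \<in> space (hspace X (k * T))"
    unfolding hspace_def space_PiM x_def
  proof (rule restrict_PiE[THEN iffD2], rule Pi_I)
    fix i assume i: "i \<in> {..<k * T}"
    then have "k > 0" by (cases k) auto
    then have "i mod k \<in> {0 * k..<Suc 0 * k}" by (simp add: mult_Suc)
    then show "y (i mod k) \<in> space (sig X)" using y(1) by (auto simp: space_PiM)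
  qed
  have "rejects s k 0 x = rejects s k 0 y"
  proof (rule rejects_cong)
    fix i assume i: "i \<in> {0 * k..<Suc 0 * k}"
    then have "i < k" by (simp add: mult_Suc)
    moreover have "i < k * T" by (rule less_le_trans[OF \<open>i < k\<close>]) (use T_pos in simp)
    ultimately show "x i = y i" by (simp add: x_def)
  qed
  then have "rejected s k T x" using y T_pos by (auto simp: rejected_def)
  then have 1: "u w \<in> contract ` space (hspace X (k * T))"
    using imageI[OF x, of contract] by (simp add: contract_def)
  have "\<exists>x\<in>space (hspace X (k * T)). \<not> rejected s k T x"
  proof (rule ccontr)
    interpret P: prob_space "path \<mu> X k strategy T" by (rule prob_path[OF strategy])
    assume "\<not> ?thesis"
    then have "(\<integral>x. (if rejected s k T x then 1 else 0) \<partial>path \<mu> X k strategy T)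
        = (\<integral>x. (1::real) \<partial>path \<mu> X k strategy T)"
      by (intro Bochner_Integration.integral_cong) (auto simp: space_path[OF strategy] hspace_commute)
    then show False using rejected_prob[of T] q(3) by (simp add: P.prob_space)
  qed
  then obtain x' where x': "x' \<in> space (hspace X (k * T))" "\<not> rejected s k T x'" by blast
  then have 2: "vH \<in> contract ` space (hspace X (k * T))"
    using imageI[OF x'(1), of contract] by (simp add: contract_def)
  have "contract ` space (hspace X (k * T)) \<subseteq> {u w, vH}"
    using contract_values by (intro image_subsetI)
  then have "contract ` space (hspace X (k * T)) = {u w, vH}" using 1 2 by blast
  then show ?thesis using D_pos by (simp add: D_def)
qed

end

section \<open>Rates of convergence\<close>

context agency
begin

lemma KL_pos: "c a < c astar \<Longrightarrow> 0 < KL (\<mu> a) (\<mu> astar)"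
proof -
  assume a: "c a < c astar"
  interpret L: likelihood_ratio "\<mu> astar" "\<mu> a" "ratio a" by (rule likelihood)
  show ?thesis using L.info_pos distinct a by (auto simp: L.KL_eq_info dest: injD)
qed

lemma exp_tendsto_0: "0 < s \<Longrightarrow> (\<lambda>k. exp (- s * real k)) \<longlonglongrightarrow> 0"
proof -
  assume "0 < s"
  then have "(\<lambda>k. exp (- s) ^ k) \<longlonglongrightarrow> 0" by (intro LIMSEQ_realpow_zero) auto
  then show ?thesis by (simp add: exp_of_nat_mult[symmetric] mult.commute)
qed

text \<open>As \<open>k\<close> grows, both error probabilities vanish while the agent's stakes stay
  bounded away from zero, so the conditions of \<open>binary_contract\<close> hold eventually. The
  loss consists of the wage premium and the false alarms, both of order \<open>q k\<close>.\<close>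

lemma loss_upper:
  assumes s: "0 < s" "\<And>a. c a < c astar \<Longrightarrow> s < KL (\<mu> a) (\<mu> astar)"
  shows "\<exists>C>0. \<forall>\<^sub>F k in sequentially. \<exists>\<alpha> v. sb_feasible \<mu> X T (k * T) u w c \<alpha> v
    \<and> card (v ` space (hspace X (k * T))) = 2
    \<and> GFB - C * exp (- s * real k) \<le> princ_pay \<mu> X T (k * T) u w g \<alpha> v"
proof -
  define q where "q k = real CARD('a) * exp (- s * real k)" for k
  \<comment> \<open>The sum over all actions dominates the missed-detection bound of each cheaper
    action at once.\<close>
  define \<delta> where "\<delta> k = (\<Sum>a\<in>UNIV. likelihood_ratio.info_var (\<mu> a) (ratio a) /
      (real k * (KL (\<mu> a) (\<mu> astar) - s)\<^sup>2))" for k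
  have q0: "0 \<le> q k" for k by (simp add: q_def)
  have q_lim: "q \<longlonglongrightarrow> 0"
    unfolding q_def[abs_def] using tendsto_mult[OF tendsto_const exp_tendsto_0[OF s(1)]] by force
  have v0: "0 \<le> likelihood_ratio.info_var (\<mu> a) (ratio a)" for a
  proof -
    interpret L: likelihood_ratio "\<mu> astar" "\<mu> a" "ratio a" by (rule likelihood)
    show ?thesis unfolding L.info_var_def by simp
  qed
  have \<delta>_lim: "\<delta> \<longlonglongrightarrow> 0"
  proof -
    have "(\<lambda>k. V / (real k * W)) \<longlonglongrightarrow> 0" for V W
    proof -
      have "(\<lambda>k. V / W * (1 / real k)) \<longlonglongrightarrow> V / W * 0"
        by (intro tendsto_mult tendsto_const lim_1_over_n)
      then show ?thesis by (simp add: mult.commute)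
    qed
    then show ?thesis unfolding \<delta>_def[abs_def] by (intro tendsto_null_sum)
  qed
  have "Min (range c) \<in> range c" by (intro Min_in) auto
  then obtain amin where "Min (range c) = c amin" by (rule imageE)
  then have amin: "c amin \<le> c a" for a using Min_le[of "range c" "c a"] by simp
  obtain a0 where a0: "c a0 < c astar" using c_lower by auto
  define d where "d = (c astar - c amin) / real T"
  have d: "0 < d" using a0 amin[of a0] T_pos by (simp add: d_def)
  have Td: "real T * d = c astar - c amin" using T_pos by (simp add: d_def)
  \<comment> \<open>Room above \<open>c astar\<close>: \<open>vH\<close> is attained by a wage up to
    \<open>y1\<close>, where the slope of \<open>u\<close> is at least \<open>u' y1\<close>.\<close>
  obtain y1 where y1: "ystar < y1" "c astar < u y1"
    using hinv_interior(3)[of "c astar"] c_int by (auto simp: ystar_def)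
  \<comment> \<open>The premium in \<open>vH\<close> should cover losses proportional to
    \<open>vH - u w\<close>, which itself depends on the premium. Capping the premium by
    \<open>1\<close> replaces that stake by the constant \<open>D0\<close>.\<close>
  define D0 where "D0 = c astar + 1 - u w"
  define vH where "vH k = c astar + real T * q k * D0" for k
  define M where "M k = (c astar - u w) - (real T - 1) * d - real T * q k * D0" for k
  have D0: "0 < D0" using c_gt[of astar] by (simp add: D0_def)
  have b_lim: "(\<lambda>k. real T * q k * D0) \<longlonglongrightarrow> 0"
    using tendsto_mult[OF tendsto_mult[OF tendsto_const q_lim] tendsto_const] by force
  \<comment> \<open>The limit of the smallest stake. It exceeds \<open>d\<close> by exactly
    \<open>c amin - u w\<close>, which is positive.\<close>
  define m where "m = (c astar - u w) - (real T - 1) * d"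
  have m: "d < m" using Td c_gt[of amin] by (simp add: m_def algebra_simps)
  have M_lim: "M \<longlonglongrightarrow> m"
    unfolding M_def[abs_def] m_def using tendsto_diff[OF tendsto_const b_lim] by force
  have "(\<lambda>k. (1 - \<delta> k - q k) * M k) \<longlonglongrightarrow> (1 - 0 - 0) * m"
    by (intro tendsto_mult tendsto_diff tendsto_const \<delta>_lim q_lim M_lim)
  then have ev1: "\<forall>\<^sub>F k in sequentially. d < (1 - \<delta> k - q k) * M k"
    using m by (intro order_tendstoD) auto
  have ev2: "\<forall>\<^sub>F k in sequentially. 0 < M k"
    using m d by (intro order_tendstoD(1)[OF M_lim]) auto
  have "(\<lambda>k. \<delta> k + q k) \<longlonglongrightarrow> 0 + 0" by (intro tendsto_add \<delta>_lim q_lim)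
  then have ev3: "\<forall>\<^sub>F k in sequentially. \<delta> k + q k < 1" by (intro order_tendstoD) auto
  have "\<forall>\<^sub>F k in sequentially. \<forall>a\<in>{a. c astar < c a}. real T * q k * D0 < c a - c astar"
    by (intro eventually_ball_finite ballI order_tendstoD(2)[OF b_lim]) auto
  then have ev4: "\<forall>\<^sub>F k in sequentially. \<forall>a. c astar < c a \<longrightarrow> real T * q k * D0 < c a - c astar"
    by simp
  have ev5: "\<forall>\<^sub>F k in sequentially. real T * q k * D0 < min 1 (u y1 - c astar)"
    using y1 by (intro order_tendstoD(2)[OF b_lim]) auto
  have "(\<lambda>k. real T * q k) \<longlonglongrightarrow> real T * 0" by (intro tendsto_mult tendsto_const q_lim)
  then have ev6: "\<forall>\<^sub>F k in sequentially. real T * q k < 1" by (intro order_tendstoD) auto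
  define G where "G = (\<Sum>b\<in>UNIV. \<bar>g b\<bar>)"
  \<comment> \<open>\<open>D0 / u' y1\<close> prices the premium in wages and \<open>2 * G\<close>
    the disrupted gains; the final \<open>1\<close> ensures positivity.\<close>
  define C where "C = real CARD('a) * real T * (D0 / u' y1 + 2 * G) + 1"
  have uy1: "0 < u' y1" using u'_pos[of y1] y1 ystar by simp
  have "0 \<le> G" by (simp add: G_def sum_nonneg)
  then have C: "0 < C" using D0 uy1 unfolding C_def by (intro add_nonneg_pos mult_nonneg_nonneg add_nonneg_nonneg) auto
  have "\<forall>\<^sub>F k in sequentially. \<exists>\<alpha> v. sb_feasible \<mu> X T (k * T) u w c \<alpha> v
    \<and> card (v ` space (hspace X (k * T))) = 2
    \<and> GFB - C * exp (- s * real k) \<le> princ_pay \<mu> X T (k * T) u w g \<alpha> v"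
    using ev1 ev2 ev3 ev4 ev5 ev6 eventually_gt_at_top[of 0]
  proof eventually_elim
    case (elim k)
    have Tq: "0 \<le> real T * q k" using q0 by simp
    have vH1: "c astar \<le> vH k" "vH k \<le> u y1" "vH k - u w \<le> D0"
      using elim(5) Tq D0 by (auto simp: vH_def D0_def[symmetric]) (auto simp: D0_def)
    have TqD: "real T * q k * (vH k - u w) \<le> real T * q k * D0"
      by (rule mult_left_mono[OF vH1(3) Tq])
    have vH2: "vH k \<in> u ` {w..}"
      using y1 ystar vH1 c_gt[of astar] by (intro range_downward[of y1]) auto
    interpret B: binary_contract \<mu> X u u' u'' w c g astar T k s "vH k" "q k" "\<delta> k" "M k" amin
    proof
      show "c astar + real T * q k * (vH k - u w) \<le> vH k" using TqD by (simp add: vH_def)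
      show "reject_prob s k t astar \<le> q k" for t
        unfolding q_def by (rule reject_prob_astar)
      show "1 - \<delta> k \<le> reject_prob s k t a" if "c a < c astar" for a t
      proof -
        have "likelihood_ratio.info_var (\<mu> a) (ratio a) / (real k * (KL (\<mu> a) (\<mu> astar) - s)\<^sup>2) \<le> \<delta> k"
          unfolding \<delta>_def using v0
          by (intro member_le_sum[of a UNIV "\<lambda>a. likelihood_ratio.info_var (\<mu> a) (ratio a) / (real k * (KL (\<mu> a) (\<mu> astar) - s)\<^sup>2)"]) auto
        then show ?thesis using reject_prob_shirk[OF that elim(7) s(2)[OF that], of t] by simp
      qed
      show "real T * q k * (vH k - u w) \<le> c a - c astar" if "c astar < c a" for a
        using TqD elim(4) that by fastforce
      show "M k \<le> vH k - u w - (real T - 1) * ((c astar - c amin) / real T) - real T * q k * (vH k - u w)"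
        using TqD vH1(1) by (simp add: M_def d_def)
      show "(c astar - c amin) / real T \<le> (1 - \<delta> k - q k) * M k"
        using elim(1) by (simp add: d_def)
    qed (use amin vH2 q0 elim in auto)
    have "0 < reject_prob s k 0 a0" using B.\<delta>[of 0 a0] a0 T_pos elim(3) q0[of k] by simp
    from B.two_values[OF this] have two: "card (B.contract ` space (hspace X (k * T))) = 2" .
    have h: "ystar \<le> hinv u w (vH k)" "hinv u w (vH k) \<le> y1"
      using u_le_cancel[of ystar "hinv u w (vH k)"] u_le_cancel[of "hinv u w (vH k)" y1]
        vH1 ystar y1 hinv_ge[OF vH2] u_hinv[OF vH2] by auto
    have "u' y1 * (hinv u w (vH k) - ystar) \<le> vH k - c astar"
      using slope_lower[of ystar "hinv u w (vH k)" y1] h ystar u_hinv[OF vH2] by simp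
    then have "hinv u w (vH k) - ystar \<le> real T * q k * D0 / u' y1"
      using uy1 by (simp add: vH_def field_simps)
    moreover have "real T * q k * D0 / u' y1 + 2 * G * (real T * q k) \<le> C * exp (- s * real k)"
    proof -
      have "real T * q k * D0 / u' y1 + 2 * G * (real T * q k)
        = (real CARD('a) * real T * (D0 / u' y1 + 2 * G)) * exp (- s * real k)"
        by (simp add: q_def algebra_simps)
      also have "\<dots> \<le> C * exp (- s * real k)" by (intro mult_right_mono) (auto simp: C_def)
      finally show ?thesis .
    qed
    ultimately have "GFB - C * exp (- s * real k) \<le> princ_pay \<mu> X T (k * T) u w g B.strategy B.contract"
      using B.payoff by (simp add: GFB_def G_def)
    then show ?case using B.feasible two by blast
  qed
  then show ?thesis using C by blast
qed

text \<open>The binary contract bounds the smaller value \<open>G_bin\<close> from below, and the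
  deviation argument bounds the larger value \<open>G_SB\<close> from above. The comparison of the
  two values lets each estimate serve both rates.\<close>

lemma rates:
  fixes K :: real
  defines "K \<equiv> Min {KL (\<mu> a) (\<mu> astar) |a. c a < c astar}"
  shows "0 < K"
    and "\<And>s. K < s \<Longrightarrow> \<exists>C>0. \<forall>\<^sub>F k in sequentially. C * exp (- s * real k) \<le> GFB - G_SB \<mu> X T (k * T) u w c g"
    and "\<And>s. 0 < s \<Longrightarrow> s < K \<Longrightarrow> \<exists>C>0. \<forall>\<^sub>F k in sequentially. GFB - G_bin \<mu> X T (k * T) u w c g \<le> C * exp (- s * real k)"
    and "\<forall>\<^sub>F k in sequentially. G_bin \<mu> X T (k * T) u w c g \<le> G_SB \<mu> X T (k * T) u w c g"
proof -
  let ?S = "{KL (\<mu> a) (\<mu> astar) |a. c a < c astar}"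
  have fin: "finite ?S" by simp
  have ne: "?S \<noteq> {}" using c_lower by auto
  have "K \<in> ?S" unfolding K_def by (rule Min_in[OF fin ne])
  then obtain a where a: "c a < c astar" "K = KL (\<mu> a) (\<mu> astar)" by auto
  show K0: "0 < K" using KL_pos[OF a(1)] a(2) by simp
  have K_le: "K \<le> KL (\<mu> b) (\<mu> astar)" if "c b < c astar" for b
    unfolding K_def using that by (intro Min_le[OF fin]) auto
  let ?SB = "\<lambda>k. {princ_pay \<mu> X T (k * T) u w g \<alpha> v | \<alpha> v. sb_feasible \<mu> X T (k * T) u w c \<alpha> v}"
  let ?bin = "\<lambda>k. {princ_pay \<mu> X T (k * T) u w g \<alpha> v | \<alpha> v. sb_feasible \<mu> X T (k * T) u w c \<alpha> v
     \<and> card (v ` space (hspace X (k * T))) = 2}"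
  have bdd: "bdd_above (?SB k)" for k
    using princ_pay_le by (intro bdd_aboveI[of _ "(\<Sum>a\<in>UNIV. \<bar>g a\<bar>) - w"]) (auto simp: sb_feasible_def)
  have sub: "?bin k \<subseteq> ?SB k" for k by blast
  have up: "\<exists>C>0. \<forall>\<^sub>F k in sequentially. ?bin k \<noteq> {} \<and> GFB - G_bin \<mu> X T (k * T) u w c g \<le> C * exp (- s * real k)"
    if s: "0 < s" "s < K" for s
  proof -
    obtain C where C: "C > 0" "\<forall>\<^sub>F k in sequentially. \<exists>\<alpha> v. sb_feasible \<mu> X T (k * T) u w c \<alpha> v
      \<and> card (v ` space (hspace X (k * T))) = 2
      \<and> GFB - C * exp (- s * real k) \<le> princ_pay \<mu> X T (k * T) u w g \<alpha> v"
      using loss_upper[OF s(1) less_le_trans[OF s(2) K_le]] by blast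
    from C(2) have "\<forall>\<^sub>F k in sequentially. ?bin k \<noteq> {} \<and> GFB - G_bin \<mu> X T (k * T) u w c g \<le> C * exp (- s * real k)"
    proof eventually_elim
      case (elim k)
      then obtain z where z: "z \<in> ?bin k" "GFB - C * exp (- s * real k) \<le> z" by blast
      have "z \<le> G_bin \<mu> X T (k * T) u w c g"
        unfolding G_bin_def by (rule cSup_upper[OF z(1) bdd_above_mono[OF bdd sub]])
      then show ?case using z by auto
    qed
    then show ?thesis using C(1) by blast
  qed
  show "\<exists>C>0. \<forall>\<^sub>F k in sequentially. GFB - G_bin \<mu> X T (k * T) u w c g \<le> C * exp (- s * real k)"
    if s: "0 < s" "s < K" for s
    using up[OF s] unfolding eventually_conj_iff by blast
  \<comment> \<open>\<open>Sup\<close> of the empty set of reals is unspecified, so comparing the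
    two suprema needs a feasible binary contract, which exists for large \<open>k\<close>.\<close>
  have nonempty: "\<forall>\<^sub>F k in sequentially. ?bin k \<noteq> {}"
    using up[of "K / 2"] K0 unfolding eventually_conj_iff by auto
  then show "\<forall>\<^sub>F k in sequentially. G_bin \<mu> X T (k * T) u w c g \<le> G_SB \<mu> X T (k * T) u w c g"
  proof eventually_elim
    case (elim k)
    then show ?case unfolding G_bin_def G_SB_def by (rule cSup_subset_mono[OF _ bdd sub])
  qed
  show "\<exists>C>0. \<forall>\<^sub>F k in sequentially. C * exp (- s * real k) \<le> GFB - G_SB \<mu> X T (k * T) u w c g"
    if s: "K < s" for s
  proof -
    obtain C where C: "C > 0" "\<forall>\<^sub>F k in sequentially. \<forall>\<alpha> v. sb_feasible \<mu> X T (k * T) u w c \<alpha> v \<longrightarrow>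
      princ_pay \<mu> X T (k * T) u w g \<alpha> v \<le> GFB - C * exp (- s * real k)"
      using loss_lower[OF a(1) s[unfolded a(2)]] by blast
    have "\<forall>\<^sub>F k in sequentially. C * exp (- s * real k) \<le> GFB - G_SB \<mu> X T (k * T) u w c g"
      using C(2) nonempty
    proof eventually_elim
      case (elim k)
      then have "?SB k \<noteq> {}" using sub[of k] by blast
      then have "G_SB \<mu> X T (k * T) u w c g \<le> GFB - C * exp (- s * real k)"
        unfolding G_SB_def using elim(1) by (intro cSup_least) auto
      then show ?case by simp
    qed
    then show ?thesis using C(1) by blast
  qed
qed

end

text \<open>Multiples of \<open>T\<close> are written \<open>k * T\<close>. Eventual positivity of
  the losses is claimed explicitly because \<open>ln\<close> is total in HOL and the limits alone
  would not imply it.\<close>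

theorem theorem5:
  fixes \<mu> :: "'a::finite \<Rightarrow> 'x::euclidean_space measure"
    and X :: "'x set"
    and T :: nat
    and u u' u'' :: "real \<Rightarrow> real" and w :: real
    and c g :: "'a \<Rightarrow> real"
    and astar :: 'a
  assumes T_pos: "T > 0"
    and prob: "\<And>a. prob_space (\<mu> a)"
    and sets_mu: "\<And>a. sets (\<mu> a) = sets (sig X)"
    and distinct: "inj \<mu>"
    and abs_cont: "\<And>a a'. absolutely_continuous (\<mu> a) (\<mu> a')"
    and moments: "\<And>a a' l. l > 0 \<Longrightarrow>
        integrable (\<mu> a) (\<lambda>x. enn2real (RN_deriv (\<mu> a) (\<mu> a') x) powr l)"
    and rich: "\<And>p a. 0 < p \<Longrightarrow> p < 1 \<Longrightarrow> \<exists>Y\<in>sets (sig X). measure (\<mu> a) Y = p"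
    and u_d1: "\<And>x. x \<ge> w \<Longrightarrow> (u has_real_derivative u' x) (at x within {w..})"
    and u_d2: "\<And>x. x \<ge> w \<Longrightarrow> (u' has_real_derivative u'' x) (at x within {w..})"
    and u''_cont: "continuous_on {w..} u''"
    and u'_pos: "\<And>x. x \<ge> w \<Longrightarrow> u' x > 0"
    and u''_neg: "\<And>x. x \<ge> w \<Longrightarrow> u'' x < 0"
    and u'_lim: "(u' \<longlongrightarrow> 0) at_top"
    and c_int: "range c \<subseteq> interior (u ` {w..})"
    and fb_strict: "\<And>n \<alpha>. n > 0 \<Longrightarrow> T dvd n \<Longrightarrow> is_strategy X (n div T) T \<alpha> \<Longrightarrow>
        \<not> (AE x in path \<mu> X (n div T) \<alpha> T. \<forall>t<T. act \<alpha> (n div T) t x = astar) \<Longrightarrow>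
        fb_value \<mu> X T n u w c g \<alpha> < fb_value \<mu> X T n u w c g (\<lambda>_ _. astar)"
    and c_lower: "\<exists>a. c a < c astar"
    and c_distinct: "\<And>a. a \<noteq> astar \<Longrightarrow> c a \<noteq> c astar"
  shows
    "(let GFB = g astar - hinv u w (c astar);
          r = Min {KL (\<mu> a) (\<mu> astar) | a. c a < c astar} / real T
      in (\<forall>\<^sub>F k in sequentially. GFB - G_SB \<mu> X T (k * T) u w c g > 0)
       \<and> ((\<lambda>k. ln (GFB - G_SB \<mu> X T (k * T) u w c g) / real (k * T)) \<longlonglongrightarrow> - r)
       \<and> (\<forall>\<^sub>F k in sequentially. GFB - G_bin \<mu> X T (k * T) u w c g > 0)
       \<and> ((\<lambda>k. ln (GFB - G_bin \<mu> X T (k * T) u w c g) / real (k * T)) \<longlonglongrightarrow> - r))"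
proof -
  interpret agency \<mu> X u u' u'' w c g astar T
    by (intro agency.intro monitoring.intro static_problem.intro static_problem_axioms.intro
        utility.intro agency_axioms.intro) (fact assms)+
  define K where "K = Min {KL (\<mu> a) (\<mu> astar) |a. c a < c astar}"
  note r = rates[folded K_def]
  \<comment> \<open>Since \<open>G_bin\<close> is eventually at most \<open>G_SB\<close>, the upper
    bound on the binary loss passes to the second-best loss; \<open>bin\<close> transfers the lower
    bound in the opposite direction.\<close>
  have sb: "\<exists>C>0. \<forall>\<^sub>F k in sequentially. GFB - G_SB \<mu> X T (k * T) u w c g \<le> C * exp (- s * real k)"
    if "0 < s" "s < K" for s
  proof -
    obtain C where C: "C > 0"
      "\<forall>\<^sub>F k in sequentially. GFB - G_bin \<mu> X T (k * T) u w c g \<le> C * exp (- s * real k)"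
      using r(3)[OF \<open>0 < s\<close> \<open>s < K\<close>] by blast
    have "\<forall>\<^sub>F k in sequentially. GFB - G_SB \<mu> X T (k * T) u w c g \<le> C * exp (- s * real k)"
      using C(2) r(4) by eventually_elim simp
    then show ?thesis using C(1) by blast
  qed
  have bin: "\<exists>C>0. \<forall>\<^sub>F k in sequentially. C * exp (- s * real k) \<le> GFB - G_bin \<mu> X T (k * T) u w c g"
    if "K < s" for s
  proof -
    obtain C where C: "C > 0"
      "\<forall>\<^sub>F k in sequentially. C * exp (- s * real k) \<le> GFB - G_SB \<mu> X T (k * T) u w c g"
      using r(2)[OF \<open>K < s\<close>] by blast
    have "\<forall>\<^sub>F k in sequentially. C * exp (- s * real k) \<le> GFB - G_bin \<mu> X T (k * T) u w c g"
      using C(2) r(4) by eventually_elim simp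
    then show ?thesis using C(1) by blast
  qed
  show ?thesis
    unfolding Let_def GFB_def[unfolded ystar_def, symmetric] K_def[symmetric]
    using ln_rate_limit[OF T_pos r(1) r(2) sb] ln_rate_limit[OF T_pos r(1) bin r(3)] by blast
qed

end
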